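(* Let $X=(X_t)_{t\ge0}$ be a real Lévy process with characteristics $(a,0,\nu)$ and index $\beta$ such that $\beta>0$ and $\mathbb{E}\,|X_1|^p<+\infty$ for some $p\in(0,\beta)$. Assume that there is $c\in(0,1]$ such that the Lévy measure satisfies $$\mathbf{1}_{\{0<|x|\le c\}}\,\nu(dx)\le\varphi(|x|)\,\mathbf{1}_{\{0<|x|\le c\}}\,dx ,$$ where $\varphi:(0,c]\to(0,\infty)$ is a regularly varying function at zero of index $-(\beta+1)$. Let $l(x)=x^{\beta+1}\varphi(x)$, $x\in(0,c]$, and assume that the function $x\mapsto l(1/x)$, $x\ge 1/c$, is locally bounded. Let $\underline{l}(x)=l(x^{1/\beta})$. (a) Assume $\beta>1$. Then as $t\to0$, for every $r\in(\beta,2]$ and $q\in[p\vee1,\beta)$, $$\mathbb{E}\,\sup_{s\le t}|X_s|^p=O\left(t^{p/\beta}\left[\underline{l}(t)^{p/r}+\underline{l}(t)^{p/q}\right]\right)\quad\text{if }\beta<2,$$ and for every $q\in[p\vee1,\beta)$, $$\mathbb{E}\,\sup_{s\le t}|X_s|^p=O\left(t^{p/\beta}\left[1+\underline{l}(t)^{p/q}\right]\right)\quad\text{if }\beta=2.$$ If $\nu$ is symmetric, then this holds for every $q\in[p,\beta)$. (b) Assume $\beta<1$. Then as $t\to0$, for every $r\in(\beta,1]$ and $q\in[p,\beta)$, $$\mathbb{E}\,\sup_{s\le t}|Y_s|^p=O\left(t^{p/\beta}\left[\underline{l}(t)^{p/r}+\underline{l}(t)^{p/q}\right]\right),$$ where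 $Y_t=X_t-t\left(a-\int_{\{|x|\le1\}}x\,d\nu(x)\right)$. If $\nu$ is symmetric, this holds for every $r\in(\beta,2]$. (c) Assume $\beta=1$ and $\nu$ is symmetric. Then as $t\to0$, for every $r\in(\beta,2]$ and $q\in[p,\beta)$, $$\mathbb{E}\,\sup_{s\le t}|X_s-as|^p=O\left(t^{p/\beta}\left[\underline{l}(t)^{p/r}+\underline{l}(t)^{p/q}\right]\right).$$
   Context: A (càdlàg) real Lévy process $X=(X_t)_{t\ge0}$ has characteristics $(a,\sigma^2,\nu)$ if $\mathbb{E}\,e^{iuX_t}=e^{-t\Psi(u)}$ for all $u\in\mathbb{R}$, $t\ge 0$, with $$\Psi(u)=-iua+\tfrac12\sigma^2u^2-\int\left(e^{iux}-1-iux\mathbf{1}_{\{|x|\le1\}}\right)d\nu(x),$$ where $a\in\mathbb{R}$, $\sigma^2\ge0$, and $\nu$ (the Lévy measure) is a measure on $\mathbb{R}$ with $\nu(\{0\})=0$ and $\int (x^2\wedge1)\,d\nu(x)<+\infty$. Characteristics $(a,0,\nu)$ means $\sigma^2=0$, i.e. $X$ has no Brownian component. The index of $X$ is $\beta=\inf\{p>0:\int_{\{|x|\le1\}}|x|^p\,d\nu(x)<+\infty\}\in[0,2]$. A measurable function $\varphi:(0,c]\to(0,\infty)$ ($c>0$) is regularly varying at zero with index $b\in\mathbb{R}$ if $\lim_{x\to0}\varphi(tx)/\varphi(x)=t^b$ for every $t>0$. An inequality between measures means inequality on every Borel set. $p\vee1=\max(p,1)$. The suprema $\sup_{s\le t}$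 are over $s\in[0,t]$. Implied constants in $O(\cdot)$ may depend on everything except $t$. *)

theory Defs
  imports "HOL-Probability.Probability" "HOL-Library.Landau_Symbols"
begin

definition cadlag :: "(real \<Rightarrow> real) \<Rightarrow> bool" where
  "cadlag f \<longleftrightarrow>
     (\<forall>t\<ge>0. continuous (at_right t) f) \<and> (\<forall>t>0. \<exists>L. (f \<longlongrightarrow> L) (at_left t))"

(* Only the values X t with t \<ge> 0 matter. Continuity in probability is not listed since
   it follows from stationarity of the increments and right-continuity of the paths. *)
locale levy_process = prob_space M for M :: "'a measure" +
  fixes X :: "real \<Rightarrow> 'a \<Rightarrow> real"
  assumes measurable_X: "0 \<le> t \<Longrightarrow> X t \<in> borel_measurable M"
    and start_zero: "AE \<omega> in M. X 0 \<omega> = 0"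
    and indep_increments:
      "0 \<le> \<tau> 0 \<Longrightarrow> (\<And>i. i < n \<Longrightarrow> \<tau> i \<le> \<tau> (Suc i)) \<Longrightarrow>
         indep_vars (\<lambda>_. borel) (\<lambda>i \<omega>. X (\<tau> (Suc i)) \<omega> - X (\<tau> i) \<omega>) {..<n::nat}"
    and stationary_increments:
      "0 \<le> s \<Longrightarrow> 0 \<le> h \<Longrightarrow>
         distr M borel (\<lambda>\<omega>. X (s + h) \<omega> - X s \<omega>) = distr M borel (\<lambda>\<omega>. X h \<omega> - X 0 \<omega>)"
    and cadlag_paths: "AE \<omega> in M. cadlag (\<lambda>t. X t \<omega>)"

definition levy_measure :: "real measure \<Rightarrow> bool" where
  "levy_measure \<nu> \<longleftrightarrow> sets \<nu> = sets borel \<and> emeasure \<nu> {0} = 0 \<and>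
     (\<integral>\<^sup>+x. ennreal (min (x\<^sup>2) 1) \<partial>\<nu>) < \<infinity>"

definition levy_exponent :: "real \<Rightarrow> real \<Rightarrow> real measure \<Rightarrow> real \<Rightarrow> complex" where
  "levy_exponent a \<sigma>2 \<nu> u =
     - \<i> * of_real u * of_real a + of_real (\<sigma>2 * u\<^sup>2 / 2)
     - (CLINT x|\<nu>. iexp (u * x) - 1 - \<i> * of_real (u * x * indicator {x. \<bar>x\<bar> \<le> 1} x))"

definition has_levy_characteristics ::
  "'a measure \<Rightarrow> (real \<Rightarrow> 'a \<Rightarrow> real) \<Rightarrow> real \<Rightarrow> real \<Rightarrow> real measure \<Rightarrow> bool" where
  "has_levy_characteristics M X a \<sigma>2 \<nu> \<longleftrightarrow> 0 \<le> \<sigma>2 \<and> levy_measure \<nu> \<and>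
     (\<forall>t\<ge>0. \<forall>u. (CLINT \<omega>|M. iexp (u * X t \<omega>)) = exp (- of_real t * levy_exponent a \<sigma>2 \<nu> u))"

definition levy_index :: "real measure \<Rightarrow> real" where
  "levy_index \<nu> = Inf {p. 0 < p \<and> (\<integral>\<^sup>+x\<in>{x. \<bar>x\<bar> \<le> 1}. ennreal (\<bar>x\<bar> powr p) \<partial>\<nu>) < \<infinity>}"

definition symmetric_measure :: "real measure \<Rightarrow> bool" where
  "symmetric_measure \<nu> \<longleftrightarrow> distr \<nu> borel uminus = \<nu>"

(* The function lives on {0<..c}; its values elsewhere are irrelevant. *)
definition regularly_varying_at_zero :: "real \<Rightarrow> real \<Rightarrow> (real \<Rightarrow> real) \<Rightarrow> bool" where
  "regularly_varying_at_zero c b \<phi> \<longleftrightarrow> 0 < c \<and>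
     \<phi> \<in> borel_measurable (restrict_space borel {0<..c}) \<and>
     (\<forall>x\<in>{0<..c}. 0 < \<phi> x) \<and>
     (\<forall>t>0. ((\<lambda>x. \<phi> (t * x) / \<phi> x) \<longlongrightarrow> t powr b) (at_right 0))"

definition locally_bounded_on :: "real set \<Rightarrow> (real \<Rightarrow> real) \<Rightarrow> bool" where
  "locally_bounded_on S f \<longleftrightarrow> (\<forall>x\<in>S. \<exists>U. open U \<and> x \<in> U \<and> bounded (f ` (U \<inter> S)))"

definition sup_moment :: "'a measure \<Rightarrow> (real \<Rightarrow> 'a \<Rightarrow> real) \<Rightarrow> real \<Rightarrow> real \<Rightarrow> ennreal" where
  "sup_moment M Z p t = (\<integral>\<^sup>+\<omega>. (SUP s\<in>{0..t}. ennreal (\<bar>Z s \<omega>\<bar> powr p)) \<partial>M)"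

(* Landau symbol as t tends to 0 from the right for an extended-valued left-hand side;
   finiteness is stated separately because enn2real maps \<infinity> to 0. *)
definition ennreal_bigo_zero :: "(real \<Rightarrow> ennreal) \<Rightarrow> (real \<Rightarrow> real) \<Rightarrow> bool" where
  "ennreal_bigo_zero f g \<longleftrightarrow>
     (\<forall>\<^sub>F t in at_right 0. f t < \<infinity>) \<and> (\<lambda>t. enn2real (f t)) \<in> O[at_right 0](g)"

end

theory Submission imports Defs begin

text \<open>
  The process is never split into its jumps: everything is read off the characteristic function.
  For a random variable \<open>Z\<close> and \<open>0 < p < 2\<close>, the moment \<open>E \<bar>Z\<bar>\<^sup>p\<close> is proportional to the integral of
  \<open>(1 - Re E e^(iuZ)) u^(-p-1)\<close> over \<open>u > 0\<close>. A one-sided version of this formula holds for running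
  suprema: averaging \<open>1 - cos (u Z)\<close> over \<open>0 < u < 2 / \<alpha>\<close> bounds the tail \<open>P (\<bar>Z\<bar> \<ge> \<alpha>)\<close>, Ottaviani's
  inequality carries tail bounds from increments to maxima along dyadic grids, and right-continuity
  reaches the supremum. So, if \<open>B u\<close> bounds \<open>1 - Re E e^(iuX_s)\<close> for all \<open>s \<le> t\<close>, then the supremum
  over \<open>[0,t]\<close> has \<open>p\<close>-th moment at most a constant times the integral of \<open>B u u^(-p-1)\<close>
  (\<open>sup_moment_le_Fourier\<close>).

  For a Levy process \<open>1 - Re e^(-s\<Psi>(u))\<close> is estimated by cutting the jumps at \<open>h = t^(1/\<beta>)\<close> and at a
  fixed \<open>\<delta>\<close>. Jumps up to \<open>h\<close> contribute \<open>min 1 (A t u^r)\<close> with \<open>A\<close> the truncated \<open>r\<close>-th moment of \<open>\<nu>\<close>,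
  jumps between \<open>h\<close> and \<open>\<delta>\<close> contribute \<open>min 1 (D t u^q)\<close> with \<open>D\<close> the truncated \<open>q\<close>-th moment, and the
  large jumps contribute \<open>t\<close> times the \<open>\<nu>\<close>-integral of \<open>min 1 ((u x)\<^sup>2)\<close>. Since the integral of
  \<open>min 1 (A u^r) u^(-p-1)\<close> is of the order \<open>A^(p/r)\<close> for \<open>p < r\<close>, the result is
  \<open>(t A)^(p/r) + (t D)^(p/q) + t\<close> up to a constant (\<open>sup_moment_le_truncated_moments\<close>). That \<open>\<nu>\<close> has a
  \<open>p\<close>-th moment away from zero follows from \<open>E \<bar>X_1\<bar>\<^sup>p < \<infinity>\<close> by reading the same identities backwards
  (\<open>levy_measure_tail_moment_finite\<close>).

  Potter's bounds for the slowly varying function \<open>l\<close> turn the domination of \<open>\<nu>\<close> by \<open>\<phi>\<close> into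
  \<open>A = O(h^(r-\<beta>) l(h))\<close> and \<open>D = O(h^(q-\<beta>) l(h))\<close> (\<open>karamata_truncated_moments\<close>). With \<open>h^\<beta> = t\<close> this
  is exactly the asserted rate, and the remainder \<open>t\<close> is negligible because \<open>p < \<beta>\<close>.

  The range of \<open>\<beta>\<close> enters only through the imaginary part of the exponent. If \<open>\<beta> > 1\<close>, the small
  jumps are fully compensated, \<open>\<bar>sin y - y\<bar> \<le> 2 \<bar>y\<bar>^s\<close> for \<open>1 \<le> s \<le> 2\<close>, and the remaining drift costs
  \<open>t^p\<close>, again negligible. If \<open>\<beta> < 1\<close>, no compensation is left in \<open>Y\<close> and \<open>\<bar>sin y\<bar> \<le> 2 \<bar>y\<bar>^s\<close> for
  \<open>0 \<le> s \<le> 1\<close> is used. If \<open>\<beta> = 1\<close> and \<open>\<nu>\<close> is symmetric, the imaginary part is a pure drift.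
  Finally, \<open>L^s \<le> L^s1 + L^s2\<close> for \<open>s1 \<le> s \<le> s2\<close>: a rate with exponents \<open>(r', q')\<close> such that
  \<open>q \<le> q' < \<beta> < r' \<le> r\<close> implies the rate with exponents \<open>(r, q)\<close>. So \<open>q > max p 1\<close> may be assumed in
  (a) and \<open>r \<le> 1\<close> in (b); the other exponents follow, including the wider ranges for symmetric \<open>\<nu>\<close>.
\<close>

section \<open>Power integrals\<close>

lemma nn_integral_powr_from_0:
  fixes a c :: real
  assumes "-1 < a" "0 \<le> c"
  shows "(\<integral>\<^sup>+u. ennreal (u powr a) * indicator {0<..<c} u \<partial>lborel)
    = ennreal (c powr (a + 1) / (a + 1))"
proof -
  have "(\<integral>\<^sup>+u. ennreal (u powr a) * indicator {0<..<c} u \<partial>lborel)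
    = (\<integral>\<^sup>+u. ennreal (u powr a) * indicator {0..c} u \<partial>lborel)"
    by (intro nn_integral_cong_AE AE_I[where N = "{0, c}"])
      (auto split: split_indicator intro: emeasure_lborel_countable)
  also have "\<dots> = ennreal (c powr (a + 1) / (a + 1))"
    using nn_integral_has_integral_lebesgue[OF _ has_integral_powr_from_0[OF assms]]
    by (simp add: nn_integral_completion nn_integral_set_ennreal[symmetric] mult.commute)
  finally show ?thesis .
qed

lemma nn_integral_powr_to_infinity:
  fixes a c :: real
  assumes "a < -1" "0 < c"
  shows "(\<integral>\<^sup>+u. ennreal (u powr a) * indicator {c<..} u \<partial>lborel)
    = ennreal (- (c powr (a + 1)) / (a + 1))"
proof -
  have "(\<integral>\<^sup>+u. ennreal (u powr a) * indicator {c<..} u \<partial>lborel)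
    = (\<integral>\<^sup>+u. ennreal (u powr a) * indicator {c..} u \<partial>lborel)"
    by (intro nn_integral_cong_AE AE_I[where N = "{c}"]) (auto split: split_indicator)
  also have "\<dots> = ennreal (- (c powr (a + 1)) / (a + 1))"
    using nn_integral_has_integral_lebesgue[OF _ has_integral_powr_to_inf[OF assms]]
    by (simp add: nn_integral_completion nn_integral_set_ennreal[symmetric] mult.commute)
  finally show ?thesis .
qed

text \<open>
  The two powers balance at \<open>c = A^(-1/r)\<close>: below \<open>c\<close> the factor \<open>A u^r\<close> is integrable against
  \<open>u^(-p-1)\<close> because \<open>p < r\<close>, above \<open>c\<close> the factor \<open>1\<close> is because \<open>p > 0\<close>. This is the step where a truncated
  \<open>r\<close>-th moment of the Levy measure is turned into its power \<open>p / r\<close>.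
\<close>

lemma nn_integral_min_one_powr_le:
  fixes p r A :: real
  assumes p: "0 < p" "p < r" and A: "0 < A"
  shows "(\<integral>\<^sup>+u. ennreal (min 1 (A * u powr r) * u powr (- p - 1)) * indicator {0<..} u \<partial>lborel)
    \<le> ennreal ((1 / (r - p) + 1 / p) * A powr (p / r))"
proof -
  define c where "c = A powr (- 1 / r)"
  have c: "0 < c" using A by (simp add: c_def)
  have low: "A * c powr (r - p) = A powr (p / r)" and high: "c powr (- p) = A powr (p / r)"
    using A p by (simp_all add: c_def powr_powr powr_mult_base field_simps)

  have "(\<integral>\<^sup>+u. ennreal (min 1 (A * u powr r) * u powr (- p - 1)) * indicator {0<..} u \<partial>lborel)
     \<le> (\<integral>\<^sup>+u. ennreal A * (ennreal (u powr (r - p - 1)) * indicator {0<..<c} u)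
           + ennreal (u powr (- p - 1)) * indicator {c<..} u \<partial>lborel)"
  proof (intro nn_integral_mono_AE AE_I[where N = "{c}"])
    show "{u \<in> space lborel. \<not> ennreal (min 1 (A * u powr r) * u powr (- p - 1)) * indicator {0<..} u
      \<le> ennreal A * (ennreal (u powr (r - p - 1)) * indicator {0<..<c} u)
           + ennreal (u powr (- p - 1)) * indicator {c<..} u} \<subseteq> {c}"
    proof (intro subsetI, rule ccontr)
      fix u assume u: "u \<in> {u \<in> space lborel. \<not> ennreal (min 1 (A * u powr r) * u powr (- p - 1))
          * indicator {0<..} u
      \<le> ennreal A * (ennreal (u powr (r - p - 1)) * indicator {0<..<c} u)
           + ennreal (u powr (- p - 1)) * indicator {c<..} u}" "u \<notin> {c}"
      then consider "u \<le> 0" | "0 < u" "u < c" | "c < u" by force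
      then show False
      proof cases
        case 1 then show ?thesis using u(1) by simp
      next
        case 2
        have "u powr (r - p - 1) = u powr r * u powr (- p - 1)"
          by (simp add: algebra_simps flip: powr_add)
        then have "min 1 (A * u powr r) * u powr (- p - 1) \<le> A * u powr (r - p - 1)"
          using 2 by (simp add: mult_right_mono flip: mult.assoc)
        then show ?thesis using u(1) 2 A by (simp add: ennreal_leI flip: ennreal_mult)
      next
        case 3
        have "min 1 (A * u powr r) * u powr (- p - 1) \<le> 1 * u powr (- p - 1)"
          by (intro mult_right_mono) auto
        then show ?thesis using u(1) 3 c by (simp add: ennreal_leI)
      qed
    qed
  qed auto
  also have "\<dots> = ennreal A * ennreal (c powr (r - p) / (r - p)) + ennreal (c powr (- p) / p)"
    using nn_integral_powr_from_0[of "r - p - 1" c] nn_integral_powr_to_infinity[of "- p - 1" c] p c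
    by (simp add: nn_integral_add nn_integral_cmult)
  also have "\<dots> = ennreal ((1 / (r - p) + 1 / p) * A powr (p / r))"
    using p A low high by (simp add: distrib_right flip: ennreal_mult ennreal_plus)
  finally show ?thesis .
qed

section \<open>Maxima of partial sums of independent variables\<close>

text \<open>
  If a partial sum reaches \<open>2 \<alpha>\<close> in absolute value, then either the final sum is at least \<open>\<alpha>\<close>, or the sum
  moves by at least \<open>\<alpha>\<close> after the first time \<open>k\<close> at which \<open>2 \<alpha>\<close> is reached. The latter move is independent
  of the event that this first time is \<open>k\<close>, and the first-passage events are disjoint.
\<close>

lemma (in prob_space) ottaviani_inequality:
  fixes D :: "nat \<Rightarrow> 'a \<Rightarrow> real" and n :: nat and \<alpha> G :: real
  defines "S \<equiv> \<lambda>k \<omega>. \<Sum>i<k. D i \<omega>"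
  assumes indep: "indep_vars (\<lambda>_. borel) D {..<n}"
    and G: "\<And>k. k \<le> n \<Longrightarrow> prob {\<omega>\<in>space M. \<alpha> \<le> \<bar>S n \<omega> - S k \<omega>\<bar>} \<le> G"
  shows "prob {\<omega>\<in>space M. \<exists>k\<le>n. 2 * \<alpha> \<le> \<bar>S k \<omega>\<bar>} \<le> 2 * G"
proof -
  have D[measurable]: "random_variable borel (D i)" if "i < n" for i
    using indep that by (auto simp: indep_vars_def)
  have S[measurable]: "random_variable borel (S k)" if "k \<le> n" for k
    unfolding S_def using that by (intro borel_measurable_sum D) auto
  \<comment> \<open>the level is first reached at index \<open>k\<close>\<close>
  define A where "A k = {\<omega>\<in>space M. 2 * \<alpha> \<le> \<bar>S k \<omega>\<bar> \<and> (\<forall>j<k. \<bar>S j \<omega>\<bar> < 2 * \<alpha>)}" for k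
  define E where "E k = {\<omega>\<in>space M. \<alpha> \<le> \<bar>S n \<omega> - S k \<omega>\<bar>}" for k
  have A_meas: "A k \<in> events" if "k \<le> n" for k
  proof -
    have "A k = {\<omega>\<in>space M. 2 * \<alpha> \<le> \<bar>S k \<omega>\<bar>} \<inter> {\<omega>\<in>space M. \<forall>j\<in>{..<k}. \<bar>S j \<omega>\<bar> < 2 * \<alpha>}"
      by (auto simp: A_def)
    also have "\<dots> \<in> events"
      using that by (intro sets.Int sets.sets_Collect_finite_All) (auto simp: less_imp_le)
    finally show ?thesis .
  qed
  have E_meas: "E k \<in> events" if "k \<le> n" for k
    using that unfolding E_def by measurable
  have disj: "disjoint_family_on A {..n}"
    unfolding disjoint_family_on_def
  proof (intro ballI impI)
    fix i j :: nat assume "i \<noteq> j" then consider "i < j" | "j < i" by linarith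
    then show "A i \<inter> A j = {}" by cases (force simp: A_def)+
  qed
  have indep_AE: "prob (A k \<inter> E k) = prob (A k) * prob (E k)" if k: "k \<le> n" for k
  proof -
    let ?past = "\<lambda>\<omega>. \<lambda>i\<in>{..<k}. D i \<omega>" and ?future = "\<lambda>\<omega>. \<lambda>i\<in>{k..<n}. D i \<omega>"
    define P where "P = {d \<in> space (PiM {..<k} (\<lambda>_. borel :: real measure)).
      2 * \<alpha> \<le> \<bar>\<Sum>i<k. d i\<bar> \<and> (\<forall>j\<in>{..<k}. \<bar>\<Sum>i<j. d i\<bar> < 2 * \<alpha>)}"
    define F where "F = {d \<in> space (PiM {k..<n} (\<lambda>_. borel :: real measure)). \<alpha> \<le> \<bar>\<Sum>i\<in>{k..<n}. d i\<bar>}"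
    have ind: "indep_var (PiM {..<k} (\<lambda>_. borel)) ?past (PiM {k..<n} (\<lambda>_. borel)) ?future"
      using k by (intro indep_var_restrict[OF indep]) auto
    have sum_meas: "(\<lambda>d. \<Sum>i\<in>J. d i) \<in> borel_measurable (PiM I (\<lambda>_. borel :: real measure))"
      if "J \<subseteq> I" for I J :: "nat set"
      using that by (intro borel_measurable_sum) (auto intro!: measurable_component_singleton)
    have P: "P \<in> sets (PiM {..<k} (\<lambda>_. borel))"
      unfolding P_def
      by (intro sets.sets_Collect sets.sets_Collect_finite_All borel_measurable_le borel_measurable_less
          borel_measurable_abs sum_meas borel_measurable_const) auto
    have F: "F \<in> sets (PiM {k..<n} (\<lambda>_. borel))"
      unfolding F_def
      by (intro borel_measurable_le borel_measurable_abs sum_meas borel_measurable_const) auto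
    have pastA: "?past -` P \<inter> space M = A k"
      unfolding P_def A_def S_def by (auto simp: space_PiM)
    have "S n \<omega> - S k \<omega> = (\<Sum>i\<in>{k..<n}. D i \<omega>)" for \<omega>
      using k by (simp add: S_def sum_diff_nat_ivl lessThan_atLeast0)
    then have futE: "?future -` F \<inter> space M = E k"
      unfolding F_def E_def by (auto simp: space_PiM)
    have "prob ((\<lambda>\<omega>. (?past \<omega>, ?future \<omega>)) -` (P \<times> F) \<inter> space M)
      = prob (?past -` P \<inter> space M) * prob (?future -` F \<inter> space M)"
      by (rule indep_varD[OF ind P F])
    moreover have "(\<lambda>\<omega>. (?past \<omega>, ?future \<omega>)) -` (P \<times> F) \<inter> space M = A k \<inter> E k"
      using pastA futE by blast
    ultimately show ?thesis by (simp only: pastA futE)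
  qed
  have G0: "0 \<le> G" using G[of n] measure_nonneg order_trans by blast
  have sub: "{\<omega>\<in>space M. \<exists>k\<le>n. 2 * \<alpha> \<le> \<bar>S k \<omega>\<bar>} \<subseteq> E 0 \<union> (\<Union>k\<in>{..n}. A k \<inter> E k)"
  proof
    fix \<omega> assume "\<omega> \<in> {\<omega>\<in>space M. \<exists>k\<le>n. 2 * \<alpha> \<le> \<bar>S k \<omega>\<bar>}"
    then have \<omega>: "\<omega> \<in> space M" and ex: "\<exists>k. k \<le> n \<and> 2 * \<alpha> \<le> \<bar>S k \<omega>\<bar>" by auto
    define k where "k = (LEAST k. k \<le> n \<and> 2 * \<alpha> \<le> \<bar>S k \<omega>\<bar>)"
    have k: "k \<le> n" "2 * \<alpha> \<le> \<bar>S k \<omega>\<bar>" using LeastI_ex[OF ex] by (auto simp: k_def)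
    have "\<bar>S j \<omega>\<bar> < 2 * \<alpha>" if "j < k" for j
      using not_less_Least[of j "\<lambda>k. k \<le> n \<and> 2 * \<alpha> \<le> \<bar>S k \<omega>\<bar>"] that k by (auto simp: k_def)
    then have "\<omega> \<in> A k" using \<omega> k by (auto simp: A_def)
    moreover have "\<omega> \<in> E 0 \<or> \<omega> \<in> E k" using \<omega> k by (auto simp: E_def S_def)
    ultimately show "\<omega> \<in> E 0 \<union> (\<Union>k\<in>{..n}. A k \<inter> E k)" using k by auto
  qed
  have U: "(\<Union>k\<in>{..n}. A k \<inter> E k) \<in> events"
    by (intro sets.finite_UN sets.Int A_meas E_meas) auto
  have "prob {\<omega>\<in>space M. \<exists>k\<le>n. 2 * \<alpha> \<le> \<bar>S k \<omega>\<bar>} \<le> prob (E 0 \<union> (\<Union>k\<in>{..n}. A k \<inter> E k))"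
    using sub U E_meas by (intro finite_measure_mono) auto
  also have "\<dots> \<le> prob (E 0) + prob (\<Union>k\<in>{..n}. A k \<inter> E k)"
    using U E_meas by (intro measure_Un_le) auto
  also have "prob (\<Union>k\<in>{..n}. A k \<inter> E k) \<le> (\<Sum>k\<le>n. prob (A k \<inter> E k))"
    by (intro finite_measure_subadditive_finite) (auto intro: A_meas E_meas)
  also have "\<dots> = (\<Sum>k\<le>n. prob (A k) * prob (E k))"
    by (intro sum.cong) (auto simp: indep_AE)
  also have "\<dots> \<le> (\<Sum>k\<le>n. prob (A k) * G)"
    using G by (intro sum_mono mult_left_mono) (auto simp: E_def)
  also have "\<dots> = prob (\<Union>k\<in>{..n}. A k) * G"
    using disj A_meas by (subst finite_measure_finite_Union) (auto simp: sum_distrib_right)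
  also have "\<dots> \<le> 1 * G" using G0 by (intro mult_right_mono) auto
  also have "prob (E 0) \<le> G" using G[of 0] by (simp add: E_def)
  finally show ?thesis by simp
qed

text \<open>
  The mean of \<open>1 - cos (u z)\<close> over \<open>0 < u < 2 / \<alpha>\<close> is \<open>1 - sin v / v\<close> with \<open>v = 2 z / \<alpha>\<close>, which is at least
  \<open>1 / 2\<close> once \<open>\<bar>z\<bar> \<ge> \<alpha>\<close>. Integrating over the law of \<open>Z\<close> and exchanging the integrals bounds the tail by the
  characteristic function.
\<close>

lemma (in prob_space) prob_abs_ge_le_averaged_cos:
  fixes Z :: "'a \<Rightarrow> real"
  assumes Z[measurable]: "random_variable borel Z" and \<alpha>: "0 < \<alpha>"
  shows "emeasure M {\<omega>\<in>space M. \<alpha> \<le> \<bar>Z \<omega>\<bar>}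
    \<le> ennreal \<alpha> * (\<integral>\<^sup>+u. (\<integral>\<^sup>+\<omega>. ennreal (1 - cos (u * Z \<omega>)) \<partial>M) * indicator {0<..<2 / \<alpha>} u \<partial>lborel)"
proof -
  interpret pair_sigma_finite lborel M ..
  have avg: "1 \<le> ennreal \<alpha> * (\<integral>\<^sup>+u. ennreal (1 - cos (u * z)) * indicator {0<..<2 / \<alpha>} u \<partial>lborel)"
    if z: "\<alpha> \<le> \<bar>z\<bar>" for z :: real
  proof -
    have "(\<integral>\<^sup>+u. ennreal (1 - cos (u * z)) * indicator {0<..<2 / \<alpha>} u \<partial>lborel)
      = (\<integral>\<^sup>+u. ennreal (1 - cos (u * z)) * indicator {0..2 / \<alpha>} u \<partial>lborel)"
      by (intro nn_integral_cong_AE AE_I[where N = "{0, 2 / \<alpha>}"])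
        (auto split: split_indicator intro: emeasure_lborel_countable)
    also have "\<dots> = ennreal ((\<lambda>u. u - sin (u * z) / z) (2 / \<alpha>) - (\<lambda>u. u - sin (u * z) / z) 0)"
      using z \<alpha> by (intro nn_integral_FTC_Icc) (auto intro!: derivative_eq_intros)
    also have "\<dots> = ennreal (2 / \<alpha> - sin (2 / \<alpha> * z) / z)" by simp
    also have "ennreal (1 / \<alpha>) \<le> \<dots>"
    proof (rule ennreal_leI)
      have "sin (2 / \<alpha> * z) / z \<le> \<bar>sin (2 / \<alpha> * z)\<bar> / \<bar>z\<bar>" by (simp flip: abs_divide)
      also have "\<dots> \<le> 1 / \<alpha>" using z \<alpha> by (intro frac_le) auto
      also have "\<dots> = 2 / \<alpha> - 1 / \<alpha>" by simp
      finally show "1 / \<alpha> \<le> 2 / \<alpha> - sin (2 / \<alpha> * z) / z" by simp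
    qed
    finally show ?thesis
      using \<alpha> mult_left_mono[of "ennreal (1/\<alpha>)" _ "ennreal \<alpha>"] by (force simp flip: ennreal_mult)
  qed
  have "emeasure M {\<omega>\<in>space M. \<alpha> \<le> \<bar>Z \<omega>\<bar>} = (\<integral>\<^sup>+\<omega>. indicator {\<omega>\<in>space M. \<alpha> \<le> \<bar>Z \<omega>\<bar>} \<omega> \<partial>M)"
    by (simp add: nn_integral_indicator)
  also have "\<dots> \<le> (\<integral>\<^sup>+\<omega>. ennreal \<alpha> * (\<integral>\<^sup>+u. ennreal (1 - cos (u * Z \<omega>))
      * indicator {0<..<2 / \<alpha>} u \<partial>lborel) \<partial>M)"
    by (intro nn_integral_mono) (auto split: split_indicator intro!: avg)
  also have "\<dots> = ennreal \<alpha> * (\<integral>\<^sup>+\<omega>. (\<integral>\<^sup>+u. ennreal (1 - cos (u * Z \<omega>))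
      * indicator {0<..<2 / \<alpha>} u \<partial>lborel) \<partial>M)"
    by (intro nn_integral_cmult) measurable
  also have "\<dots> = ennreal \<alpha> * (\<integral>\<^sup>+u. (\<integral>\<^sup>+\<omega>. ennreal (1 - cos (u * Z \<omega>))
      * indicator {0<..<2 / \<alpha>} u \<partial>M) \<partial>lborel)"
    by (subst Fubini') measurable
  finally show ?thesis by (simp add: nn_integral_multc)
qed

lemma nn_integral_powr_layer_cake:
  fixes x p :: real
  assumes "0 < p" "0 \<le> x"
  shows "ennreal (x powr p)
    = ennreal (p * 2 powr p) * (\<integral>\<^sup>+\<alpha>. ennreal (\<alpha> powr (p - 1)) * indicator {0<..<x / 2} \<alpha> \<partial>lborel)"
  using assms nn_integral_powr_from_0[of "p - 1" "x / 2"]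
  by (simp add: powr_divide flip: ennreal_mult)

text \<open>
  The tail bound for the maximum that follows from Ottaviani's inequality and the averaged cosine is
  \<open>2 \<alpha>\<close> times the integral of \<open>B\<close> over \<open>0 < u < 2 / \<alpha>\<close>. Its integral against \<open>p \<alpha>^(p-1)\<close> is, by Tonelli, the
  integral of \<open>B u\<close> against a constant multiple of \<open>u^(-p-1)\<close>.
\<close>

lemma (in prob_space) nn_integral_max_partial_sums_powr_le:
  fixes D :: "nat \<Rightarrow> 'a \<Rightarrow> real" and n :: nat and p :: real and B :: "real \<Rightarrow> ennreal"
  defines "S \<equiv> \<lambda>k \<omega>. \<Sum>i<k. D i \<omega>"
  assumes indep: "indep_vars (\<lambda>_. borel) D {..<n}" and p: "0 < p"
    and B[measurable]: "B \<in> borel_measurable borel"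
    and bound: "\<And>k u. k \<le> n \<Longrightarrow> 0 < u \<Longrightarrow> (\<integral>\<^sup>+\<omega>. ennreal (1 - cos (u * (S n \<omega> - S k \<omega>))) \<partial>M) \<le> B u"
  shows "(\<integral>\<^sup>+\<omega>. (SUP k\<in>{..n}. ennreal (\<bar>S k \<omega>\<bar> powr p)) \<partial>M)
    \<le> ennreal (p * 4 powr (p + 1) / (p + 1)) * (\<integral>\<^sup>+u. B u * ennreal (u powr
        (- p - 1)) * indicator {0<..} u \<partial>lborel)"
proof -
  interpret LM: pair_sigma_finite lborel M ..
  have D[measurable]: "random_variable borel (D i)" if "i < n" for i
    using indep that by (auto simp: indep_vars_def)
  have S[measurable]: "random_variable borel (S k)" if "k \<le> n" for k
    unfolding S_def using that by (intro borel_measurable_sum D) auto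
  have [measurable]: "(\<lambda>x. indicator {0<..<2 / g x} (f x) :: ennreal) \<in> borel_measurable N"
    if [measurable]: "f \<in> borel_measurable N" "g \<in> borel_measurable N" for N and f g :: "_ \<Rightarrow> real"
    unfolding indicator_def greaterThanLessThan_iff by measurable
  define m where "m \<omega> = Max ((\<lambda>k. \<bar>S k \<omega>\<bar>) ` {..n})" for \<omega>
  have m_meas[measurable]: "random_variable borel m"
    unfolding m_def by (intro borel_measurable_Max borel_measurable_abs S) auto
  have m_ge: "\<bar>S k \<omega>\<bar> \<le> m \<omega>" if "k \<le> n" for k \<omega>
    unfolding m_def using that by (intro Max_ge) auto
  have m_in: "\<exists>k\<le>n. m \<omega> = \<bar>S k \<omega>\<bar>" for \<omega>
    unfolding m_def using Max_in[of "(\<lambda>k. \<bar>S k \<omega>\<bar>) ` {..n}"] by fastforce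
  have m0: "0 \<le> m \<omega>" for \<omega> using m_in[of \<omega>] by auto
  define I where "I \<alpha> = (\<integral>\<^sup>+u. B u * indicator {0<..<2 / \<alpha>} u \<partial>lborel)" for \<alpha> :: real
  have tail: "emeasure M {\<omega>\<in>space M. 2 * \<alpha> < m \<omega>} \<le> 2 * (ennreal \<alpha> * I \<alpha>)" if \<alpha>: "0 < \<alpha>" for \<alpha>
  proof (cases "ennreal \<alpha> * I \<alpha> = \<infinity>")
    case False
    define G where "G = enn2real (ennreal \<alpha> * I \<alpha>)"
    have G: "ennreal \<alpha> * I \<alpha> = ennreal G" using False by (simp add: G_def less_top)
    have "prob {\<omega>\<in>space M. \<alpha> \<le> \<bar>S n \<omega> - S k \<omega>\<bar>} \<le> G" if k: "k \<le> n" for k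
    proof -
      have "emeasure M {\<omega>\<in>space M. \<alpha> \<le> \<bar>S n \<omega> - S k \<omega>\<bar>}
        \<le> ennreal \<alpha> * (\<integral>\<^sup>+u. (\<integral>\<^sup>+\<omega>. ennreal (1 - cos (u *
            (S n \<omega> - S k \<omega>))) \<partial>M) * indicator {0<..<2 / \<alpha>} u \<partial>lborel)"
        using k \<alpha> by (intro prob_abs_ge_le_averaged_cos) auto
      also have "\<dots> \<le> ennreal \<alpha> * I \<alpha>"
        unfolding I_def using bound[OF k]
        by (intro mult_left_mono nn_integral_mono) (auto split: split_indicator)
      finally show ?thesis
        unfolding G by (simp add: emeasure_eq_measure G_def)
    qed
    then have "prob {\<omega>\<in>space M. \<exists>k\<le>n. 2 * \<alpha> \<le> \<bar>S k \<omega>\<bar>} \<le> 2 * G"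
      unfolding S_def by (intro ottaviani_inequality indep) auto
    moreover have "{\<omega>\<in>space M. 2 * \<alpha> < m \<omega>} \<subseteq> {\<omega>\<in>space M. \<exists>k\<le>n. 2 * \<alpha> \<le> \<bar>S k \<omega>\<bar>}"
    proof safe
      fix \<omega> assume "2 * \<alpha> < m \<omega>"
      then show "\<exists>k\<le>n. 2 * \<alpha> \<le> \<bar>S k \<omega>\<bar>" using m_in[of \<omega>] by (auto intro: less_imp_le)
    qed
    moreover have "{\<omega>\<in>space M. \<exists>k\<in>{..n}. 2 * \<alpha> \<le> \<bar>S k \<omega>\<bar>} \<in> events"
      by (intro sets.sets_Collect_finite_Ex) auto
    then have "{\<omega>\<in>space M. \<exists>k\<le>n. 2 * \<alpha> \<le> \<bar>S k \<omega>\<bar>} \<in> events"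
      by (simp only: Bex_def atMost_iff)
    ultimately have "prob {\<omega>\<in>space M. 2 * \<alpha> < m \<omega>} \<le> 2 * G"
      using finite_measure_mono order_trans by blast
    then show ?thesis
      unfolding G by (simp add: emeasure_eq_measure ennreal_leI G_def flip: ennreal_numeral ennreal_mult)
  qed simp
  have "(\<integral>\<^sup>+\<omega>. (SUP k\<in>{..n}. ennreal (\<bar>S k \<omega>\<bar> powr p)) \<partial>M) \<le> (\<integral>\<^sup>+\<omega>. ennreal (m \<omega> powr p) \<partial>M)"
    using m_ge p by (intro nn_integral_mono SUP_least ennreal_leI powr_mono2) auto
  also have "\<dots> = (\<integral>\<^sup>+\<omega>. ennreal (p * 2 powr p) * (\<integral>\<^sup>+\<alpha>. ennreal (\<alpha> powr (p - 1))
      * indicator {0<..<m \<omega> / 2} \<alpha> \<partial>lborel) \<partial>M)"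
    using p m0 by (simp only: nn_integral_powr_layer_cake)
  also have "\<dots> = (\<integral>\<^sup>+\<omega>. ennreal (p * 2 powr p) * (\<integral>\<^sup>+\<alpha>. ennreal (\<alpha> powr (p - 1)) * indicator {0<..} \<alpha>
      * indicator {\<omega>\<in>space M. 2 * \<alpha> < m \<omega>} \<omega> \<partial>lborel) \<partial>M)"
    by (rule nn_integral_cong, rule arg_cong2[where f = times], rule refl, rule nn_integral_cong)
      (auto split: split_indicator)
  also have "\<dots> = ennreal (p * 2 powr p) * (\<integral>\<^sup>+\<omega>. (\<integral>\<^sup>+\<alpha>. ennreal (\<alpha> powr (p - 1)) * indicator {0<..} \<alpha>
      * indicator {\<omega>\<in>space M. 2 * \<alpha> < m \<omega>} \<omega> \<partial>lborel) \<partial>M)"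
    by (intro nn_integral_cmult) measurable
  also have "\<dots> = ennreal (p * 2 powr p) * (\<integral>\<^sup>+\<alpha>. (\<integral>\<^sup>+\<omega>. ennreal (\<alpha> powr (p - 1)) * indicator {0<..} \<alpha>
      * indicator {\<omega>\<in>space M. 2 * \<alpha> < m \<omega>} \<omega> \<partial>M) \<partial>lborel)"
    by (subst LM.Fubini') measurable
  also have "\<dots> = ennreal (p * 2 powr p) * (\<integral>\<^sup>+\<alpha>. ennreal (\<alpha> powr (p - 1)) * indicator {0<..} \<alpha>
      * emeasure M {\<omega>\<in>space M. 2 * \<alpha> < m \<omega>} \<partial>lborel)"
    by (subst nn_integral_cmult_indicator) auto
  also have "\<dots> \<le> ennreal (p * 2 powr p) * (\<integral>\<^sup>+\<alpha>. 2 * (\<integral>\<^sup>+u. B u * indicator {0<..} u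
      * (ennreal (\<alpha> powr p) * indicator {0<..<2 / u} \<alpha>) \<partial>lborel) \<partial>lborel)"
  proof (intro mult_left_mono nn_integral_mono)
    fix \<alpha> :: real
    show "ennreal (\<alpha> powr (p - 1)) * indicator {0<..} \<alpha> * emeasure M {\<omega>\<in>space M. 2 * \<alpha> < m \<omega>}
      \<le> 2 * (\<integral>\<^sup>+u. B u * indicator {0<..} u * (ennreal (\<alpha> powr p) * indicator {0<..<2 / u} \<alpha>) \<partial>lborel)"
    proof (cases "0 < \<alpha>")
      case True
      have "ennreal (\<alpha> powr (p - 1)) * emeasure M {\<omega>\<in>space M. 2 * \<alpha> < m \<omega>} \<le> ennreal (\<alpha> powr (p - 1))
          * (2 * (ennreal \<alpha> * I \<alpha>))"
        by (intro mult_left_mono tail True) auto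
      also have "\<dots> = 2 * (ennreal (\<alpha> powr (p - 1)) * ennreal \<alpha> * I \<alpha>)" by (simp only: mult_ac)
      also have "ennreal (\<alpha> powr (p - 1)) * ennreal \<alpha> = ennreal (\<alpha> powr p)"
        using True powr_mult_base[of \<alpha> "p - 1"] by (simp add: mult.commute flip: ennreal_mult)
      also have "ennreal (\<alpha> powr p) * I \<alpha> = (\<integral>\<^sup>+u. ennreal (\<alpha> powr p) * (B u
          * indicator {0<..<2 / \<alpha>} u) \<partial>lborel)"
        unfolding I_def by (intro nn_integral_cmult[symmetric]) measurable
      also have "\<dots> = (\<integral>\<^sup>+u. B u * indicator {0<..} u * (ennreal (\<alpha> powr p)
          * indicator {0<..<2 / u} \<alpha>) \<partial>lborel)"
        using True by (intro nn_integral_cong) (auto split: split_indicator simp: field_simps)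
      finally show ?thesis using True by simp
    qed simp
  qed auto
  also have "(\<integral>\<^sup>+\<alpha>. 2 * (\<integral>\<^sup>+u. B u * indicator {0<..} u * (ennreal (\<alpha> powr p)
      * indicator {0<..<2 / u} \<alpha>) \<partial>lborel) \<partial>lborel)
    = 2 * (\<integral>\<^sup>+u. (\<integral>\<^sup>+\<alpha>. B u * indicator {0<..} u * (ennreal
        (\<alpha> powr p) * indicator {0<..<2 / u} \<alpha>) \<partial>lborel) \<partial>lborel)"
    by (subst nn_integral_cmult, measurable) (subst lborel_pair.Fubini', measurable)
  also have "(\<integral>\<^sup>+u. (\<integral>\<^sup>+\<alpha>. B u * indicator {0<..} u * (ennreal (\<alpha> powr p)
      * indicator {0<..<2 / u} \<alpha>) \<partial>lborel) \<partial>lborel)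
    = (\<integral>\<^sup>+u. ennreal (2 powr (p + 1) / (p + 1)) * (B u * ennreal (u powr
        (- p - 1)) * indicator {0<..} u) \<partial>lborel)"
  proof (intro nn_integral_cong)
    fix u :: real
    have "(\<integral>\<^sup>+\<alpha>. B u * indicator {0<..} u * (ennreal (\<alpha> powr p) * indicator {0<..<2 / u} \<alpha>) \<partial>lborel)
      = B u * indicator {0<..} u * (\<integral>\<^sup>+\<alpha>. ennreal (\<alpha> powr p) * indicator {0<..<2 / u} \<alpha> \<partial>lborel)"
      by (intro nn_integral_cmult) measurable
    also have "\<dots> = ennreal (2 powr (p + 1) / (p + 1)) * (B u * ennreal (u powr (- p - 1))
        * indicator {0<..} u)"
    proof (cases "0 < u")
      case True
      have "(2 / u) powr (p + 1) = 2 powr (p + 1) * u powr (- p - 1)"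
        using True by (simp add: powr_divide powr_minus_divide[of u "p + 1", simplified])
      then have "ennreal ((2 / u) powr (p + 1) / (p + 1))
        = ennreal (2 powr (p + 1) / (p + 1)) * ennreal (u powr (- p - 1))"
        using p by (simp flip: ennreal_mult)
      then show ?thesis using True p by (simp add: nn_integral_powr_from_0 mult_ac)
    qed simp
    finally show "(\<integral>\<^sup>+\<alpha>. B u * indicator {0<..} u * (ennreal (\<alpha> powr p)
        * indicator {0<..<2 / u} \<alpha>) \<partial>lborel)
      = ennreal (2 powr (p + 1) / (p + 1)) * (B u * ennreal (u powr (- p - 1)) * indicator {0<..} u)" .
  qed
  also have "\<dots> = ennreal (2 powr (p + 1) / (p + 1)) * (\<integral>\<^sup>+u. B u * ennreal (u powr (- p - 1))
      * indicator {0<..} u \<partial>lborel)"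
    by (intro nn_integral_cmult) measurable
  also have "ennreal (p * 2 powr p) * (2 * (ennreal (2 powr (p + 1) / (p + 1)) * (\<integral>\<^sup>+u. B u
      * ennreal (u powr (- p - 1)) * indicator {0<..} u \<partial>lborel)))
    = ennreal (p * 4 powr (p + 1) / (p + 1)) * (\<integral>\<^sup>+u. B u * ennreal (u powr
        (- p - 1)) * indicator {0<..} u \<partial>lborel)"
  proof -
    have "(4::real) powr (p + 1) = 2 powr p * 2 * 2 powr (p + 1)"
      using powr_mult[of 2 2 "p + 1"] by (simp add: powr_add)
    then show ?thesis
      using p by (simp add: mult.assoc[symmetric] ennreal_mult[symmetric] del: ennreal_numeral
          flip: ennreal_numeral)
  qed
  finally show ?thesis .
qed

section \<open>Suprema of Levy processes\<close>

lemma (in levy_process) nn_integral_cos_increment: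
  assumes s: "0 \<le> s" "s \<le> t"
  shows "(\<integral>\<^sup>+\<omega>. ennreal (1 - cos (u * (X t \<omega> - X s \<omega>))) \<partial>M)
    = (\<integral>\<^sup>+\<omega>. ennreal (1 - cos (u * X (t - s) \<omega>)) \<partial>M)"
proof -
  have [measurable]: "X t \<in> borel_measurable M" "X s \<in> borel_measurable M"
    "X (t - s) \<in> borel_measurable M" "X 0 \<in> borel_measurable M"
    using s by (auto intro: measurable_X)
  have "(\<integral>\<^sup>+\<omega>. ennreal (1 - cos (u * (X t \<omega> - X s \<omega>))) \<partial>M)
    = (\<integral>\<^sup>+x. ennreal (1 - cos (u * x)) \<partial>distr M borel (\<lambda>\<omega>. X t \<omega> - X s \<omega>))"
    by (subst nn_integral_distr) auto
  also have "distr M borel (\<lambda>\<omega>. X t \<omega> - X s \<omega>) = distr M borel (\<lambda>\<omega>. X (t - s) \<omega> - X 0 \<omega>)"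
    using stationary_increments[of s "t - s"] s by simp
  also have "(\<integral>\<^sup>+x. ennreal (1 - cos (u * x)) \<partial>distr M borel (\<lambda>\<omega>. X (t - s) \<omega> - X 0 \<omega>))
    = (\<integral>\<^sup>+\<omega>. ennreal (1 - cos (u * (X (t - s) \<omega> - X 0 \<omega>))) \<partial>M)"
    by (subst nn_integral_distr) auto
  also have "\<dots> = (\<integral>\<^sup>+\<omega>. ennreal (1 - cos (u * X (t - s) \<omega>)) \<partial>M)"
    using start_zero by (intro nn_integral_cong_AE) auto
  finally show ?thesis .
qed

text \<open>
  For a right-continuous path every value before the end of the interval is a limit of values at dyadic
  points strictly to the right; the right end point is itself a dyadic point.
\<close>

lemma SUP_dyadic_right_limits:
  fixes f :: "real \<Rightarrow> real" and g :: "real \<Rightarrow> ennreal"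
  assumes f: "\<And>s. 0 \<le> s \<Longrightarrow> continuous (at_right s) f" and t: "0 < t"
    and g: "\<And>x. isCont g x" and s: "0 \<le> s" "s \<le> t"
  shows "g (f s) \<le> (SUP n. SUP k\<in>{..2 ^ n}. g (f (real k * (t / 2 ^ n))))"
proof (cases "s = t")
  case True
  have "g (f t) \<le> (SUP k\<in>{..2 ^ 0}. g (f (real k * (t / 2 ^ 0))))"
    by (rule SUP_upper2[of 1]) auto
  then show ?thesis unfolding True by (rule SUP_upper2[of 0, rotated]) auto
next
  case False
  \<comment> \<open>the first grid point strictly to the right of \<open>s\<close>: right-continuity ignores \<open>s\<close> itself\<close>
  define k where "k n = nat \<lfloor>s / (t / 2 ^ n)\<rfloor> + 1" for n :: nat
  define r where "r n = real (k n) * (t / 2 ^ n)" for n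
  have k_eq: "real (k n) = real_of_int \<lfloor>s / (t / 2 ^ n)\<rfloor> + 1" for n
    using s t by (simp add: k_def)
  have r_gt: "s < r n" and r_le: "r n \<le> s + t / 2 ^ n" for n
  proof -
    have "s / (t / 2 ^ n) < real (k n)" "real (k n) \<le> s / (t / 2 ^ n) + 1"
      unfolding k_eq by linarith+
    then show "s < r n" "r n \<le> s + t / 2 ^ n"
      using t unfolding r_def by (simp_all add: field_simps)
  qed
  have k_le: "k n \<le> 2 ^ n" for n
  proof -
    have "s / (t / 2 ^ n) < of_int (2 ^ n)" using s t False by (simp add: field_simps)
    then have "\<lfloor>s / (t / 2 ^ n)\<rfloor> < 2 ^ n" by (simp only: floor_less_iff)
    then have "real_of_int \<lfloor>s / (t / 2 ^ n)\<rfloor> + 1 \<le> real_of_int (2 ^ n)" by linarith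
    then have "real (k n) \<le> real (2 ^ n)" unfolding k_eq by simp
    then show ?thesis by (simp only: of_nat_le_iff)
  qed
  have "(\<lambda>n. s + t / 2 ^ n) \<longlonglongrightarrow> s + 0"
    by (intro tendsto_add tendsto_const LIMSEQ_divide_realpow_zero) auto
  then have "r \<longlonglongrightarrow> s"
    by (intro tendsto_sandwich[of "\<lambda>_. s" r sequentially "\<lambda>n. s + t / 2 ^ n"] always_eventually)
      (auto intro: less_imp_le[OF r_gt] r_le)
  then have "filterlim r (at_right s) sequentially"
    using r_gt less_imp_neq[OF r_gt] by (auto simp: filterlim_at intro!: always_eventually)
  then have "(\<lambda>n. f (r n)) \<longlonglongrightarrow> f s"
    using f[OF s(1)] by (auto simp: continuous_within intro: filterlim_compose)
  then have "(\<lambda>n. g (f (r n))) \<longlonglongrightarrow> g (f s)"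
    by (rule isCont_tendsto_compose[OF g])
  then show ?thesis
  proof (rule LIMSEQ_le_const2, intro exI allI impI)
    fix n
    have "g (f (r n)) \<le> (SUP k\<in>{..2 ^ n}. g (f (real k * (t / 2 ^ n))))"
      unfolding r_def by (rule SUP_upper2[of "k n"]) (use k_le in auto)
    then show "g (f (r n)) \<le> (SUP n. SUP k\<in>{..2 ^ n}. g (f (real k * (t / 2 ^ n))))"
      by (rule SUP_upper2[rotated]) auto
  qed
qed

lemma isCont_ennreal_abs_powr:
  fixes p x :: real
  assumes "0 < p"
  shows "isCont (\<lambda>x. ennreal (\<bar>x\<bar> powr p)) x"
proof (cases "x = 0")
  case True
  have "((\<lambda>x. \<bar>x\<bar> powr p) \<longlongrightarrow> 0 powr p) (at (0::real))"
    using assms by (intro tendsto_powr' tendsto_eq_intros) (auto intro: tendsto_eq_intros)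
  then have "((\<lambda>x. ennreal (\<bar>x\<bar> powr p)) \<longlongrightarrow> ennreal (0 powr p)) (at (0::real))"
    by (rule tendsto_ennrealI)
  then show ?thesis unfolding isCont_def True by simp
qed (auto simp: isCont_def intro!: tendsto_ennrealI tendsto_intros)

text \<open>
  The supremum over uncountably many times is thus, almost surely, a countable supremum, which is measurable.
\<close>

lemma (in levy_process) SUP_abs_powr_AE_eq_dyadic:
  assumes p: "0 < p" and t: "0 < t"
  shows "AE \<omega> in M. (SUP s\<in>{0..t}. ennreal (\<bar>X s \<omega>\<bar> powr p))
    = (SUP n. SUP k\<in>{..2 ^ n}. ennreal (\<bar>X (real k * (t / 2 ^ n)) \<omega>\<bar> powr p))"
  using cadlag_paths
proof eventually_elim
  case (elim \<omega>)
  show ?case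
  proof (rule antisym)
    show "(SUP s\<in>{0..t}. ennreal (\<bar>X s \<omega>\<bar> powr p))
      \<le> (SUP n. SUP k\<in>{..2 ^ n}. ennreal (\<bar>X (real k * (t / 2 ^ n)) \<omega>\<bar> powr p))"
      using elim p t
      by (intro SUP_least SUP_dyadic_right_limits[where g = "\<lambda>x. ennreal (\<bar>x\<bar> powr p)" and f = "\<lambda>s. X s \<omega>"])
        (auto simp: cadlag_def intro: isCont_ennreal_abs_powr)
    show "(SUP n. SUP k\<in>{..2 ^ n}. ennreal (\<bar>X (real k * (t / 2 ^ n)) \<omega>\<bar> powr p))
      \<le> (SUP s\<in>{0..t}. ennreal (\<bar>X s \<omega>\<bar> powr p))"
    proof (intro SUP_least SUP_upper)
      fix n k :: nat assume "k \<in> {..2 ^ n}"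
      then have "real k \<le> 2 ^ n" using of_nat_le_iff[of k "2 ^ n", where 'a = real] by simp
      then have "real k * (t / 2 ^ n) \<le> 2 ^ n * (t / 2 ^ n)"
        using t by (intro mult_right_mono) auto
      then show "real k * (t / 2 ^ n) \<in> {0..t}" using t by simp
    qed
  qed
qed

text \<open>
  Along each dyadic grid the process is a random walk with stationary increments, so that a bound for
  \<open>1 - Re E e^(iuX_s)\<close> which is uniform in \<open>s \<le> t\<close> covers all differences of partial sums. The estimate does
  not depend on the mesh, and monotone convergence yields the supremum.
\<close>

lemma (in levy_process) sup_moment_le_Fourier:
  assumes p: "0 < p" and t: "0 < t" and B[measurable]: "B \<in> borel_measurable borel"
    and bound: "\<And>s u. 0 \<le> s \<Longrightarrow> s \<le> t \<Longrightarrow> 0 < u \<Longrightarrow>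
      (\<integral>\<^sup>+\<omega>. ennreal (1 - cos (u * X s \<omega>)) \<partial>M) \<le> B u"
  shows "sup_moment M X p t \<le> ennreal (p * 4 powr (p + 1) / (p + 1)) *
    (\<integral>\<^sup>+u. B u * ennreal (u powr (- p - 1)) * indicator {0<..} u \<partial>lborel)" (is "_ \<le> ?R")
proof -
  have [measurable]: "X s \<in> borel_measurable M" if "0 \<le> s" for s using that by (rule measurable_X)
  define F where "F n \<omega> = (SUP k\<in>{..2 ^ n}. ennreal (\<bar>X (real k
      * (t / 2 ^ n)) \<omega>\<bar> powr p))" for n :: nat and \<omega>
  have F_meas[measurable]: "F n \<in> borel_measurable M" for n
    unfolding F_def using t by (intro borel_measurable_SUP) auto
  have F_mono: "incseq F"
  proof (intro incseq_SucI le_funI)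
    fix n \<omega>
    show "F n \<omega> \<le> F (Suc n) \<omega>"
      unfolding F_def
    proof (rule SUP_least)
      fix k assume "k \<in> {..2 ^ n :: nat}"
      then show "ennreal (\<bar>X (real k * (t / 2 ^ n)) \<omega>\<bar> powr p)
        \<le> (SUP k\<in>{..2 ^ Suc n}. ennreal (\<bar>X (real k * (t / 2 ^ Suc n)) \<omega>\<bar> powr p))"
        by (intro SUP_upper2[of "2 * k"]) auto
    qed
  qed
  have F_bound: "(\<integral>\<^sup>+\<omega>. F n \<omega> \<partial>M) \<le> ?R" for n
  proof -
    define \<tau> where "\<tau> i = real i * (t / 2 ^ n)" for i
    define D where "D i \<omega> = X (\<tau> (Suc i)) \<omega> - X (\<tau> i) \<omega>" for i \<omega>
    have \<tau>0: "0 \<le> \<tau> i" for i using t by (simp add: \<tau>_def)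
    have \<tau>_mono: "\<tau> i \<le> \<tau> j" if "i
        \<le> j" for i j using t that unfolding \<tau>_def by (intro mult_right_mono) auto
    have \<tau>_end: "\<tau> (2 ^ n) = t" by (simp add: \<tau>_def)
    have sum: "(\<Sum>i<k. D i \<omega>) = X (\<tau> k) \<omega> - X 0 \<omega>" for k \<omega>
      using sum_lessThan_telescope[of "\<lambda>i. X (\<tau> i) \<omega>" k] by (simp add: D_def) (simp add: \<tau>_def)
    have "indep_vars (\<lambda>_. borel) D {..<2 ^ n}"
      unfolding D_def using \<tau>0 \<tau>_mono by (intro indep_increments) auto
    moreover have "(\<integral>\<^sup>+\<omega>. ennreal (1 - cos (u * ((\<Sum>i<2^n. D i \<omega>) - (\<Sum>i<k. D i \<omega>)))) \<partial>M) \<le> B u"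
      if "k \<le> 2 ^ n" "0 < u" for k u
      using nn_integral_cos_increment[OF \<tau>0 \<tau>_mono[OF that(1)], of u] bound[of "t - \<tau> k" u] \<tau>0[of k]
        \<tau>_mono[OF that(1)] that(2) by (simp add: sum \<tau>_end)
    ultimately have "(\<integral>\<^sup>+\<omega>. (SUP k\<in>{..2^n}. ennreal (\<bar>\<Sum>i<k. D i \<omega>\<bar> powr p)) \<partial>M) \<le> ?R"
      using p by (intro nn_integral_max_partial_sums_powr_le B) auto
    also have "(\<integral>\<^sup>+\<omega>. (SUP k\<in>{..2^n}. ennreal (\<bar>\<Sum>i<k. D i \<omega>\<bar> powr p)) \<partial>M) = (\<integral>\<^sup>+\<omega>. F n \<omega> \<partial>M)"
      using start_zero by (intro nn_integral_cong_AE) (auto simp: sum F_def \<tau>_def)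
    finally show ?thesis .
  qed
  have "sup_moment M X p t = (\<integral>\<^sup>+\<omega>. (SUP n. F n \<omega>) \<partial>M)"
    unfolding sup_moment_def F_def by (intro nn_integral_cong_AE SUP_abs_powr_AE_eq_dyadic p t)
  also have "\<dots> = (SUP n. \<integral>\<^sup>+\<omega>. F n \<omega> \<partial>M)"
    by (intro nn_integral_monotone_convergence_SUP F_mono) auto
  also have "\<dots> \<le> ?R" by (intro SUP_least F_bound)
  finally show ?thesis .
qed

section \<open>Elementary bounds for sine and cosine\<close>

lemma one_minus_cos_eq: "1 - cos y = 2 * (sin (y / 2))\<^sup>2" for y :: real
  using cos_double_sin[of "y / 2"] by simp

lemma sin_square_le: "(sin y)\<^sup>2 \<le> y\<^sup>2" for y :: real
  using abs_sin_x_le_abs_x[of y] by (simp add: abs_le_square_iff)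

lemma one_minus_cos_le_square: "1 - cos y \<le> y\<^sup>2 / 2" for y :: real
  using sin_square_le[of "y / 2"] by (simp add: one_minus_cos_eq power_divide)

lemma one_minus_cos_le_min: "1 - cos y \<le> 2 * min 1 (y\<^sup>2)" for y :: real
proof -
  have "1 - cos y \<le> 2 * y\<^sup>2" using one_minus_cos_le_square[of y] zero_le_power2[of y] by linarith
  moreover have "1 - cos y \<le> 2" using cos_ge_minus_one[of y] by simp
  ultimately show ?thesis by (simp add: min_def)
qed

text \<open>
  Each of the following bounds by \<open>\<bar>y\<bar>^s\<close> interpolates between the behaviour at \<open>0\<close> and at infinity; the
  admissible range of \<open>s\<close> is given by the order of vanishing at \<open>0\<close> and the growth at infinity.
\<close>

lemma min_one_square_le_abs_powr:
  fixes y s :: real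
  assumes "0 \<le> s" "s \<le> 2"
  shows "min 1 (y\<^sup>2) \<le> \<bar>y\<bar> powr s"
proof (cases "\<bar>y\<bar> \<le> 1")
  case True
  show ?thesis
  proof (cases "y = 0")
    case False
    have "\<bar>y\<bar> powr 2 \<le> \<bar>y\<bar> powr s" using True False assms by (intro powr_mono') auto
    then show ?thesis using False by (simp add: min_le_iff_disj)
  qed simp
next
  case False
  then have "1 \<le> \<bar>y\<bar> powr s" using assms by (intro ge_one_powr_ge_zero) auto
  then show ?thesis by (simp add: min_le_iff_disj)
qed

lemma one_minus_cos_le_powr:
  fixes y s :: real
  assumes "0 \<le> s" "s \<le> 2"
  shows "\<bar>1 - cos y\<bar> \<le> 2 * \<bar>y\<bar> powr s"
  using one_minus_cos_le_min[of y] min_one_square_le_abs_powr[OF assms, of y] by simp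

lemma abs_sin_le_powr:
  fixes y s :: real
  assumes "0 \<le> s" "s \<le> 1"
  shows "\<bar>sin y\<bar> \<le> 2 * \<bar>y\<bar> powr s"
proof (cases "\<bar>y\<bar> \<le> 1")
  case True
  have "\<bar>y\<bar> powr 1 \<le> \<bar>y\<bar> powr s" if "y \<noteq> 0" using True that assms by (intro powr_mono') auto
  then show ?thesis using abs_sin_x_le_abs_x[of y] by (cases "y = 0") auto
next
  case False
  then have "1 \<le> \<bar>y\<bar> powr s" using assms by (intro ge_one_powr_ge_zero) auto
  then show ?thesis using abs_sin_le_one[of y] by linarith
qed

lemma abs_sin_minus_id_le_powr:
  fixes y s :: real
  assumes "1 \<le> s" "s \<le> 2"
  shows "\<bar>sin y - y\<bar> \<le> 2 * \<bar>y\<bar> powr s"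
proof (cases "\<bar>y\<bar> \<le> 1")
  case True
  have "\<bar>sin y - y\<bar> \<le> cmod (iexp y - (\<Sum>k\<le>1. (\<i> * y) ^ k / fact k))"
    using abs_Im_le_cmod[of "iexp y - (\<Sum>k\<le>1. (\<i> * y) ^ k / fact k)"] by (simp add: Im_exp)
  also have "\<dots> \<le> y\<^sup>2 / 2" using iexp_approx1[of y 1] by (simp add: numeral_2_eq_2)
  also have "y\<^sup>2 = min 1 (y\<^sup>2)" using True abs_square_le_1[of y] by (simp add: min_def)
  also have "\<dots> \<le> \<bar>y\<bar> powr s" using assms by (intro min_one_square_le_abs_powr) auto
  finally show ?thesis using powr_ge_zero[of "\<bar>y\<bar>" s] by linarith
next
  case False
  have "\<bar>sin y - y\<bar> \<le> 2 * \<bar>y\<bar>" using abs_sin_x_le_abs_x[of y] by linarith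
  also have "\<bar>y\<bar> = \<bar>y\<bar> powr 1" using False by simp
  also have "\<dots> \<le> \<bar>y\<bar> powr s" using assms False by (intro powr_mono) auto
  finally show ?thesis by simp
qed

lemma one_minus_cos_ge_square:
  fixes y :: real
  assumes "\<bar>y\<bar> \<le> 1"
  shows "y\<^sup>2 / 8 \<le> 1 - cos y"
proof -
  define z where "z = \<bar>y\<bar> / 2"
  have z: "0 \<le> z" "z \<le> 1 / 2" using assms by (auto simp: z_def)
  have cos: "1 / 2 \<le> cos x" if "0 \<le> x" "x \<le> z" for x
    using cos_mono_le_eq[of "pi / 3" x] that z pi_gt3 by (simp add: cos_60)
  have "sin 0 - 0 / 2 \<le> sin z - z / 2"
    by (rule DERIV_nonneg_imp_nondecreasing[OF z(1)])
      (use cos in \<open>auto intro!: exI derivative_eq_intros\<close>)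
  then have "(z / 2)\<^sup>2 \<le> (sin z)\<^sup>2" using z by (intro power_mono) auto
  moreover have "cos y = cos (2 * z)" by (simp add: z_def abs_if)
  then have "1 - cos y = 2 * (sin z)\<^sup>2" using cos_double_sin[of z] by simp
  ultimately show ?thesis by (simp add: z_def power_divide)
qed

text \<open>
  Here \<open>x1 + i y1\<close> is the part of the exponent due to small jumps and \<open>x2 + i y2\<close> the part due to large ones. The
  first one enters only through \<open>min 1 m\<close>, while the imaginary part of the second one enters squared. For
  \<open>p \<ge> 1\<close> this square is essential: near \<open>u = 0\<close> the function \<open>y2\<close> is in general of order \<open>u\<close>, which is not
  integrable against \<open>u^(-p-1)\<close>, but \<open>u\<^sup>2\<close> is.
\<close>

lemma one_minus_exp_cos_le:
  fixes x1 x2 y1 y2 m :: real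
  assumes "0 \<le> x1" "0 \<le> x2" "x1 \<le> m" "\<bar>y1\<bar> \<le> m"
  shows "1 - exp (- (x1 + x2)) * cos (y1 + y2) \<le> 3 * min 1 m + x2 + y2\<^sup>2"
proof -
  let ?x = "x1 + x2" and ?y = "y1 + y2"
  have e: "1 - exp (- ?x) \<le> min 1 m + x2"
  proof (cases "m \<le> 1")
    case True
    have "1 - exp (- ?x) \<le> x1 + x2" using exp_ge_add_one_self[of "- ?x"] by linarith
    then show ?thesis using True assms by simp
  next
    case False
    have "1 - exp (- ?x) \<le> 1" by simp
    also have "1 \<le> min 1 m + x2" using False assms by simp
    finally show ?thesis .
  qed
  have c: "exp (- ?x) * (1 - cos ?y) \<le> 1 * (1 - cos ?y)"
    using assms by (intro mult_right_mono) auto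
  have y: "1 - cos ?y \<le> 2 * min 1 m + y2\<^sup>2"
  proof (cases "m \<le> 1")
    case True
    have "1 - cos ?y \<le> ?y\<^sup>2 / 2" by (rule one_minus_cos_le_square)
    also have "\<dots> \<le> y1\<^sup>2 + y2\<^sup>2" using sum_squares_bound[of y1 y2] by (simp add: power2_sum)
    also have "y1\<^sup>2 \<le> m * m" using assms power_mono[of "\<bar>y1\<bar>" m 2] by (simp add: power2_eq_square)
    also have "m * m \<le> 1 * m" using True assms by (intro mult_right_mono) auto
    finally show ?thesis using True assms by simp
  next
    case False
    then show ?thesis using cos_ge_minus_one[of ?y] zero_le_power2[of y2] by linarith
  qed
  have "1 - exp (- ?x) * cos ?y = (1 - exp (- ?x)) + exp (- ?x) * (1 - cos ?y)"
    by (simp add: algebra_simps)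
  also have "\<dots> \<le> (min 1 m + x2) + (2 * min 1 m + y2\<^sup>2)"
    using c y by (intro add_mono e) simp
  finally show ?thesis by simp
qed

section \<open>The Levy exponent\<close>

lemma levy_measure_sets: "levy_measure \<nu> \<Longrightarrow> sets \<nu> = sets borel"
  by (simp add: levy_measure_def)

lemma levy_integrable_min_one_square:
  assumes \<nu>: "levy_measure \<nu>"
  shows "integrable \<nu> (\<lambda>x. min 1 (x\<^sup>2))"
proof (rule integrableI_bounded)
  have [measurable_cong]: "sets \<nu> = sets borel" by (rule levy_measure_sets[OF \<nu>])
  show "(\<lambda>x. min 1 (x\<^sup>2)) \<in> borel_measurable \<nu>" by measurable
  show "(\<integral>\<^sup>+x. ennreal (norm (min 1 (x\<^sup>2))) \<partial>\<nu>) < \<infinity>"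
    using \<nu> by (simp add: levy_measure_def min.commute)
qed

text \<open>
  After compensation the integrands of the exponent are bounded and vanish at \<open>0\<close> to second order, which is
  what integrability for every Levy measure requires.
\<close>

lemma levy_integrable_bound:
  fixes f :: "real \<Rightarrow> real"
  assumes \<nu>: "levy_measure \<nu>" and f: "f \<in> borel_measurable borel"
    and le: "\<And>x. \<bar>f x\<bar> \<le> K * min 1 (x\<^sup>2)"
  shows "integrable \<nu> f"
proof (rule Bochner_Integration.integrable_bound)
  show "integrable \<nu> (\<lambda>x. K * min 1 (x\<^sup>2))"
    by (intro integrable_mult_right levy_integrable_min_one_square \<nu>)
  show "f \<in> borel_measurable \<nu>" using f levy_measure_sets[OF \<nu>] by (simp cong: measurable_cong_sets)
  show "AE x in \<nu>. norm (f x) \<le> norm (K * min 1 (x\<^sup>2))"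
    by (intro AE_I2) (metis abs_ge_self le order_trans real_norm_def)
qed

lemma min_one_square_scale:
  fixes u x :: real
  shows "min 1 ((u * x)\<^sup>2) \<le> (1 + u\<^sup>2) * min 1 (x\<^sup>2)"
proof (cases "x\<^sup>2 \<le> 1")
  case True
  have "min 1 ((u * x)\<^sup>2) \<le> u\<^sup>2 * x\<^sup>2" by (simp add: power_mult_distrib)
  also have "\<dots> \<le> (1 + u\<^sup>2) * x\<^sup>2" by (intro mult_right_mono) auto
  finally show ?thesis using True by simp
next
  case False
  then have m: "min 1 (x\<^sup>2) = 1" by simp
  show ?thesis unfolding m by (simp add: min_le_iff_disj)
qed

lemma levy_integrable_one_minus_cos:
  assumes \<nu>: "levy_measure \<nu>"
  shows "integrable \<nu> (\<lambda>x. 1 - cos (u * x))"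
proof (rule levy_integrable_bound[OF \<nu>])
  fix x
  show "\<bar>1 - cos (u * x)\<bar> \<le> (2 * (1 + u\<^sup>2)) * min 1 (x\<^sup>2)"
    using order_trans[OF one_minus_cos_le_min mult_left_mono[OF min_one_square_scale]]
    by (simp add: mult.assoc del: distrib_left_numeral)
qed measurable

lemma levy_integrable_compensated_sin:
  assumes \<nu>: "levy_measure \<nu>"
  shows "integrable \<nu> (\<lambda>x. sin (u * x) - u * x * indicator {x. \<bar>x\<bar> \<le> 1} x)"
proof (rule levy_integrable_bound[OF \<nu>])
  fix x :: real
  show "\<bar>sin (u * x) - u * x * indicator {x. \<bar>x\<bar> \<le> 1} x\<bar> \<le> (1 + 2 * u\<^sup>2) * min 1 (x\<^sup>2)"
  proof (cases "\<bar>x\<bar> \<le> 1")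
    case True
    have "\<bar>sin (u * x) - u * x\<bar> \<le> 2 * \<bar>u * x\<bar> powr 2" by (rule abs_sin_minus_id_le_powr) auto
    also have "\<dots> = 2 * u\<^sup>2 * x\<^sup>2" by (simp add: power_mult_distrib)
    also have "\<dots> \<le> (1 + 2 * u\<^sup>2) * x\<^sup>2" by (intro mult_right_mono) auto
    finally show ?thesis using True abs_square_le_1[of x] by simp
  next
    case False
    then have "1 \<le> x\<^sup>2" using abs_square_le_1[of x] by auto
    then show ?thesis using False abs_sin_le_one[of "u * x"] by (simp add: add_increasing2)
  qed
qed measurable

lemma levy_exponent_Re_Im:
  assumes \<nu>: "levy_measure \<nu>"
  shows "levy_exponent a 0 \<nu> u = Complex (LINT x|\<nu>. 1 - cos (u * x))
    (- u * a - (LINT x|\<nu>. sin (u * x) - u * x * indicator {x. \<bar>x\<bar> \<le> 1} x))"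
proof -
  let ?c = "\<lambda>x. 1 - cos (u * x)" and ?s = "\<lambda>x. sin (u * x) - u * x * indicator {x. \<bar>x\<bar> \<le> 1} x"
  have "(CLINT x|\<nu>. iexp (u * x) - 1 - \<i> * of_real (u * x * indicator {x. \<bar>x\<bar> \<le> 1} x))
    = (CLINT x|\<nu>. of_real (- ?c x) + \<i> * of_real (?s x))"
    by (intro Bochner_Integration.integral_cong) (auto simp: complex_eq_iff Re_exp Im_exp)
  also have "\<dots> = of_real (- (LINT x|\<nu>. ?c x)) + \<i> * of_real (LINT x|\<nu>. ?s x)"
    using levy_integrable_one_minus_cos[OF \<nu>, of u] levy_integrable_compensated_sin[OF \<nu>, of u]
    by (subst Bochner_Integration.integral_add)
       (auto simp del: of_real_minus of_real_diff of_real_mult minus_diff_eq intro!: integrable_of_real)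
  finally show ?thesis
    unfolding levy_exponent_def by (simp only:) (simp add: complex_eq_iff)
qed

lemma levy_characteristic_function:
  "has_levy_characteristics M X a \<sigma>2 \<nu> \<Longrightarrow> 0 \<le> t \<Longrightarrow>
    (CLINT \<omega>|M. iexp (u * X t \<omega>)) = exp (- of_real t * levy_exponent a \<sigma>2 \<nu> u)"
  unfolding has_levy_characteristics_def by blast

text \<open>
  For a random variable whose characteristic function is \<open>e^(-s\<Psi>)\<close> with \<open>\<Psi> = R + i I\<close>, subtracting the drift
  \<open>d s\<close> shifts the imaginary part of \<open>\<Psi>\<close> by \<open>u d\<close>.
\<close>

lemma (in prob_space) nn_integral_one_minus_cos_drift:
  assumes Z[measurable]: "random_variable borel Z"
    and char: "(CLINT \<omega>|M. iexp (u * Z \<omega>)) = exp (- of_real s * Complex R I)"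
  shows "(\<integral>\<^sup>+\<omega>. ennreal (1 - cos (u * (Z \<omega> - d * s))) \<partial>M)
    = ennreal (1 - exp (- (s * R)) * cos (s * (I + u * d)))"
proof -
  have int: "integrable M (\<lambda>\<omega>. iexp (u * Z \<omega>))"
    by (intro integrable_const_bound[of _ 1]) auto
  have cos_int: "integrable M (\<lambda>\<omega>. cos (u * (Z \<omega> - d * s)))"
    by (intro integrable_const_bound[of _ 1]) auto
  have "(LINT \<omega>|M. cos (u * (Z \<omega> - d * s))) = (LINT \<omega>|M. Re (iexp (- u * d * s) * iexp (u * Z \<omega>)))"
    by (intro Bochner_Integration.integral_cong) (simp_all add: Re_exp algebra_simps flip: exp_add)
  also have "\<dots> = Re (iexp (- u * d * s) * (CLINT \<omega>|M. iexp (u * Z \<omega>)))"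
    using int by (subst integral_Re) auto
  also have "\<dots> = exp (- (s * R)) * cos (- (s * (I + u * d)))"
    unfolding char by (simp add: Re_exp algebra_simps flip: exp_add)
  finally have E: "(LINT \<omega>|M. cos (u * (Z \<omega> - d * s))) = exp (- (s * R)) * cos (s * (I + u * d))"
    by simp
  have "(\<integral>\<^sup>+\<omega>. ennreal (1 - cos (u * (Z \<omega> - d * s))) \<partial>M) = ennreal (LINT \<omega>|M. 1 - cos (u * (Z \<omega> - d
      * s)))"
    using cos_int by (intro nn_integral_eq_integral) auto
  also have "(LINT \<omega>|M. 1 - cos (u * (Z \<omega> - d * s))) = 1 - exp (- (s * R)) * cos (s * (I + u * d))"
    using cos_int E by (simp add: prob_space)
  finally show ?thesis .
qed

lemma levy_measure_tail_finite:
  assumes \<nu>: "levy_measure \<nu>" and \<delta>: "0 < \<delta>"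
  shows "emeasure \<nu> {x. \<delta> < \<bar>x\<bar>} < \<infinity>"
proof -
  have [measurable_cong]: "sets \<nu> = sets borel" by (rule levy_measure_sets[OF \<nu>])
  have "{x. \<delta> < \<bar>x\<bar>} \<in> sets \<nu>" by measurable
  moreover have "integrable \<nu> (indicator {x. \<delta> < \<bar>x\<bar>} :: real \<Rightarrow> real)"
  proof (rule levy_integrable_bound[OF \<nu>])
    fix x :: real
    show "\<bar>indicator {x. \<delta> < \<bar>x\<bar>} x\<bar> \<le> (1 / min 1 (\<delta>\<^sup>2)) * min 1 (x\<^sup>2)"
    proof (cases "\<delta> < \<bar>x\<bar>")
      case True
      then have "\<delta>\<^sup>2 \<le> x\<^sup>2" using \<delta> by (simp flip: abs_le_square_iff)
      then have "min 1 (\<delta>\<^sup>2) \<le> min 1 (x\<^sup>2)" by auto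
      then show ?thesis using True \<delta> by (simp add: field_simps)
    qed simp
  qed measurable
  ultimately show ?thesis by (simp add: integrable_indicator_iff)
qed

lemma levy_integrable_tail:
  fixes f :: "real \<Rightarrow> real"
  assumes \<nu>: "levy_measure \<nu>" and \<delta>: "0 < \<delta>" and f: "f \<in> borel_measurable borel"
    and le: "\<And>x. \<delta> < \<bar>x\<bar> \<Longrightarrow> \<bar>f x\<bar> \<le> K"
  shows "integrable \<nu> (\<lambda>x. indicator {x. \<delta> < \<bar>x\<bar>} x * f x)"
proof (rule integrableI_bounded_set[where A = "{x. \<delta> < \<bar>x\<bar>}" and B = K])
  have [measurable_cong]: "sets \<nu> = sets borel" by (rule levy_measure_sets[OF \<nu>])
  show "{x. \<delta> < \<bar>x\<bar>} \<in> sets \<nu>" by measurable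
  have [measurable]: "f \<in> borel_measurable \<nu>" using f by measurable
  show "(\<lambda>x. indicator {x. \<delta> < \<bar>x\<bar>} x * f x) \<in> borel_measurable \<nu>" by measurable
qed (use levy_measure_tail_finite[OF \<nu> \<delta>] le in auto)

text \<open>
  The function \<open>w\<close> will be the real or imaginary part of the suitably compensated exponential. The threshold \<open>h\<close> decides
  which of the two power bounds is used: \<open>r\<close> is larger than the index and serves for jumps up to \<open>h\<close>, \<open>q\<close> is
  smaller and serves for jumps between \<open>h\<close> and \<open>\<delta>\<close>.
\<close>

lemma small_jump_integral_le:
  fixes w :: "real \<Rightarrow> real"
  assumes sets: "sets \<nu> = sets borel" and w: "w \<in> borel_measurable borel"
    and w_r: "\<And>y. \<bar>w y\<bar> \<le> 2 * \<bar>y\<bar> powr r" and w_q: "\<And>y. \<bar>w y\<bar> \<le> 2 * \<bar>y\<bar> powr q"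
    and A: "(\<integral>\<^sup>+x. ennreal (\<bar>x\<bar> powr r) * indicator {0<..h} \<bar>x\<bar> \<partial>\<nu>) \<le> ennreal A" "0 \<le> A"
    and D: "(\<integral>\<^sup>+x. ennreal (\<bar>x\<bar> powr q) * indicator {h<..\<delta>} \<bar>x\<bar> \<partial>\<nu>) \<le> ennreal D" "0 \<le> D"
    and u: "0 < u"
  shows "integrable \<nu> (\<lambda>x. indicator {x. \<bar>x\<bar> \<le> \<delta>} x * w (u * x))"
    and "\<bar>LINT x|\<nu>. indicator {x. \<bar>x\<bar> \<le> \<delta>} x * w (u * x)\<bar> \<le> 2 * (A * u powr r + D * u powr q)"
proof -
  note sets[measurable_cong] w[measurable]
  let ?f = "\<lambda>x. indicator {x. \<bar>x\<bar> \<le> \<delta>} x * w (u * x)"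
  have le: "(\<integral>\<^sup>+x. ennreal (norm (?f x)) \<partial>\<nu>) \<le> ennreal (2 * (A * u powr r + D * u powr q))"
  proof -
    have "(\<integral>\<^sup>+x. ennreal (norm (?f x)) \<partial>\<nu>)
      \<le> (\<integral>\<^sup>+x. ennreal (2 * u powr r) * (ennreal (\<bar>x\<bar> powr r) * indicator {0<..h} \<bar>x\<bar>)
            + ennreal (2 * u powr q) * (ennreal (\<bar>x\<bar> powr q) * indicator {h<..\<delta>} \<bar>x\<bar>) \<partial>\<nu>)"
    proof (rule nn_integral_mono)
      fix x
      have r: "\<bar>w (u * x)\<bar> \<le> 2 * u powr r * \<bar>x\<bar> powr r" and q: "\<bar>w (u * x)\<bar> \<le> 2 * u powr q * \<bar>x\<bar> powr q"
        using w_r[of "u * x"] w_q[of "u * x"] u by (simp_all add: abs_mult powr_mult mult.assoc)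
      consider "\<delta> < \<bar>x\<bar>" | "x = 0" | "\<bar>x\<bar> \<le> \<delta>" "0 < \<bar>x\<bar>" "\<bar>x\<bar> \<le> h" | "\<bar>x\<bar> \<le> \<delta>" "h < \<bar>x\<bar>" by force
      then show "ennreal (norm (?f x)) \<le> ennreal (2 * u powr r) * (ennreal (\<bar>x\<bar> powr r)
          * indicator {0<..h} \<bar>x\<bar>)
            + ennreal (2 * u powr q) * (ennreal (\<bar>x\<bar> powr q) * indicator {h<..\<delta>} \<bar>x\<bar>)"
        by cases (use r q in \<open>auto simp: ennreal_leI simp flip: ennreal_mult\<close>)
    qed
    also have "\<dots> = ennreal (2 * u powr r) * (\<integral>\<^sup>+x. ennreal (\<bar>x\<bar> powr r) * indicator {0<..h} \<bar>x\<bar> \<partial>\<nu>)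
      + ennreal (2 * u powr q) * (\<integral>\<^sup>+x. ennreal (\<bar>x\<bar> powr q) * indicator {h<..\<delta>} \<bar>x\<bar> \<partial>\<nu>)"
      by (simp add: nn_integral_add nn_integral_cmult)
    also have "\<dots> \<le> ennreal (2 * u powr r) * ennreal A + ennreal (2 * u powr q) * ennreal D"
      by (intro add_mono mult_left_mono A D) auto
    also have "\<dots> = ennreal (2 * (A * u powr r + D * u powr q))"
      using A D by (simp add: algebra_simps flip: ennreal_mult ennreal_plus)
    finally show ?thesis .
  qed
  show int: "integrable \<nu> ?f"
    using le by (intro integrableI_bounded) (auto intro: le_less_trans)
  have "ennreal \<bar>LINT x|\<nu>. ?f x\<bar> \<le> ennreal (2 * (A * u powr r + D * u powr q))"
    using integral_norm_bound_ennreal[OF int] le by simp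
  then show "\<bar>LINT x|\<nu>. ?f x\<bar> \<le> 2 * (A * u powr r + D * u powr q)"
    using A D by (subst (asm) ennreal_le_iff) auto
qed

text \<open>
  Cauchy-Schwarz for the finite measure that \<open>\<nu>\<close> induces on \<open>\<bar>x\<bar> > \<delta>\<close>, obtained from the sign of the quadratic
  polynomial \<open>m \<mapsto> \<integral> (f - m)\<^sup>2\<close>.
\<close>

lemma square_tail_integral_le:
  fixes f :: "real \<Rightarrow> real"
  assumes \<nu>: "levy_measure \<nu>" and \<delta>: "0 < \<delta>" and f[measurable]: "f \<in> borel_measurable borel"
    and le: "\<And>x. \<bar>f x\<bar> \<le> 1"
  shows "(LINT x|\<nu>. indicator {x. \<delta> < \<bar>x\<bar>} x * f x)\<^sup>2
    \<le> measure \<nu> {x. \<delta> < \<bar>x\<bar>} * (LINT x|\<nu>. indicator {x. \<delta> < \<bar>x\<bar>} x * (f x)\<^sup>2)"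
proof -
  let ?S = "{x. \<delta> < \<bar>x\<bar>}"
  define \<tau> J Q where "\<tau> = measure \<nu> ?S" and "J = (LINT x|\<nu>. indicator ?S x * f x)"
    and "Q = (LINT x|\<nu>. indicator ?S x * (f x)\<^sup>2)"
  have int1: "integrable \<nu> (\<lambda>x. indicator ?S x * f x)"
    by (rule levy_integrable_tail[OF \<nu> \<delta> f le])
  have int2: "integrable \<nu> (\<lambda>x. indicator ?S x * (f x)\<^sup>2)"
    by (rule levy_integrable_tail[OF \<nu> \<delta>, of _ 1]) (use le in \<open>auto simp: abs_square_le_1\<close>)
  have int0: "integrable \<nu> (\<lambda>x. indicator ?S x * (1::real))"
    by (rule levy_integrable_tail[OF \<nu> \<delta>, of _ 1]) auto
  have quad: "0 \<le> Q - 2 * m * J + m\<^sup>2 * \<tau>" for m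
  proof -
    have "0 \<le> (LINT x|\<nu>. indicator ?S x * (f x - m)\<^sup>2)"
      by (intro Bochner_Integration.integral_nonneg) auto
    also have "\<dots> = (LINT x|\<nu>. indicator ?S x * (f x)\<^sup>2 - 2 * m * (indicator ?S x * f x) + m\<^sup>2
        * (indicator ?S x * 1))"
      by (intro Bochner_Integration.integral_cong) (auto simp: power2_diff algebra_simps)
    also have "\<dots> = Q - 2 * m * J + m\<^sup>2 * (LINT x|\<nu>. indicator ?S x * 1)"
      using int0 int1 int2 unfolding Q_def J_def
      by (subst Bochner_Integration.integral_add) (auto simp: Bochner_Integration.integral_diff)
    also have "(LINT x|\<nu>. indicator ?S x * 1) = \<tau>"
      using levy_measure_sets[OF \<nu>] by (simp add: \<tau>_def sets_eq_imp_space_eq)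
    finally show ?thesis .
  qed
  show ?thesis
  proof (cases "\<tau> = 0")
    case True
    have "J = 0"
    proof (rule ccontr)
      assume "J \<noteq> 0"
      then show False using quad[of "(Q + 1) / (2 * J)"] True by simp
    qed
    then show ?thesis using True by (simp add: J_def \<tau>_def)
  next
    case False
    then have "0 < \<tau>" by (simp add: \<tau>_def less_le)
    then have "0 \<le> \<tau> * (Q - 2 * (J / \<tau>) * J + (J / \<tau>)\<^sup>2 * \<tau>)"
      using quad[of "J / \<tau>"] by (intro mult_nonneg_nonneg) auto
    also have "\<dots> = \<tau> * Q - J\<^sup>2"
      using \<open>0 < \<tau>\<close> by (simp add: field_simps power2_eq_square)
    finally show ?thesis by (simp add: J_def Q_def \<tau>_def)
  qed
qed

section \<open>Moments of the Levy measure away from zero\<close>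

text \<open>
  By Tonelli this is the bound for \<open>min 1 (A u\<^sup>2)\<close> with \<open>A = z\<^sup>2\<close>, integrated over the values \<open>z\<close> of \<open>Z\<close>. It is
  used twice: for \<open>Z = X_1\<close>, and for the identity under the Levy measure of the large jumps.
\<close>

lemma (in sigma_finite_measure) nn_integral_min_one_square_le_moment:
  fixes Z :: "'a \<Rightarrow> real"
  assumes Z[measurable]: "Z \<in> borel_measurable M" and p: "0 < p" "p < 2"
  shows "(\<integral>\<^sup>+u. (\<integral>\<^sup>+\<omega>. ennreal (min 1 ((u * Z \<omega>)\<^sup>2)) \<partial>M) * ennreal (u powr (- p - 1))
      * indicator {0<..} u \<partial>lborel)
    \<le> ennreal (1 / (2 - p) + 1 / p) * (\<integral>\<^sup>+\<omega>. ennreal (\<bar>Z \<omega>\<bar> powr p) \<partial>M)"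
proof -
  interpret LM: pair_sigma_finite lborel M ..
  have point: "(\<integral>\<^sup>+u. ennreal (min 1 ((u * z)\<^sup>2)) * ennreal (u powr (- p - 1))
      * indicator {0<..} u \<partial>lborel)
    \<le> ennreal (1 / (2 - p) + 1 / p) * ennreal (\<bar>z\<bar> powr p)" for z
  proof (cases "z = 0")
    case False
    have "(\<integral>\<^sup>+u. ennreal (min 1 ((u * z)\<^sup>2)) * ennreal (u powr (- p - 1)) * indicator {0<..} u \<partial>lborel)
      = (\<integral>\<^sup>+u. ennreal (min 1 (z\<^sup>2 * u powr 2) * u powr (- p - 1)) * indicator {0<..} u \<partial>lborel)"
      by (intro nn_integral_cong)
          (auto split: split_indicator simp: power_mult_distrib mult.commute simp flip: ennreal_mult)
    also have "\<dots> \<le> ennreal ((1 / (2 - p) + 1 / p) * (z\<^sup>2) powr (p / 2))"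
      using p False by (intro nn_integral_min_one_powr_le) auto
    also have "(z\<^sup>2) powr (p / 2) = (\<bar>z\<bar> powr 2) powr (p / 2)" using False by simp
    also have "\<dots> = \<bar>z\<bar> powr p" by (simp only: powr_powr) simp
    finally show ?thesis using p by (simp add: ennreal_mult)
  qed simp
  have "(\<integral>\<^sup>+u. (\<integral>\<^sup>+\<omega>. ennreal (min 1 ((u * Z \<omega>)\<^sup>2)) \<partial>M) * ennreal (u powr (- p - 1))
      * indicator {0<..} u \<partial>lborel)
    = (\<integral>\<^sup>+u. (\<integral>\<^sup>+\<omega>. ennreal (min 1 ((u * Z \<omega>)\<^sup>2)) * ennreal (u powr
        (- p - 1)) * indicator {0<..} u \<partial>M) \<partial>lborel)"
    by (simp add: nn_integral_multc)
  also have "\<dots> = (\<integral>\<^sup>+\<omega>. (\<integral>\<^sup>+u. ennreal (min 1 ((u * Z \<omega>)\<^sup>2)) * ennreal (u powr (- p - 1))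
      * indicator {0<..} u \<partial>lborel) \<partial>M)"
    by (rule LM.Fubini'[symmetric]) measurable
  also have "\<dots> \<le> (\<integral>\<^sup>+\<omega>. ennreal (1 / (2 - p) + 1 / p) * ennreal (\<bar>Z \<omega>\<bar> powr p) \<partial>M)"
    by (intro nn_integral_mono point)
  finally show ?thesis by (simp add: nn_integral_cmult)
qed

text \<open>
  On \<open>0 < u < \<delta> / \<bar>x\<bar>\<close> one has \<open>\<bar>u x\<bar> \<le> 1\<close>, hence \<open>1 - cos (u x) \<ge> (u x)\<^sup>2 / 8\<close>, and the integral of
  \<open>x\<^sup>2 u^(1-p)\<close> over this interval is of the order \<open>\<bar>x\<bar>^p\<close>.
\<close>

lemma abs_powr_le_nn_integral_one_minus_cos:
  fixes x p \<delta> :: real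
  assumes p: "p < 2" and \<delta>: "0 < \<delta>" "\<delta> \<le> 1" and x: "\<delta> < \<bar>x\<bar>"
  shows "ennreal (\<delta> powr (2 - p) / (8 * (2 - p)) * \<bar>x\<bar> powr p)
    \<le> (\<integral>\<^sup>+u. ennreal (1 - cos (u * x)) * ennreal (u powr (- p - 1)) * indicator {0<..<1} u \<partial>lborel)"
proof -
  have x2: "x\<^sup>2 = \<bar>x\<bar> powr p * \<bar>x\<bar> powr (2 - p)" using x \<delta> by (simp flip: powr_add)
  have "\<delta> powr (2 - p) / (8 * (2 - p)) * \<bar>x\<bar> powr p = x\<^sup>2 / 8 * ((\<delta> / \<bar>x\<bar>) powr (2 - p) / (2 - p))"
    unfolding x2 using x \<delta> p by (simp add: powr_divide field_simps)
  then have "ennreal (\<delta> powr (2 - p) / (8 * (2 - p)) * \<bar>x\<bar> powr p)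
    = ennreal (x\<^sup>2 / 8) * (\<integral>\<^sup>+u. ennreal (u powr (1 - p)) * indicator {0<..<\<delta> / \<bar>x\<bar>} u \<partial>lborel)"
    using nn_integral_powr_from_0[of "1 - p" "\<delta> / \<bar>x\<bar>"] p \<delta> x by (simp flip: ennreal_mult)
  also have "\<dots> = (\<integral>\<^sup>+u. ennreal (x\<^sup>2 / 8) * (ennreal (u powr (1 - p))
      * indicator {0<..<\<delta> / \<bar>x\<bar>} u) \<partial>lborel)"
    by (intro nn_integral_cmult[symmetric]) measurable
  also have "\<dots> \<le> (\<integral>\<^sup>+u. ennreal (1 - cos (u * x)) * ennreal (u powr (- p - 1))
      * indicator {0<..<1} u \<partial>lborel)"
  proof (intro nn_integral_mono)
    fix u :: real
    show "ennreal (x\<^sup>2 / 8) * (ennreal (u powr (1 - p)) * indicator {0<..<\<delta> / \<bar>x\<bar>} u)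
      \<le> ennreal (1 - cos (u * x)) * ennreal (u powr (- p - 1)) * indicator {0<..<1} u"
    proof (cases "0 < u \<and> u < \<delta> / \<bar>x\<bar>")
      case True
      then have "u * \<bar>x\<bar> < \<delta>" using x \<delta> by (simp add: field_simps)
      then have ux: "\<bar>u * x\<bar> \<le> 1" using True \<delta> by (simp add: abs_mult)
      have "\<delta> / \<bar>x\<bar> < 1" using x \<delta> by simp
      then have u1: "u < 1" using True by linarith
      have "u powr (1 - p) = u\<^sup>2 * u powr (- p - 1)"
        using True by (simp flip: powr_add powr_numeral)
      then have "x\<^sup>2 / 8 * u powr (1 - p) = (u * x)\<^sup>2 / 8
          * u powr (- p - 1)" by (simp add: power_mult_distrib)
      also have "\<dots> \<le> (1 - cos (u * x)) * u powr (- p - 1)"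
        by (intro mult_right_mono one_minus_cos_ge_square ux) auto
      finally show ?thesis using True u1 by (simp add: ennreal_leI flip: ennreal_mult)
    qed auto
  qed
  finally show ?thesis .
qed

text \<open>
  The Levy measure of the large jumps is a finite measure, so that Tonelli's theorem applies to it.
\<close>

lemma levy_tail_measure:
  assumes \<nu>: "levy_measure \<nu>" and \<delta>: "0 < \<delta>"
  defines "T \<equiv> density \<nu> (indicator {x. \<delta> < \<bar>x\<bar>})"
  shows "sets T = sets borel" and "finite_measure T"
    and "f \<in> borel_measurable borel \<Longrightarrow> (\<integral>\<^sup>+x. f x \<partial>T) = (\<integral>\<^sup>+x. f x * indicator {x. \<delta> < \<bar>x\<bar>} x \<partial>\<nu>)"
proof -
  have [measurable_cong]: "sets \<nu> = sets borel" by (rule levy_measure_sets[OF \<nu>])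
  show "sets T = sets borel" by (simp add: T_def levy_measure_sets[OF \<nu>])
  have sp: "space \<nu> = UNIV" using levy_measure_sets[OF \<nu>] by (simp add: sets_eq_imp_space_eq)
  show "finite_measure T"
  proof
    have "emeasure T (space T) = emeasure \<nu> {x. \<delta> < \<bar>x\<bar>}"
      unfolding T_def by (subst emeasure_density) (auto simp: sp levy_measure_sets[OF \<nu>])
    then show "emeasure T (space T) \<noteq> \<infinity>" using levy_measure_tail_finite[OF \<nu> \<delta>] by simp
  qed
  show "f \<in> borel_measurable borel \<Longrightarrow> (\<integral>\<^sup>+x. f x \<partial>T) = (\<integral>\<^sup>+x. f x * indicator {x. \<delta> < \<bar>x\<bar>} x \<partial>\<nu>)"
    unfolding T_def by (subst nn_integral_density) (auto simp: mult.commute)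
qed

text \<open>
  Let \<open>R u\<close> be the real part of the exponent. Then \<open>1 - e^(-R u) \<le> 1 - Re E e^(iuX_1)\<close>, and the right-hand side
  is integrable against \<open>u^(-p-1)\<close> because \<open>X_1\<close> has a \<open>p\<close>-th moment. For \<open>0 < u < 1\<close> the function \<open>R\<close> is bounded,
  so \<open>R u\<close> itself is at most a multiple of \<open>1 - e^(-R u)\<close>. Since \<open>R\<close> dominates the contribution of the large
  jumps, Tonelli's theorem and the lower bound for the cosine integral give their \<open>p\<close>-th moment.
\<close>

lemma (in levy_process) levy_measure_tail_moment_finite:
  assumes chars: "has_levy_characteristics M X a 0 \<nu>" and p: "0 < p" "p < 2"
    and moment: "integrable M (\<lambda>\<omega>. \<bar>X 1 \<omega>\<bar> powr p)" and \<delta>: "0 < \<delta>" "\<delta> \<le> 1"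
  shows "(\<integral>\<^sup>+x. ennreal (\<bar>x\<bar> powr p) * indicator {x. \<delta> < \<bar>x\<bar>} x \<partial>\<nu>) < \<infinity>"
proof -
  have \<nu>: "levy_measure \<nu>" using chars by (simp add: has_levy_characteristics_def)
  have [measurable]: "X 1 \<in> borel_measurable M" by (rule measurable_X) simp
  have [measurable_cong]: "sets \<nu> = sets borel" by (rule levy_measure_sets[OF \<nu>])
  define T where "T = density \<nu> (indicator {x. \<delta> < \<bar>x\<bar>})"
  note T = levy_tail_measure[OF \<nu> \<delta>(1), folded T_def]
  note T(1)[measurable_cong]
  interpret T: finite_measure T by (rule T(2))
  interpret LT: pair_sigma_finite lborel T ..
  define R where "R u = (LINT x|\<nu>. 1 - cos (u * x))" for u
  define R1 where "R1 = (LINT x|\<nu>. 2 * min 1 (x\<^sup>2))"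
  have R0: "0 \<le> R u" for u unfolding R_def by (intro Bochner_Integration.integral_nonneg) simp
  have R10: "0 \<le> R1" unfolding R1_def by (intro Bochner_Integration.integral_nonneg) simp
  have R_le: "R u \<le> R1" if "0 < u" "u < 1" for u
    unfolding R_def R1_def
  proof (rule integral_mono)
    show "integrable \<nu> (\<lambda>x. 1 - cos (u * x))" by (rule levy_integrable_one_minus_cos[OF \<nu>])
    show "integrable \<nu> (\<lambda>x. 2 * min 1 (x\<^sup>2))"
      by (intro integrable_mult_right levy_integrable_min_one_square \<nu>)
    fix x :: real
    have "(u * x)\<^sup>2 \<le> x\<^sup>2"
      using that by (auto simp: abs_mult mult_left_le_one_le simp flip: abs_le_square_iff)
    then show "1 - cos (u * x) \<le> 2 * min 1 (x\<^sup>2)"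
      using one_minus_cos_le_min[of "u * x"] by auto
  qed
  have tail_le: "(\<integral>\<^sup>+x. ennreal (1 - cos (u * x)) \<partial>T)
    \<le> ennreal (2 * (1 + R1)) * (\<integral>\<^sup>+\<omega>. ennreal (min 1 ((u * X 1 \<omega>)\<^sup>2)) \<partial>M)" if u: "0 < u" "u < 1" for u
  proof -
    define I where "I = - u * a - (LINT x|\<nu>. sin (u * x) - u * x * indicator {x. \<bar>x\<bar> \<le> 1} x)"
    have "(CLINT \<omega>|M. iexp (u * X 1 \<omega>)) = exp (- of_real 1 * Complex (R u) I)"
      using levy_characteristic_function[OF chars zero_le_one, of u]
      unfolding I_def R_def levy_exponent_Re_Im[OF \<nu>] .
    from nn_integral_one_minus_cos_drift[OF _ this, of 0]
    have E: "(\<integral>\<^sup>+\<omega>. ennreal (1 - cos (u * X 1 \<omega>)) \<partial>M) = ennreal (1 - exp (- R u) * cos I)" by simp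
    have "(\<integral>\<^sup>+x. ennreal (1 - cos (u * x)) \<partial>T) \<le> (\<integral>\<^sup>+x. ennreal (1 - cos (u * x)) \<partial>\<nu>)"
      by (subst T(3)) (auto intro!: nn_integral_mono split: split_indicator)
    also have "\<dots> = ennreal (R u)"
      unfolding R_def using levy_integrable_one_minus_cos[OF \<nu>, of u]
          by (intro nn_integral_eq_integral) auto
    also have "R u \<le> (1 + R1) * (1 - exp (- R u) * cos I)"
    proof -
      have "exp (- R u) \<le> inverse (1 + R u)"
        unfolding exp_minus using R0[of u] exp_ge_add_one_self[of "R u"]
            by (intro le_imp_inverse_le) auto
      then have "R u / (1 + R u) \<le> 1 - exp (- R u)" using R0[of u] by (simp add: field_simps)
      then have "R u \<le> (1 + R u) * (1 - exp (- R u))" using R0[of u] by (simp add: field_simps)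
      also have "\<dots> \<le> (1 + R1) * (1 - exp (- R u) * cos I)"
        using R_le[OF u] R0[of u] R10 by (intro mult_mono) auto
      finally show ?thesis .
    qed
    then have "ennreal (R u) \<le> ennreal (1 + R1) * (\<integral>\<^sup>+\<omega>. ennreal (1 - cos (u * X 1 \<omega>)) \<partial>M)"
      unfolding E using R10 by (subst ennreal_mult'[symmetric]) (auto intro: ennreal_leI)
    also have "\<dots> \<le> ennreal (1 + R1) * (\<integral>\<^sup>+\<omega>. ennreal 2 * ennreal (min 1 ((u * X 1 \<omega>)\<^sup>2)) \<partial>M)"
    proof (intro mult_left_mono nn_integral_mono)
      show "ennreal (1 - cos (u * X 1 \<omega>)) \<le> ennreal 2 * ennreal (min 1 ((u * X 1 \<omega>)\<^sup>2))" for \<omega>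
        by (subst ennreal_mult[symmetric]) (auto intro!: ennreal_leI one_minus_cos_le_min)
    qed simp
    also have "\<dots> = ennreal (1 + R1) * (ennreal 2 * (\<integral>\<^sup>+\<omega>. ennreal (min 1 ((u * X 1 \<omega>)\<^sup>2)) \<partial>M))"
      by (subst nn_integral_cmult) auto
    also have "\<dots> = ennreal ((1 + R1) * 2) * (\<integral>\<^sup>+\<omega>. ennreal (min 1 ((u * X 1 \<omega>)\<^sup>2)) \<partial>M)"
      using R10 by (simp only: mult.assoc[symmetric] ennreal_mult)
    finally show ?thesis by (simp only: mult.commute[of "1 + R1" 2])
  qed
  define \<kappa> where "\<kappa> = \<delta> powr (2 - p) / (8 * (2 - p))"
  have \<kappa>: "0 < \<kappa>" using p \<delta> by (simp add: \<kappa>_def)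
  have "ennreal \<kappa> * (\<integral>\<^sup>+x. ennreal (\<bar>x\<bar> powr p) \<partial>T) = (\<integral>\<^sup>+x. ennreal (\<kappa> * \<bar>x\<bar> powr p) \<partial>T)"
    using \<kappa> by (subst nn_integral_cmult[symmetric]) (auto simp: ennreal_mult)
  also have "\<dots> \<le> (\<integral>\<^sup>+x. (\<integral>\<^sup>+u. ennreal (1 - cos (u * x)) * ennreal (u powr (- p - 1))
      * indicator {0<..<1} u \<partial>lborel) \<partial>T)"
  proof (intro nn_integral_mono_AE)
    have "AE x in T. \<delta> < \<bar>x\<bar>"
      unfolding T_def by (subst AE_density) (auto split: split_indicator)
    then show "AE x in T. ennreal (\<kappa> * \<bar>x\<bar> powr p)
      \<le> (\<integral>\<^sup>+u. ennreal (1 - cos (u * x)) * ennreal (u powr (- p - 1)) * indicator {0<..<1} u \<partial>lborel)"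
      unfolding \<kappa>_def by eventually_elim (intro abs_powr_le_nn_integral_one_minus_cos p \<delta>)
  qed
  also have "\<dots> = (\<integral>\<^sup>+u. (\<integral>\<^sup>+x. ennreal (1 - cos (u * x)) * ennreal (u powr (- p - 1))
      * indicator {0<..<1} u \<partial>T) \<partial>lborel)"
    by (rule LT.Fubini') measurable
  also have "\<dots> = (\<integral>\<^sup>+u. (\<integral>\<^sup>+x. ennreal (1 - cos (u * x)) \<partial>T) * ennreal (u powr (- p - 1))
      * indicator {0<..<1} u \<partial>lborel)"
    by (simp add: nn_integral_multc)
  also have "\<dots> \<le> (\<integral>\<^sup>+u. ennreal (2 * (1 + R1)) * ((\<integral>\<^sup>+\<omega>. ennreal (min 1 ((u * X 1 \<omega>)\<^sup>2)) \<partial>M)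
      * ennreal (u powr (- p - 1)) * indicator {0<..} u) \<partial>lborel)"
  proof (rule nn_integral_mono)
    fix u :: real
    show "(\<integral>\<^sup>+x. ennreal (1 - cos (u * x)) \<partial>T) * ennreal (u powr (- p - 1)) * indicator {0<..<1} u
      \<le> ennreal (2 * (1 + R1)) * ((\<integral>\<^sup>+\<omega>. ennreal (min 1 ((u * X 1 \<omega>)\<^sup>2)) \<partial>M) * ennreal (u powr
          (- p - 1)) * indicator {0<..} u)"
    proof (cases "0 < u \<and> u < 1")
      case True
      then have ind: "indicator {0<..<1} u = (1 :: ennreal)" "indicator {0<..} u
          = (1 :: ennreal)" by auto
      show ?thesis
        unfolding ind mult_1_right mult.assoc[symmetric]
        by (rule mult_right_mono[OF tail_le]) (use True in auto)
    next
      case False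
      then have "indicator {0<..<1} u = (0 :: ennreal)" by auto
      then show ?thesis by (simp only: mult_zero_right zero_le)
    qed
  qed
  also have "\<dots> = ennreal (2 * (1 + R1)) * (\<integral>\<^sup>+u. (\<integral>\<^sup>+\<omega>. ennreal (min 1 ((u * X 1 \<omega>)\<^sup>2)) \<partial>M)
      * ennreal (u powr (- p - 1)) * indicator {0<..} u \<partial>lborel)"
    by (intro nn_integral_cmult) measurable
  also have "\<dots> \<le> ennreal (2 * (1 + R1)) * (ennreal (1 / (2 - p) + 1 / p)
      * (\<integral>\<^sup>+\<omega>. ennreal (\<bar>X 1 \<omega>\<bar> powr p) \<partial>M))"
    by (intro mult_left_mono nn_integral_min_one_square_le_moment p) auto
  also have "\<dots> < \<infinity>"
    using moment by (auto simp: ennreal_mult_less_top nn_integral_eq_integral)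
  finally have "(\<integral>\<^sup>+x. ennreal (\<bar>x\<bar> powr p) \<partial>T) < \<infinity>"
    using \<kappa> by (auto simp: ennreal_mult_less_top)
  then show ?thesis by (subst (asm) T(3)) auto
qed

section \<open>The supremum in terms of truncated moments of the Levy measure\<close>

lemma (in levy_process) levy_process_drift: "levy_process M (\<lambda>s \<omega>. X s \<omega> - d * s)"
proof
  show "0 \<le> t \<Longrightarrow> (\<lambda>\<omega>. X t \<omega> - d * t) \<in> borel_measurable M" for t
    using measurable_X[of t] by measurable
  show "AE \<omega> in M. X 0 \<omega> - d * 0 = 0" using start_zero by simp
  show "indep_vars (\<lambda>_. borel) (\<lambda>i \<omega>. X (\<tau> (Suc i)) \<omega> - d * \<tau> (Suc i) - (X (\<tau> i) \<omega> - d * \<tau> i)) {..<n}"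
    if "0 \<le> \<tau> 0" "\<And>i. i < n \<Longrightarrow> \<tau> i \<le> \<tau> (Suc i)" for \<tau> n
  proof -
    have "indep_vars (\<lambda>_. borel) (\<lambda>i \<omega>. (\<lambda>x. x - d
        * (\<tau> (Suc i) - \<tau> i)) (X (\<tau> (Suc i)) \<omega> - X (\<tau> i) \<omega>)) {..<n}"
      by (rule indep_vars_compose2[OF indep_increments[OF that]]) auto
    then show ?thesis by (simp add: algebra_simps)
  qed
  show "distr M borel (\<lambda>\<omega>. X (s + h) \<omega> - d * (s + h) - (X s \<omega> - d * s))
    = distr M borel (\<lambda>\<omega>. X h \<omega> - d * h - (X 0 \<omega> - d * 0))" if "0 \<le> s" "0 \<le> h" for s h
  proof -
    have [measurable]: "X s \<in> borel_measurable M" "X h \<in> borel_measurable M"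
      "X (s + h) \<in> borel_measurable M" "X 0 \<in> borel_measurable M"
      using that by (auto intro: measurable_X)
    have "distr M borel (\<lambda>\<omega>. X (s + h) \<omega> - d * (s + h) - (X s \<omega> - d * s))
      = distr (distr M borel (\<lambda>\<omega>. X (s + h) \<omega> - X s \<omega>)) borel (\<lambda>x. x - d * h)"
      by (subst distr_distr, measurable) (simp add: comp_def algebra_simps)
    also have "\<dots> = distr (distr M borel (\<lambda>\<omega>. X h \<omega> - X 0 \<omega>)) borel (\<lambda>x. x - d * h)"
      by (simp only: stationary_increments[OF that])
    also have "\<dots> = distr M borel (\<lambda>\<omega>. X h \<omega> - d * h - (X 0 \<omega> - d * 0))"
      by (subst distr_distr, measurable) (simp add: comp_def algebra_simps)
    finally show ?thesis .
  qed
  show "AE \<omega> in M. cadlag (\<lambda>t. X t \<omega> - d * t)"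
    using cadlag_paths
  proof eventually_elim
    case (elim \<omega>)
    show ?case
      unfolding cadlag_def
    proof (intro conjI allI impI)
      fix t :: real assume "0 \<le> t"
      then show "continuous (at_right t) (\<lambda>t. X t \<omega> - d * t)"
        using elim by (auto simp: cadlag_def intro!: continuous_intros)
    next
      fix t :: real assume "0 < t"
      then obtain L where "((\<lambda>t. X t \<omega>) \<longlongrightarrow> L) (at_left t)" using elim by (auto simp: cadlag_def)
      then have "((\<lambda>t. X t \<omega> - d * t) \<longlongrightarrow> L - d * t) (at_left t)" by (intro tendsto_intros)
      then show "\<exists>L. ((\<lambda>t. X t \<omega> - d * t) \<longlongrightarrow> L) (at_left t)" by blast
    qed
  qed
qed

text \<open>
  This is \<open>\<bar>x + y\<bar>^p \<le> 2^p (\<bar>x\<bar>^p + \<bar>y\<bar>^p)\<close>, integrated. Additivity of the integral needs measurability, so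
  the supremum is replaced by the dyadic one.
\<close>

lemma (in levy_process) sup_moment_le_remove_drift:
  assumes p: "0 < p" and t: "0 < t"
  shows "sup_moment M X p t
    \<le> ennreal (2 powr p) * (sup_moment M (\<lambda>s \<omega>. X s \<omega> - d * s) p t + ennreal ((\<bar>d\<bar> * t) powr p))"
proof -
  interpret Z: levy_process M "\<lambda>s \<omega>. X s \<omega> - d * s" by (rule levy_process_drift)
  define G where "G \<omega> = (SUP n. SUP k\<in>{..2 ^ n}. ennreal (\<bar>X (real k * (t / 2 ^ n)) \<omega> - d * (real k
      * (t / 2 ^ n))\<bar> powr p))" for \<omega>
  have [measurable]: "X s \<in> borel_measurable M" if "0 \<le> s" for s using that by (rule measurable_X)
  have G_meas[measurable]: "G \<in> borel_measurable M"
    unfolding G_def using t by (intro borel_measurable_SUP) auto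
  have G: "AE \<omega> in M. (SUP s\<in>{0..t}. ennreal (\<bar>X s \<omega> - d * s\<bar> powr p)) = G \<omega>"
    unfolding G_def by (rule Z.SUP_abs_powr_AE_eq_dyadic[OF p t])
  have "sup_moment M X p t \<le> (\<integral>\<^sup>+\<omega>. ennreal (2 powr p) * (G \<omega> + ennreal ((\<bar>d\<bar> * t) powr p)) \<partial>M)"
    unfolding sup_moment_def
  proof (intro nn_integral_mono_AE)
    show "AE \<omega> in M. (SUP s\<in>{0..t}. ennreal (\<bar>X s \<omega>\<bar> powr p))
      \<le> ennreal (2 powr p) * (G \<omega> + ennreal ((\<bar>d\<bar> * t) powr p))"
      using G
    proof eventually_elim
      case (elim \<omega>)
      show ?case
      proof (rule SUP_least)
        fix s assume s: "s \<in> {0..t}"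
        let ?z = "\<bar>X s \<omega> - d * s\<bar>" and ?d = "\<bar>d\<bar> * t"
        have "\<bar>d * s\<bar> \<le> ?d" using s by (auto simp: abs_mult intro: mult_left_mono)
        then have "\<bar>X s \<omega>\<bar> \<le> ?z + ?d" by linarith
        also have "\<dots> \<le> 2 * max ?z ?d" by (simp add: max_def mult.commute)
        finally have "\<bar>X s \<omega>\<bar> \<le> 2 * max ?z ?d" .
        then have "\<bar>X s \<omega>\<bar> powr p \<le> (2 * max ?z ?d) powr p" using p by (intro powr_mono2) auto
        also have "\<dots> = 2 powr p * max ?z ?d powr p" by (rule powr_mult)
        also have "\<dots> \<le> 2 powr p * (?z powr p + ?d powr p)"
          by (intro mult_left_mono) (auto simp: max_def)
        finally have "ennreal (\<bar>X s \<omega>\<bar> powr p) \<le> ennreal (2 powr p) * (ennreal (?z powr p)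
            + ennreal (?d powr p))"
          by (simp add: ennreal_leI flip: ennreal_mult ennreal_plus)
        also have "ennreal (?z powr p) \<le> G \<omega>"
          unfolding elim[symmetric] by (rule SUP_upper[OF s])
        finally show "ennreal (\<bar>X s \<omega>\<bar> powr p) \<le> ennreal (2 powr p) * (G \<omega> + ennreal (?d powr p))"
          by (simp add: add_right_mono mult_left_mono)
      qed
    qed
  qed
  also have "\<dots> = ennreal (2 powr p) * ((\<integral>\<^sup>+\<omega>. G \<omega> \<partial>M) + ennreal ((\<bar>d\<bar> * t) powr p))"
    by (simp add: nn_integral_cmult nn_integral_add emeasure_space_1)
  also have "(\<integral>\<^sup>+\<omega>. G \<omega> \<partial>M) = sup_moment M (\<lambda>s \<omega>. X s \<omega> - d * s) p t"
    unfolding sup_moment_def by (rule nn_integral_cong_AE) (use G in auto)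
  finally show ?thesis .
qed

lemma min_one_add_le: "0 \<le> b \<Longrightarrow> 0 \<le> c \<Longrightarrow> min 1 (b + c) \<le> min 1 b + min 1 c" for b c :: real
  by (auto simp: min_def)

text \<open>
  The assumption on \<open>d\<close> says that, after subtracting the drift \<open>d s\<close>, the imaginary part of the exponent is
  given by \<open>w\<close> for the jumps up to \<open>\<delta>\<close> and by \<open>v\<close> for the larger ones. The constant \<open>C\<close> is independent of
  \<open>t\<close> and of the threshold \<open>h\<close>, which will depend on \<open>t\<close>. The large jumps contribute the term \<open>t\<close>; their
  imaginary part is handled by the Cauchy-Schwarz bound, because \<open>s\<^sup>2 \<le> t\<close> for \<open>s \<le> t \<le> 1\<close>.
\<close>

lemma (in levy_process) sup_moment_le_truncated_moments:
  fixes a d p q r \<delta> :: real and \<nu> :: "real measure" and v w :: "real \<Rightarrow> real"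
  assumes chars: "has_levy_characteristics M X a 0 \<nu>" and p: "0 < p" "p < 2"
    and r: "p < r" "r \<le> 2" and q: "p < q" "q \<le> 2" and \<delta>: "0 < \<delta>"
    and tail: "(\<integral>\<^sup>+x. ennreal (\<bar>x\<bar> powr p) * indicator {x. \<delta> < \<bar>x\<bar>} x \<partial>\<nu>) < \<infinity>"
    and w: "w \<in> borel_measurable borel" "\<And>y. \<bar>w y\<bar> \<le> 2 * \<bar>y\<bar> powr r" "\<And>y. \<bar>w y\<bar> \<le> 2 * \<bar>y\<bar> powr q"
    and v: "v \<in> borel_measurable borel" "\<And>y. \<bar>v y\<bar> \<le> \<bar>sin y\<bar>"
    and centering: "\<And>u. Im (levy_exponent a 0 \<nu> u) + u * d
      = - (LINT x|\<nu>. indicator {x. \<bar>x\<bar> \<le> \<delta>} x * w (u * x)) - (LINT x|\<nu>. indicator {x. \<delta> < \<bar>x\<bar>} x * v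
          (u * x))"
  shows "\<exists>C\<ge>0. \<forall>t h A D. 0 < t \<longrightarrow> t \<le> 1 \<longrightarrow> 0 < A \<longrightarrow> 0 < D \<longrightarrow>
    (\<integral>\<^sup>+x. ennreal (\<bar>x\<bar> powr r) * indicator {0<..h} \<bar>x\<bar> \<partial>\<nu>) \<le> ennreal A \<longrightarrow>
    (\<integral>\<^sup>+x. ennreal (\<bar>x\<bar> powr q) * indicator {h<..\<delta>} \<bar>x\<bar> \<partial>\<nu>) \<le> ennreal D \<longrightarrow>
    sup_moment M (\<lambda>s \<omega>. X s \<omega> - d * s) p t \<le> ennreal (C * ((t * A) powr (p / r) + (t * D) powr
        (p / q) + t))"
proof -
  have \<nu>: "levy_measure \<nu>" using chars by (simp add: has_levy_characteristics_def)
  have sets: "sets \<nu> = sets borel" by (rule levy_measure_sets[OF \<nu>])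
  note sets[measurable_cong] w(1)[measurable] v(1)[measurable]
  interpret Z: levy_process M "\<lambda>s \<omega>. X s \<omega> - d * s" by (rule levy_process_drift)
  define T where "T = density \<nu> (indicator {x. \<delta> < \<bar>x\<bar>})"
  note T = levy_tail_measure[OF \<nu> \<delta>, folded T_def]
  note T(1)[measurable_cong]
  interpret T: finite_measure T by (rule T(2))
  define \<tau> where "\<tau> = measure \<nu> {x. \<delta> < \<bar>x\<bar>}"
  define m where "m = enn2real (\<integral>\<^sup>+x. ennreal (\<bar>x\<bar> powr p) \<partial>T)"
  have m: "(\<integral>\<^sup>+x. ennreal (\<bar>x\<bar> powr p) \<partial>T) = ennreal m" and m0: "0 \<le> m"
    using tail T(3)[of "\<lambda>x. ennreal (\<bar>x\<bar> powr p)"] by (auto simp: m_def)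
  define cr cq c2 cp K where "cr = 3 * (1 / (r - p) + 1 / p) * 2 powr (p / r)"
    and "cq = 3 * (1 / (q - p) + 1 / p) * 2 powr (p / q)" and "c2 = (1 / (2 - p) + 1 / p) * m"
    and "cp = p * 4 powr (p + 1) / (p + 1)" and "K = 2 + \<tau>"
  have pos: "0 \<le> cr" "0 \<le> cq" "0 \<le> c2" "0 \<le> cp" "0 \<le> K"
    using p r q m0 by (auto simp: cr_def cq_def c2_def cp_def K_def \<tau>_def)
  define C where "C = cp * (cr + cq + K * c2)"
  have C: "0 \<le> C" using pos by (simp add: C_def)
  show ?thesis
  proof (intro exI[of _ C] conjI C allI impI)
    fix t h A D :: real
    assume t: "0 < t" "t \<le> 1" and A: "0 < A" and D: "0 < D"
      and int_A: "(\<integral>\<^sup>+x. ennreal (\<bar>x\<bar> powr r) * indicator {0<..h} \<bar>x\<bar> \<partial>\<nu>) \<le> ennreal A"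
      and int_D: "(\<integral>\<^sup>+x. ennreal (\<bar>x\<bar> powr q) * indicator {h<..\<delta>} \<bar>x\<bar> \<partial>\<nu>) \<le> ennreal D"
    define f1 where "f1 u = 3 * min 1 (2 * t * A * u powr r)" for u
    define f2 where "f2 u = 3 * min 1 (2 * t * D * u powr q)" for u
    define f3 where "f3 u = (\<integral>\<^sup>+x. ennreal (min 1 ((u * x)\<^sup>2)) \<partial>T)" for u
    define B where "B u = ennreal (f1 u) + ennreal (f2 u) + ennreal (K * t) * f3 u" for u
    have [measurable]: "f1 \<in> borel_measurable borel" "f2 \<in> borel_measurable borel" "f3 \<in> borel_measurable borel"
      unfolding f1_def f2_def f3_def by measurable
    have B_meas: "B \<in> borel_measurable borel" unfolding B_def by measurable
    have f_nonneg: "0 \<le> f1 u" "0 \<le> f2 u" for u using t A D by (auto simp: f1_def f2_def)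
    have bound: "(\<integral>\<^sup>+\<omega>. ennreal (1 - cos (u * (X s \<omega> - d * s))) \<partial>M) \<le> B u"
      if s: "0 \<le> s" "s \<le> t" and u: "0 < u" for s u
    proof -
      let ?S = "{x. \<delta> < \<bar>x\<bar>}"
      define R1 where "R1 = (LINT x|\<nu>. indicator {x. \<bar>x\<bar> \<le> \<delta>} x * (1 - cos (u * x)))"
      define R2 where "R2 = (LINT x|\<nu>. indicator ?S x * (1 - cos (u * x)))"
      define y1 where "y1 = - (LINT x|\<nu>. indicator {x. \<bar>x\<bar> \<le> \<delta>} x * w (u * x))"
      define y2 where "y2 = - (LINT x|\<nu>. indicator ?S x * v (u * x))"
      define n where "n = (LINT x|\<nu>. indicator ?S x * min 1 ((u * x)\<^sup>2))"
      define J where "J = 2 * (A * u powr r + D * u powr q)"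
      have n_int: "integrable \<nu> (\<lambda>x. indicator ?S x * min 1 ((u * x)\<^sup>2))"
        by (rule levy_integrable_tail[OF \<nu> \<delta>, of _ 1]) auto
      have n0: "0 \<le> n" unfolding n_def by (intro Bochner_Integration.integral_nonneg) auto
      have f3_n: "f3 u = ennreal n"
      proof -
        have "f3 u = (\<integral>\<^sup>+x. ennreal (indicator ?S x * min 1 ((u * x)\<^sup>2)) \<partial>\<nu>)"
          unfolding f3_def by (subst T(3)) (auto intro!: nn_integral_cong split: split_indicator)
        then show ?thesis unfolding n_def using n_int by (simp add: nn_integral_eq_integral)
      qed
      have cos_r: "\<bar>1 - cos y\<bar> \<le> 2 * \<bar>y\<bar> powr r" and cos_q: "\<bar>1 - cos y\<bar> \<le> 2 * \<bar>y\<bar> powr q" for y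
        using p r q by (intro one_minus_cos_le_powr; simp)+
      have R1_int: "integrable \<nu> (\<lambda>x. indicator {x. \<bar>x\<bar> \<le> \<delta>} x * (1 - cos (u * x)))" and "\<bar>R1\<bar> \<le> J"
        using small_jump_integral_le[OF sets, where w = "\<lambda>y. 1 - cos y", OF _ cos_r cos_q int_A _ int_D _ u] A D
        unfolding R1_def J_def by auto
      moreover have "0 \<le> R1" unfolding R1_def by (intro Bochner_Integration.integral_nonneg) auto
      ultimately have R1: "0 \<le> R1" "R1 \<le> J" by auto
      have R2_int: "integrable \<nu> (\<lambda>x. indicator ?S x * (1 - cos (u * x)))"
        by (rule levy_integrable_tail[OF \<nu> \<delta>, of _ 2])
            (auto simp: abs_le_iff cos_ge_minus_one intro: order_trans[OF cos_le_one] order_trans[OF _ cos_ge_minus_one])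
      have R2: "0 \<le> R2" "R2 \<le> 2 * n"
      proof -
        show "0 \<le> R2" unfolding R2_def by (intro Bochner_Integration.integral_nonneg) auto
        have "R2 \<le> (LINT x|\<nu>. 2 * (indicator ?S x * min 1 ((u * x)\<^sup>2)))"
          unfolding R2_def using one_minus_cos_le_min
          by (intro integral_mono R2_int integrable_mult_right n_int) (auto split: split_indicator)
        then show "R2 \<le> 2 * n" by (simp add: n_def)
      qed
      have y1: "\<bar>y1\<bar> \<le> J"
        using small_jump_integral_le(2)[OF sets w int_A _ int_D _ u] A D by (simp add: y1_def J_def)
      have y2: "y2\<^sup>2 \<le> \<tau> * n"
      proof -
        have v1: "\<bar>v y\<bar> \<le> 1" for y using v(2)[of y] abs_sin_le_one[of y] by linarith
        have v2: "(v y)\<^sup>2 \<le> min 1 (y\<^sup>2)" for y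
        proof -
          have "(v y)\<^sup>2 \<le> (sin y)\<^sup>2" using v(2)[of y] by (simp add: abs_le_square_iff)
          also have "\<dots> \<le> min 1 (y\<^sup>2)" using sin_square_le[of y] by (simp add: abs_square_le_1)
          finally show ?thesis .
        qed
        have "y2\<^sup>2 \<le> \<tau> * (LINT x|\<nu>. indicator ?S x * (v (u * x))\<^sup>2)"
          using square_tail_integral_le[OF \<nu> \<delta>, of "\<lambda>x. v (u * x)"] v1 by (simp add: y2_def \<tau>_def)
        also have "(LINT x|\<nu>. indicator ?S x * (v (u * x))\<^sup>2) \<le> n"
          unfolding n_def
        proof (rule integral_mono)
          show "integrable \<nu> (\<lambda>x. indicator ?S x * (v (u * x))\<^sup>2)"
            by (rule levy_integrable_tail[OF \<nu> \<delta>, of _ 1]) (use v1 in \<open>auto simp: abs_square_le_1\<close>)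
        qed (use n_int v2 in \<open>auto split: split_indicator\<close>)
        finally show ?thesis by (simp add: \<tau>_def mult_left_mono)
      qed
      have R: "(LINT x|\<nu>. 1 - cos (u * x)) = R1 + R2"
        unfolding R1_def R2_def
        by (subst Bochner_Integration.integral_add[OF R1_int R2_int, symmetric])
          (auto intro!: Bochner_Integration.integral_cong split: split_indicator)
      define I where "I = Im (levy_exponent a 0 \<nu> u)"
      have I: "I + u * d = y1 + y2" unfolding I_def centering y1_def y2_def by simp
      have exponent: "levy_exponent a 0 \<nu> u = Complex (R1 + R2) I"
        by (simp add: complex_eq_iff I_def levy_exponent_Re_Im[OF \<nu>] R)
      have char: "(CLINT \<omega>|M. iexp (u * X s \<omega>)) = exp (- of_real s * Complex (R1 + R2) I)"
        using levy_characteristic_function[OF chars s(1), of u] unfolding exponent .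
      have "(\<integral>\<^sup>+\<omega>. ennreal (1 - cos (u * (X s \<omega> - d * s))) \<partial>M)
        = ennreal (1 - exp (- (s * (R1 + R2))) * cos (s * (I + u * d)))"
        by (rule nn_integral_one_minus_cos_drift[OF measurable_X[OF s(1)] char])
      also have "1 - exp (- (s * (R1 + R2))) * cos (s * (I + u * d))
        = 1 - exp (- (s * R1 + s * R2)) * cos (s * y1 + s * y2)"
        unfolding I by (simp add: distrib_left)
      also have "\<dots> \<le> 3 * min 1 (s * J) + s * R2 + (s * y2)\<^sup>2"
        using s R1 R2 y1 by (intro one_minus_exp_cos_le) (auto simp: abs_mult intro: mult_left_mono)
      also have "\<dots> \<le> 3 * min 1 (t * J) + t * (2 * n) + t * (\<tau> * n)"
      proof -
        have J0: "0 \<le> J" using R1 by simp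
        have "s * s \<le> t * 1" using s t by (intro mult_mono) auto
        then have "s\<^sup>2 \<le> t" by (simp add: power2_eq_square)
        then have "(s * y2)\<^sup>2 \<le> t * (\<tau> * n)"
          unfolding power_mult_distrib using y2 t by (intro mult_mono) auto
        moreover have "s * R2 \<le> t * (2 * n)" using s R2 t by (intro mult_mono) auto
        moreover have "min 1 (s * J) \<le> min 1 (t * J)"
          using mult_right_mono[OF s(2) J0] by (auto simp: min_def)
        ultimately show ?thesis by linarith
      qed
      also have "\<dots> \<le> f1 u + f2 u + K * t * n"
      proof -
        have tJ: "t * J = 2 * t * A * u powr r + 2 * t * D * u powr q" by (simp add: J_def algebra_simps)
        have "min 1 (t * J) \<le> min 1 (2 * t * A * u powr r) + min 1 (2 * t * D * u powr q)"
          unfolding tJ using t A D by (intro min_one_add_le) auto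
        then have "3 * min 1 (t * J) \<le> f1 u + f2 u" unfolding f1_def f2_def by linarith
        then show ?thesis by (simp add: K_def algebra_simps)
      qed
      finally have "(\<integral>\<^sup>+\<omega>. ennreal (1 - cos (u * (X s \<omega> - d * s))) \<partial>M) \<le> ennreal (f1 u + f2 u + K * t
          * n)"
        by (simp add: ennreal_leI)
      also have "\<dots> = B u"
        unfolding B_def f3_n using f_nonneg[of u] pos t n0 by (simp add: ennreal_mult)
      finally show ?thesis .
    qed
    have piece: "(\<integral>\<^sup>+u. ennreal (3 * min 1 (2 * t * E * u powr z)) * ennreal (u powr (- p - 1))
        * indicator {0<..} u \<partial>lborel)
      \<le> ennreal (3 * (1 / (z - p) + 1 / p) * 2 powr (p / z) * (t * E) powr (p / z))"
      if E: "0 < E" and z: "p < z" for E z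
    proof -
      have "(\<integral>\<^sup>+u. ennreal (3 * min 1 (2 * t * E * u powr z)) * ennreal (u powr (- p - 1))
          * indicator {0<..} u \<partial>lborel)
        = (\<integral>\<^sup>+u. ennreal 3 * (ennreal (min 1 (2 * t * E * u powr z) * u powr
            (- p - 1)) * indicator {0<..} u) \<partial>lborel)"
        using t E by (intro nn_integral_cong) (simp add: ennreal_mult mult.assoc)
      also have "\<dots> = ennreal 3 * (\<integral>\<^sup>+u. ennreal (min 1 (2 * t * E * u powr z) * u powr (- p - 1))
          * indicator {0<..} u \<partial>lborel)"
        by (intro nn_integral_cmult) measurable
      also have "\<dots> \<le> ennreal 3 * ennreal ((1 / (z - p) + 1 / p) * (2 * t * E) powr (p / z))"
        using p t E z by (intro mult_left_mono nn_integral_min_one_powr_le) auto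
      also have "\<dots> = ennreal (3 * ((1 / (z - p) + 1 / p) * (2 * t * E) powr (p / z)))"
        using p z by (subst ennreal_mult[symmetric]) auto
      also have "(2 * t * E) powr (p / z) = 2 powr (p / z) * (t * E) powr (p / z)"
        using t E powr_mult[of 2 "t * E" "p / z"] by (simp add: mult.assoc)
      finally show ?thesis by (simp only: mult.assoc)
    qed
    have "sup_moment M (\<lambda>s \<omega>. X s \<omega> - d * s) p t
      \<le> ennreal cp * (\<integral>\<^sup>+u. B u * ennreal (u powr (- p - 1)) * indicator {0<..} u \<partial>lborel)"
      unfolding cp_def using p t by (intro Z.sup_moment_le_Fourier B_meas bound) auto
    also have "(\<integral>\<^sup>+u. B u * ennreal (u powr (- p - 1)) * indicator {0<..} u \<partial>lborel)
      = (\<integral>\<^sup>+u. ennreal (f1 u) * ennreal (u powr (- p - 1)) * indicator {0<..} u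
        + ennreal (f2 u) * ennreal (u powr (- p - 1)) * indicator {0<..} u
        + ennreal (K * t) * (f3 u * ennreal (u powr (- p - 1)) * indicator {0<..} u) \<partial>lborel)"
      unfolding B_def by (intro nn_integral_cong) (simp only: distrib_right mult.assoc)
    also have "\<dots> = (\<integral>\<^sup>+u. ennreal (f1 u) * ennreal (u powr (- p - 1)) * indicator {0<..} u \<partial>lborel)
        + (\<integral>\<^sup>+u. ennreal (f2 u) * ennreal (u powr (- p - 1)) * indicator {0<..} u \<partial>lborel)
        + ennreal (K * t) * (\<integral>\<^sup>+u. f3 u * ennreal (u powr (- p - 1)) * indicator {0<..} u \<partial>lborel)"
      by (subst nn_integral_add, measurable)+ (simp add: nn_integral_cmult)
    also have "\<dots> \<le> ennreal (cr * (t * A) powr (p / r)) + ennreal (cq * (t * D) powr (p / q))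
        + ennreal (K * t) * ennreal c2"
    proof (intro add_mono mult_left_mono)
      show "(\<integral>\<^sup>+u. ennreal (f1 u) * ennreal (u powr (- p - 1)) * indicator {0<..} u \<partial>lborel)
          \<le> ennreal (cr * (t * A) powr (p / r))"
        unfolding f1_def cr_def by (rule piece[OF A r(1)])
      show "(\<integral>\<^sup>+u. ennreal (f2 u) * ennreal (u powr (- p - 1)) * indicator {0<..} u \<partial>lborel)
          \<le> ennreal (cq * (t * D) powr (p / q))"
        unfolding f2_def cq_def by (rule piece[OF D q(1)])
      show "(\<integral>\<^sup>+u. f3 u * ennreal (u powr (- p - 1)) * indicator {0<..} u \<partial>lborel) \<le> ennreal c2"
        unfolding f3_def c2_def using T.nn_integral_min_one_square_le_moment[of "\<lambda>x. x" p] p m0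
        by (simp add: m ennreal_mult)
    qed auto
    also have "ennreal cp * (ennreal (cr * (t * A) powr (p / r)) + ennreal (cq * (t * D) powr (p / q))
        + ennreal (K * t) * ennreal c2)
      = ennreal (cp * (cr * (t * A) powr (p / r) + cq * (t * D) powr (p / q) + K * t * c2))"
      using pos t by (simp add: ennreal_mult)
    also have "\<dots> \<le> ennreal (C * ((t * A) powr (p / r) + (t * D) powr (p / q) + t))"
    proof (rule ennreal_leI)
      let ?C = "cr + cq + K * c2"
      have "cr * (t * A) powr (p / r) + cq * (t * D) powr (p / q) + K * c2 * t
        \<le> ?C * (t * A) powr (p / r) + ?C * (t * D) powr (p / q) + ?C * t"
        using pos t by (intro add_mono mult_right_mono) auto
      then show "cp * (cr * (t * A) powr (p / r) + cq * (t * D) powr (p / q) + K * t * c2)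
        \<le> C * ((t * A) powr (p / r) + (t * D) powr (p / q) + t)"
        unfolding C_def mult.assoc using pos by (intro mult_left_mono) (auto simp: distrib_left mult_ac)
    qed
    finally show "sup_moment M (\<lambda>s \<omega>. X s \<omega> - d * s) p t
      \<le> ennreal (C * ((t * A) powr (p / r) + (t * D) powr (p / q) + t))"
      by (simp add: mult_left_mono)
  qed
qed

section \<open>Potter's bounds\<close>

text \<open>
  Pointwise convergence of the increments to \<open>0\<close> is locally uniform for measurable \<open>k\<close>. Suppose the increments
  from \<open>s n\<close> to \<open>s n + u n\<close> stay large. For large \<open>n\<close>, the points of \<open>[0,2]\<close> at which the increment is small
  when started from \<open>s n\<close>, and likewise from \<open>s n + u n\<close>, have measure above \<open>3 / 2\<close> each. Translating
  the second set by \<open>u n\<close> puts both into \<open>[0,3]\<close>, so that they meet, and a common point contradicts the choice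
  of \<open>u n\<close> by the triangle inequality.
\<close>

lemma additive_slow_variation_uniform:
  fixes k :: "real \<Rightarrow> real"
  assumes k[measurable]: "k \<in> borel_measurable borel"
    and lim: "\<And>u. ((\<lambda>s. k (s + u) - k s) \<longlongrightarrow> 0) at_top" and e: "0 < e"
  shows "\<exists>S. \<forall>s\<ge>S. \<forall>u\<in>{0..1}. \<bar>k (s + u) - k s\<bar> \<le> e"
proof (rule ccontr)
  assume "\<not> ?thesis"
  then have "\<forall>n::nat. \<exists>s u. s \<ge> real n \<and> u \<in> {0..1} \<and> e < \<bar>k (s + u) - k s\<bar>"
    by (force simp: not_le)
  then obtain s u where s: "\<And>n. s n \<ge> real n" and u: "\<And>n. u n \<in> {0..1}"
    and bad: "\<And>n. e < \<bar>k (s n + u n) - k (s n)\<bar>" by metis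
  have s_top: "filterlim s at_top sequentially"
    by (rule filterlim_at_top_mono[OF filterlim_real_sequentially]) (simp add: s)
  have su_top: "filterlim (\<lambda>n. s n + u n) at_top sequentially"
    by (rule filterlim_at_top_mono[OF s_top]) (use u in auto)
  define Good where "Good z n = {x \<in> {0..2}. \<forall>m\<in>{n..}. \<bar>k (z m + x) - k (z m)\<bar> \<le> e / 2}"
    for z :: "nat \<Rightarrow> real" and n
  have Good_sets[measurable]: "Good z n \<in> sets borel" for z n
  proof -
    have "Good z n = {0..2} \<inter> (\<Inter>m\<in>{n..}. {x. \<bar>k (z m + x) - k (z m)\<bar> \<le> e / 2})"
      by (auto simp: Good_def)
    also have "\<dots> \<in> sets borel"
      by (intro sets.Int sets.countable_INT') auto
    finally show ?thesis .
  qed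
  have big: "\<forall>\<^sub>F n in sequentially. ennreal (3 / 2) < emeasure lborel (Good z n)"
    if z: "filterlim z at_top sequentially" for z
  proof -
    have "(\<Union>n. Good z n) = {0..2}"
    proof (rule antisym)
      show "{0..2} \<subseteq> (\<Union>n. Good z n)"
      proof
        fix x :: real assume x: "x \<in> {0..2}"
        have "(\<lambda>m. k (z m + x) - k (z m)) \<longlonglongrightarrow> 0"
          by (rule filterlim_compose[OF lim z])
        then have "\<forall>\<^sub>F m in sequentially. \<bar>k (z m + x) - k (z m)\<bar> < e / 2"
          using e by (auto simp: tendsto_iff dist_real_def dest!: spec[of _ "e / 2"])
        then obtain n where "\<And>m. m \<ge> n \<Longrightarrow> \<bar>k (z m + x) - k (z m)\<bar> < e / 2"
          by (auto simp: eventually_sequentially)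
        then show "x \<in> (\<Union>n. Good z n)"
          using x by (auto simp: Good_def intro!: exI[of _ n] less_imp_le)
      qed
    qed (auto simp: Good_def)
    moreover have "incseq (Good z)"
      by (auto simp: incseq_def Good_def)
    ultimately have "(\<lambda>n. emeasure lborel (Good z n)) \<longlonglongrightarrow> emeasure lborel {0..2::real}"
      using Lim_emeasure_incseq[of "Good z" lborel] by (simp add: image_subset_iff)
    then show ?thesis
      by (rule order_tendstoD(1)) (simp flip: ennreal_numeral add: ennreal_lessI)
  qed
  from eventually_conj[OF big[OF s_top] big[OF su_top]]
  obtain n where n: "ennreal (3 / 2) < emeasure lborel (Good s n)"
    "ennreal (3 / 2) < emeasure lborel (Good (\<lambda>n. s n + u n) n)"
    by (auto simp: eventually_sequentially)
  define W where "W = (+) (- u n) -` Good (\<lambda>n. s n + u n) n"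
  have W_sets[measurable]: "W \<in> sets borel"
    unfolding W_def by (rule measurable_sets_borel[OF _ Good_sets]) measurable
  have W_measure: "emeasure lborel W = emeasure lborel (Good (\<lambda>n. s n + u n) n)"
  proof -
    have "emeasure lborel (Good (\<lambda>n. s n + u n) n)
      = emeasure (distr lborel borel ((+) (- u n))) (Good (\<lambda>n. s n + u n) n)"
      by (simp only: lborel_distr_plus)
    also have "\<dots> = emeasure lborel W"
      unfolding W_def by (subst emeasure_distr) auto
    finally show ?thesis by simp
  qed
  have "Good s n \<inter> W \<noteq> {}"
  proof
    assume disj: "Good s n \<inter> W = {}"
    have "ennreal 3 = ennreal (3 / 2) + ennreal (3 / 2)" by (simp flip: ennreal_plus)
    also have "\<dots> < emeasure lborel (Good s n) + emeasure lborel W"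
      unfolding W_measure by (intro add_strict_mono n)
    also have "\<dots> = emeasure lborel (Good s n \<union> W)"
      using disj by (intro plus_emeasure) auto
    also have "\<dots> \<le> emeasure lborel {0..3::real}"
      using u[of n] by (intro emeasure_mono) (auto simp: Good_def W_def)
    finally show False by simp
  qed
  then obtain x where x: "x \<in> Good s n" "x - u n \<in> Good (\<lambda>n. s n + u n) n"
    by (auto simp: W_def)
  then have "\<bar>k (s n + x) - k (s n)\<bar> \<le> e / 2" "\<bar>k (s n + x) - k (s n + u n)\<bar> \<le> e / 2"
    by (auto simp: Good_def dest!: bspec[of _ _ n])
  then show False using bad[of n] by linarith
qed

lemma additive_slow_variation_linear_bound:
  fixes k :: "real \<Rightarrow> real"
  assumes step: "\<And>s u. S \<le> s \<Longrightarrow> u \<in> {0..1} \<Longrightarrow> \<bar>k (s + u) - k s\<bar> \<le> e"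
    and s: "S \<le> s" "s \<le> t"
  shows "\<bar>k t - k s\<bar> \<le> e * (t - s + 1)"
proof -
  have e: "0 \<le> e" using step[of S 0] by simp
  have ints: "\<bar>k (s + real n) - k s\<bar> \<le> e * real n" for n
  proof (induction n)
    case (Suc n)
    have "\<bar>k (s + real n + 1) - k (s + real n)\<bar> \<le> e" using s by (intro step) auto
    then show ?case using Suc by (simp add: algebra_simps)
  qed simp
  define n where "n = nat \<lfloor>t - s\<rfloor>"
  have "real n = of_int \<lfloor>t - s\<rfloor>" using s by (simp add: n_def)
  then have n: "real n \<le> t - s" "t - s - real n \<le> 1" by linarith+
  have "\<bar>k (s + real n + (t - s - real n)) - k (s + real n)\<bar> \<le> e" using s n by (intro step) auto
  then have "\<bar>k t - k s\<bar> \<le> e * (real n + 1)" using ints[of n] by (simp add: algebra_simps)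
  also have "\<dots> \<le> e * (t - s + 1)" using e n by (intro mult_left_mono) auto
  finally show ?thesis .
qed

text \<open>
  In logarithmic coordinates \<open>k s = ln (l (e^(-s)))\<close> has increments tending to \<open>0\<close>, hence grows at most
  linearly with arbitrarily small slope. Exponentiating gives Potter's bounds near zero.
\<close>

lemma regularly_varying_potter_bound:
  fixes \<phi> l :: "real \<Rightarrow> real"
  assumes rv: "regularly_varying_at_zero c (- \<rho>) \<phi>"
    and l: "\<forall>x\<in>{0<..c}. l x = x powr \<rho> * \<phi> x" and e: "0 < e"
  shows "\<exists>x0. 0 < x0 \<and> x0 \<le> c \<and> (\<forall>x y. 0 < x \<longrightarrow> x \<le> y \<longrightarrow> y \<le> x0 \<longrightarrow>
    l x \<le> exp e * (y / x) powr e * l y \<and> l y \<le> exp e * (y / x) powr e * l x)"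
proof -
  have c: "0 < c" and \<phi>_meas: "\<phi> \<in> borel_measurable (restrict_space borel {0<..c})"
    and \<phi>_pos: "\<And>x. x \<in> {0<..c} \<Longrightarrow> 0 < \<phi> x"
    and \<phi>_lim: "\<And>t. 0 < t \<Longrightarrow> ((\<lambda>x. \<phi> (t * x) / \<phi> x) \<longlongrightarrow> t powr - \<rho>) (at_right 0)"
    using rv by (auto simp: regularly_varying_at_zero_def)
  have l_pos: "0 < l x" if "x \<in> {0<..c}" for x using that l \<phi>_pos by auto
  define k where "k s = (if exp (- s) \<in> {0<..c} then ln (exp (- s) powr \<rho> * \<phi> (exp (- s))) else 0)" for s
  have k_l: "k s = ln (l (exp (- s)))" if "exp (- s) \<le> c" for s
    using that l by (simp add: k_def)
  have k_meas: "k \<in> borel_measurable borel"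
  proof -
    define \<phi>0 where "\<phi>0 x = (if x \<in> {0<..c} then \<phi> x else 0)" for x
    have [measurable]: "\<phi>0 \<in> borel_measurable borel"
      using \<phi>_meas unfolding \<phi>0_def by (subst (asm) measurable_restrict_space_iff[of _ _ 0]) auto
    have "k = (\<lambda>s. if exp (- s) \<in> {0<..c} then ln (exp (- s) powr \<rho> * \<phi>0 (exp (- s))) else 0)"
      by (auto simp: k_def \<phi>0_def)
    then show ?thesis by simp
  qed
  have k_lim: "((\<lambda>s. k (s + u) - k s) \<longlongrightarrow> 0) at_top" for u
  proof -
    have exp_lim: "filterlim (\<lambda>s::real. exp (- s)) (at_right 0) at_top"
      by (auto simp: filterlim_at intro!: filterlim_compose[OF exp_at_bot] filterlim_uminus_at_bot_at_top)
    have "((\<lambda>s. exp (- u) powr \<rho> * (\<phi> (exp (- u) * exp (- s)) / \<phi> (exp (- s)))) \<longlongrightarrow> exp (- u) powr \<rho>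
        * exp (- u) powr - \<rho>) at_top"
      by (intro tendsto_mult tendsto_const filterlim_compose[OF \<phi>_lim exp_lim]) simp
    then have "((\<lambda>s. ln (exp (- u) powr \<rho> * (\<phi> (exp (- u) * exp (- s)) / \<phi> (exp (- s))))) \<longlongrightarrow> ln 1) at_top"
      by (intro tendsto_ln) (simp_all flip: powr_add)
    moreover have "\<forall>\<^sub>F s in at_top. ln (exp (- u) powr \<rho> * (\<phi> (exp (- u) * exp (- s)) / \<phi> (exp (- s))))
        = k (s + u) - k s"
      using eventually_ge_at_top[of "max (- ln c) (- ln c - u)"]
    proof eventually_elim
      case (elim s)
      then have "- s \<le> ln c" "- (s + u) \<le> ln c" by auto
      then have s: "exp (- s) \<le> c" "exp (- (s + u)) \<le> c" using c by (metis exp_le_cancel_iff exp_ln)+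
      have mult: "exp (- u) * exp (- s) = exp (- (s + u))" by (simp flip: exp_add)
      have powr_add_exp: "l (exp (- (s + u))) = exp (- u) powr \<rho> * exp (- s) powr \<rho> * \<phi> (exp (- (s
          + u)))"
        using l s powr_mult[of "exp (- u)" "exp (- s)" \<rho>] by (simp add: mult)
      have "exp (- u) powr \<rho> * (\<phi> (exp (- u) * exp (- s)) / \<phi> (exp (- s)))
        = l (exp (- (s + u))) / l (exp (- s))"
        using l s by (simp only: powr_add_exp mult) simp
      then show ?case
        using s l_pos[of "exp (- s)"] l_pos[of "exp (- (s + u))"] by (simp add: k_l ln_div)
    qed
    ultimately show ?thesis by (simp add: filterlim_cong)
  qed
  obtain S where S: "\<And>s u. S \<le> s \<Longrightarrow> u \<in> {0..1} \<Longrightarrow> \<bar>k (s + u) - k s\<bar> \<le> e"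
    using additive_slow_variation_uniform[OF k_meas k_lim e] by blast
  define x0 where "x0 = min c (exp (- S))"
  have "l x \<le> exp e * (y / x) powr e * l y \<and> l y \<le> exp e * (y / x) powr e * l x"
    if xy: "0 < x" "x \<le> y" "y \<le> x0" for x y
  proof -
    have y0: "0 < y" using xy by simp
    have le: "S \<le> - ln y" "- ln y \<le> - ln x" "x \<le> c" "y \<le> c"
      using xy y0 by (auto simp: x0_def ln_le_cancel_iff minus_le_iff dest: ln_mono)

    have "\<bar>k (- ln x) - k (- ln y)\<bar> \<le> e * (- ln x - - ln y + 1)"
      by (rule additive_slow_variation_linear_bound[OF S]) (use le in auto)
    moreover have "k (- ln x) = ln (l x)" "k (- ln y) = ln (l y)"
      using k_l[of "- ln x"] k_l[of "- ln y"] xy y0 le by simp_all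
    moreover define P where "P = exp e * (y / x) powr e"
    moreover have "ln P = e * (- ln x - - ln y + 1)"
      using xy y0 by (simp add: P_def ln_mult ln_powr ln_div algebra_simps)
    moreover have "0 < l x" "0 < l y" "0 < P" using l_pos xy y0 le by (auto simp: P_def)
    ultimately have "ln (l x) \<le> ln (P * l y)" "ln (l y) \<le> ln (P * l x)"
      by (auto simp: ln_mult_pos)
    then show ?thesis
      using \<open>0 < l x\<close> \<open>0 < l y\<close> \<open>0 < P\<close> unfolding P_def[symmetric] by simp
  qed
  then show ?thesis using c by (intro exI[of _ x0]) (auto simp: x0_def)
qed

section \<open>Truncated moments of a regularly dominated measure\<close>

lemma nn_integral_even_function:
  fixes f :: "real \<Rightarrow> ennreal"
  assumes f[measurable]: "f \<in> borel_measurable borel"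
  shows "(\<integral>\<^sup>+x. f \<bar>x\<bar> \<partial>lborel) = 2 * (\<integral>\<^sup>+x. f x * indicator {0<..} x \<partial>lborel)"
proof -
  have "(\<integral>\<^sup>+x. f \<bar>x\<bar> \<partial>lborel)
    = (\<integral>\<^sup>+x. f x * indicator {0<..} x + f (- x) * indicator {0<..} (- x) \<partial>lborel)"
    by (intro nn_integral_cong_AE AE_I[where N = "{0}"]) (auto split: split_indicator)
  also have "\<dots> = (\<integral>\<^sup>+x. f x * indicator {0<..} x \<partial>lborel) + (\<integral>\<^sup>+x. f (- x)
      * indicator {0<..} (- x) \<partial>lborel)"
    by (intro nn_integral_add) measurable
  also have "(\<integral>\<^sup>+x. f (- x) * indicator {0<..} (- x) \<partial>lborel) = (\<integral>\<^sup>+x. f x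
      * indicator {0<..} x \<partial>distr lborel borel uminus)"
    by (subst nn_integral_distr) auto
  finally show ?thesis by (simp add: lborel_distr_uminus mult_2)
qed

text \<open>
  The inequality between measures extends from sets to nonnegative functions, and even functions reduce to
  the half-line at the price of the factor \<open>2\<close>.
\<close>

lemma nn_integral_dominated_near_zero:
  fixes \<nu> :: "real measure" and f :: "real \<Rightarrow> ennreal"
  assumes sets: "sets \<nu> = sets borel"
    and dominated: "\<forall>B\<in>sets borel.
      emeasure \<nu> (B \<inter> {x. 0 < \<bar>x\<bar> \<and> \<bar>x\<bar> \<le> c})
        \<le> (\<integral>\<^sup>+x\<in>B \<inter> {x. 0 < \<bar>x\<bar> \<and> \<bar>x\<bar> \<le> c}. ennreal (\<phi> \<bar>x\<bar>) \<partial>lborel)"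
    and \<phi>: "\<phi> \<in> borel_measurable (restrict_space borel {0<..c})"
    and f[measurable]: "f \<in> borel_measurable borel"
  shows "(\<integral>\<^sup>+x. f \<bar>x\<bar> * indicator {0<..c} \<bar>x\<bar> \<partial>\<nu>)
    \<le> 2 * (\<integral>\<^sup>+x. f x * ennreal (\<phi> x) * indicator {0<..c} x \<partial>lborel)"
proof -
  note sets[measurable_cong]
  define \<phi>0 where "\<phi>0 x = (if x \<in> {0<..c} then \<phi> x else 0)" for x
  have \<phi>0[measurable]: "\<phi>0 \<in> borel_measurable borel"
    using \<phi> unfolding \<phi>0_def by (subst (asm) measurable_restrict_space_iff[of _ _ 0]) auto
  let ?N = "density \<nu> (\<lambda>x. indicator {0<..c} \<bar>x\<bar>)" and ?L = "density lborel (\<lambda>x. ennreal (\<phi>0 \<bar>x\<bar>))"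
  have "?N \<le> ?L"
  proof (subst le_measure)
    show "\<forall>B\<in>sets ?N. emeasure ?N B \<le> emeasure ?L B"
    proof
      fix B assume "B \<in> sets ?N"
      then have B[measurable]: "B \<in> sets borel" by (simp add: sets)
      have "emeasure ?N B = (\<integral>\<^sup>+x. indicator {0<..c} \<bar>x\<bar> * indicator B x \<partial>\<nu>)"
        by (rule emeasure_density) (simp_all add: sets)
      also have "\<dots> = (\<integral>\<^sup>+x. indicator (B \<inter> {x. 0 < \<bar>x\<bar> \<and> \<bar>x\<bar> \<le> c}) x \<partial>\<nu>)"
        by (rule nn_integral_cong) (auto split: split_indicator)
      also have "\<dots> = emeasure \<nu> (B \<inter> {x. 0 < \<bar>x\<bar> \<and> \<bar>x\<bar> \<le> c})"
        by (rule nn_integral_indicator) measurable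
      also have "\<dots> \<le> (\<integral>\<^sup>+x\<in>B \<inter> {x. 0 < \<bar>x\<bar> \<and> \<bar>x\<bar> \<le> c}. ennreal (\<phi> \<bar>x\<bar>) \<partial>lborel)"
        using dominated B by blast
      also have "\<dots> = emeasure ?L B"
        by (subst emeasure_density, measurable, rule nn_integral_cong)
            (auto simp: \<phi>0_def split: split_indicator)
      finally show "emeasure ?N B \<le> emeasure ?L B" .
    qed
  qed (simp add: sets)
  have "(\<integral>\<^sup>+x. f \<bar>x\<bar> * indicator {0<..c} \<bar>x\<bar> \<partial>\<nu>) = (\<integral>\<^sup>+x. f \<bar>x\<bar> \<partial>?N)"
    by (subst nn_integral_density) (auto simp: mult.commute)
  also have "\<dots> \<le> (\<integral>\<^sup>+x. f \<bar>x\<bar> \<partial>?L)"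
    by (intro nn_integral_mono_measure \<open>?N \<le> ?L\<close>) (simp add: sets)
  also have "\<dots> = (\<integral>\<^sup>+x. (\<lambda>x. f x * ennreal (\<phi>0 x)) \<bar>x\<bar> \<partial>lborel)"
    by (subst nn_integral_density) (auto simp: mult.commute)
  also have "\<dots> = 2 * (\<integral>\<^sup>+x. f x * ennreal (\<phi>0 x) * indicator {0<..} x \<partial>lborel)"
    by (rule nn_integral_even_function) measurable
  also have "(\<integral>\<^sup>+x. f x * ennreal (\<phi>0 x) * indicator {0<..} x \<partial>lborel) = (\<integral>\<^sup>+x. f x * ennreal (\<phi> x)
      * indicator {0<..c} x \<partial>lborel)"
    by (intro nn_integral_cong) (auto simp: \<phi>0_def split: split_indicator)
  finally show ?thesis .
qed

text \<open>
  Potter's bounds replace \<open>l x\<close> by \<open>l h\<close> at the price of a factor \<open>(h / x)^e\<close> or \<open>(x / h)^e\<close>, and with a small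
  \<open>e\<close> the remaining powers are still integrable at zero and at infinity, respectively.
\<close>

lemma karamata_truncated_moments:
  fixes \<nu> :: "real measure" and \<phi> l :: "real \<Rightarrow> real"
  assumes sets: "sets \<nu> = sets borel"
    and dominated: "\<forall>B\<in>sets borel.
      emeasure \<nu> (B \<inter> {x. 0 < \<bar>x\<bar> \<and> \<bar>x\<bar> \<le> c})
        \<le> (\<integral>\<^sup>+x\<in>B \<inter> {x. 0 < \<bar>x\<bar> \<and> \<bar>x\<bar> \<le> c}. ennreal (\<phi> \<bar>x\<bar>) \<partial>lborel)"
    and rv: "regularly_varying_at_zero c (- (\<beta> + 1)) \<phi>"
    and l: "\<forall>x\<in>{0<..c}. l x = x powr (\<beta> + 1) * \<phi> x"
    and x0: "0 < x0" "x0 \<le> c"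
    and potter: "\<And>x y. 0 < x \<Longrightarrow> x \<le> y \<Longrightarrow> y \<le> x0 \<Longrightarrow>
      l x \<le> exp e * (y / x) powr e * l y \<and> l y \<le> exp e * (y / x) powr e * l x"
    and h: "0 < h" "h \<le> x0"
  shows "\<beta> + e < r \<Longrightarrow> (\<integral>\<^sup>+x. ennreal (\<bar>x\<bar> powr r) * indicator {0<..h} \<bar>x\<bar> \<partial>\<nu>)
      \<le> ennreal (2 * exp e / (r - \<beta> - e) * h powr (r - \<beta>) * l h)" (is "_ \<Longrightarrow> ?small")
    and "q < \<beta> - e \<Longrightarrow> (\<integral>\<^sup>+x. ennreal (\<bar>x\<bar> powr q) * indicator {h<..x0} \<bar>x\<bar> \<partial>\<nu>)
      \<le> ennreal (2 * exp e / (\<beta> - q - e) * h powr (q - \<beta>) * l h)" (is "_ \<Longrightarrow> ?mid")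
proof -
  have \<phi>_meas: "\<phi> \<in> borel_measurable (restrict_space borel {0<..c})"
    and \<phi>_pos: "\<And>x. x \<in> {0<..c} \<Longrightarrow> 0 < \<phi> x"
    using rv by (auto simp: regularly_varying_at_zero_def)
  have lh: "0 < l h" using l h x0 \<phi>_pos by auto
  have density: "x powr s * \<phi> x = x powr (s - \<beta> - 1) * l x" if "x \<in> {0<..c}" for x s
  proof -
    have "x powr s = x powr (s - \<beta> - 1) * x powr (\<beta> + 1)" by (simp flip: powr_add)
    then show ?thesis using that l by simp
  qed
  have compare: "(\<integral>\<^sup>+x. ennreal (\<bar>x\<bar> powr s) * indicator A \<bar>x\<bar> \<partial>\<nu>)
    \<le> 2 * (\<integral>\<^sup>+x. ennreal K * (ennreal (x powr w) * indicator A' x) \<partial>lborel)"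
    if A: "A \<subseteq> {0<..c}" "A \<subseteq> A'" and [measurable]: "A \<in> sets borel" and K: "0 \<le> K"
      and le: "\<And>x. x \<in> A \<Longrightarrow> x powr (s - \<beta> - 1) * l x \<le> K * x powr w" for A A' s K w
  proof -
    have "(\<integral>\<^sup>+x. ennreal (\<bar>x\<bar> powr s) * indicator A \<bar>x\<bar> \<partial>\<nu>)
      = (\<integral>\<^sup>+x. (\<lambda>x. ennreal (x powr s) * indicator A x) \<bar>x\<bar> * indicator {0<..c} \<bar>x\<bar> \<partial>\<nu>)"
      using A by (intro nn_integral_cong) (auto split: split_indicator)
    also have "\<dots> \<le> 2 * (\<integral>\<^sup>+x. (ennreal (x powr s) * indicator A x) * ennreal (\<phi> x)
        * indicator {0<..c} x \<partial>lborel)"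
      by (intro nn_integral_dominated_near_zero[OF sets dominated \<phi>_meas]) measurable
    also have "\<dots> \<le> 2 * (\<integral>\<^sup>+x. ennreal K * (ennreal (x powr w) * indicator A' x) \<partial>lborel)"
    proof (intro mult_left_mono nn_integral_mono)
      fix x
      show "(ennreal (x powr s) * indicator A x) * ennreal (\<phi> x) * indicator {0<..c} x
        \<le> ennreal K * (ennreal (x powr w) * indicator A' x)"
      proof (cases "x \<in> A")
        case True
        then have "x \<in> {0<..c}" "x \<in> A'" using A by auto
        moreover have "ennreal (x powr s) * ennreal (\<phi> x) \<le> ennreal K * ennreal (x powr w)"
          using le[OF True] density[OF \<open>x \<in> {0<..c}\<close>, of s] K \<phi>_pos[OF \<open>x \<in> {0<..c}\<close>]
          by (simp add: ennreal_leI flip: ennreal_mult)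
        ultimately show ?thesis using True by simp
      qed simp
    qed simp
    finally show ?thesis .
  qed
  show ?small if r: "\<beta> + e < r"
  proof -
    have "(\<integral>\<^sup>+x. ennreal (\<bar>x\<bar> powr r) * indicator {0<..h} \<bar>x\<bar> \<partial>\<nu>)
      \<le> 2 * (\<integral>\<^sup>+x. ennreal (exp e * h powr e * l h) * (ennreal (x powr
          (r - \<beta> - 1 - e)) * indicator {0..h} x) \<partial>lborel)"
    proof (rule compare)
      fix x assume x: "x \<in> {0<..h}"
      have "x powr (r - \<beta> - 1) * l x \<le> x powr (r - \<beta> - 1) * (exp e * (h / x) powr e * l h)"
        using potter[of x h] x h by (intro mult_left_mono) auto
      also have "\<dots> = exp e * h powr e * l h * (x powr (r - \<beta> - 1) * x powr - e)"
        using x h by (simp add: powr_divide powr_minus_divide)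
      finally show "x powr (r - \<beta> - 1) * l x \<le> exp e * h powr e * l h * x powr (r - \<beta> - 1 - e)"
        by (simp flip: powr_add)
    qed (use h x0 lh in auto)
    also have "\<dots> = 2 * (ennreal (exp e * h powr e * l h) * (\<integral>\<^sup>+x. ennreal (x powr (r - \<beta> - 1 - e))
        * indicator {0..h} x \<partial>lborel))"
      by (subst nn_integral_cmult) auto
    also have "(\<integral>\<^sup>+x. ennreal (x powr (r - \<beta> - 1 - e)) * indicator {0..h} x \<partial>lborel)
      = ennreal (h powr (r - \<beta> - e) / (r - \<beta> - e))"
      using nn_integral_has_integral_lebesgue'[OF _ has_integral_powr_from_0[of "r - \<beta> - 1 - e" h]] r h
      by (simp add: algebra_simps)
    also have "2 * (ennreal (exp e * h powr e * l h) * ennreal (h powr (r - \<beta> - e) / (r - \<beta> - e)))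
      = ennreal (2 * exp e / (r - \<beta> - e) * (h powr e * h powr (r - \<beta> - e)) * l h)"
      using r lh by (simp del: ennreal_numeral flip: ennreal_mult ennreal_numeral)
    also have "h powr e * h powr (r - \<beta> - e) = h powr (r - \<beta>)" by (simp flip: powr_add)
    finally show ?thesis .
  qed
  show ?mid if q: "q < \<beta> - e"
  proof -
    have "(\<integral>\<^sup>+x. ennreal (\<bar>x\<bar> powr q) * indicator {h<..x0} \<bar>x\<bar> \<partial>\<nu>)
      \<le> 2 * (\<integral>\<^sup>+x. ennreal (exp e * h powr - e * l h) * (ennreal (x powr
          (q - \<beta> - 1 + e)) * indicator {h<..} x) \<partial>lborel)"
    proof (rule compare)
      fix x assume x: "x \<in> {h<..x0}"
      have "x powr (q - \<beta> - 1) * l x \<le> x powr (q - \<beta> - 1) * (exp e * (x / h) powr e * l h)"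
        using potter[of h x] x h by (intro mult_left_mono) auto
      also have "\<dots> = exp e * h powr - e * l h * (x powr (q - \<beta> - 1) * x powr e)"
        using x h by (simp add: powr_divide powr_minus_divide)
      finally show "x powr (q - \<beta> - 1) * l x \<le> exp e * h powr - e * l h * x powr (q - \<beta> - 1 + e)"
        by (simp flip: powr_add)
    qed (use h x0 lh in auto)
    also have "\<dots> = 2 * (ennreal (exp e * h powr - e * l h) * (\<integral>\<^sup>+x. ennreal (x powr (q - \<beta> - 1 + e))
        * indicator {h<..} x \<partial>lborel))"
      by (subst nn_integral_cmult) auto
    also have "(\<integral>\<^sup>+x. ennreal (x powr (q - \<beta> - 1 + e)) * indicator {h<..} x \<partial>lborel)
      = ennreal (h powr (q - \<beta> + e) / (\<beta> - q - e))"
    proof -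
      define z where "z = \<beta> - q - e"
      have z: "q - \<beta> - 1 + e = - z - 1" "q - \<beta> + e = - z" "0 < z" using q by (simp_all add: z_def)
      show ?thesis
        unfolding z(1,2) z_def[symmetric] using z(3) nn_integral_powr_to_infinity[of "- z - 1" h] h
            by simp
    qed
    also have "2 * (ennreal (exp e * h powr - e * l h) * ennreal (h powr (q - \<beta> + e) / (\<beta> - q - e)))
      = ennreal (2 * exp e / (\<beta> - q - e) * (h powr - e * h powr (q - \<beta> + e)) * l h)"
      using q lh by (simp del: ennreal_numeral flip: ennreal_mult ennreal_numeral)
    also have "h powr - e * h powr (q - \<beta> + e) = h powr (q - \<beta>)" by (simp flip: powr_add)
    finally show ?thesis .
  qed
qed

section \<open>Asymptotic rates\<close>

lemma ennreal_bigo_zeroI: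
  assumes le: "\<forall>\<^sub>F t in at_right 0. f t \<le> ennreal (C * g t)" and C: "0 \<le> C"
    and g: "\<forall>\<^sub>F t in at_right 0. 0 \<le> g t"
  shows "ennreal_bigo_zero f g"
  unfolding ennreal_bigo_zero_def
proof
  show "\<forall>\<^sub>F t in at_right 0. f t < \<infinity>"
    using le by eventually_elim (auto intro: le_less_trans)
  have "\<forall>\<^sub>F t in at_right 0. norm (enn2real (f t)) \<le> C * norm (g t)"
    using le g by eventually_elim (use C in \<open>auto simp: enn2real_leI\<close>)
  then show "(\<lambda>t. enn2real (f t)) \<in> O[at_right 0](g)" by (rule bigoI)
qed

lemma ennreal_bigo_zeroE:
  assumes "ennreal_bigo_zero f g"
  obtains C where "0 < C" "\<forall>\<^sub>F t in at_right 0. f t \<le> ennreal (C * \<bar>g t\<bar>)"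
proof -
  obtain C where C: "0 < C" "\<forall>\<^sub>F t in at_right 0. norm (enn2real (f t)) \<le> C * norm (g t)"
    using assms by (auto simp: ennreal_bigo_zero_def elim: landau_o.bigE)
  have "\<forall>\<^sub>F t in at_right 0. f t < \<infinity>" using assms by (simp add: ennreal_bigo_zero_def)
  then have "\<forall>\<^sub>F t in at_right 0. f t \<le> ennreal (C * \<bar>g t\<bar>)"
    using C(2)
  proof eventually_elim
    case (elim t)
    then have "f t = ennreal (enn2real (f t))" by simp
    also have "\<dots> \<le> ennreal (C * \<bar>g t\<bar>)" using elim by (intro ennreal_leI) simp
    finally show ?case .
  qed
  then show thesis using C(1) that by blast
qed

lemma ennreal_bigo_zero_mono:
  assumes "ennreal_bigo_zero f g" and "\<forall>\<^sub>F t in at_right 0. \<bar>g t\<bar> \<le> K * g' t" and "0 \<le> K"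
    and "\<forall>\<^sub>F t in at_right 0. 0 \<le> g' t"
  shows "ennreal_bigo_zero f g'"
proof -
  obtain C where C: "0 < C" and le: "\<forall>\<^sub>F t in at_right 0. f t \<le> ennreal (C * \<bar>g t\<bar>)"
    using assms(1) by (rule ennreal_bigo_zeroE)
  have "\<forall>\<^sub>F t in at_right 0. f t \<le> ennreal (C * K * g' t)"
    using le assms(2)
  proof eventually_elim
    case (elim t)
    have "C * \<bar>g t\<bar> \<le> C * (K * g' t)" using C elim by (intro mult_left_mono) auto
    then show ?case using elim by (auto simp: mult.assoc intro: order_trans ennreal_leI)
  qed
  then show ?thesis using C assms(3,4) by (intro ennreal_bigo_zeroI[where C = "C * K"]) auto
qed

lemma powr_le_interpolate:
  fixes x s s1 s2 :: real
  assumes "0 < x" "s1 \<le> s" "s \<le> s2"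
  shows "x powr s \<le> x powr s1 + x powr s2"
proof (cases "1 \<le> x")
  case True
  then have "x powr s \<le> x powr s2" using assms by (intro powr_mono) auto
  then show ?thesis using powr_ge_zero[of x s1] by linarith
next
  case False
  then have "x powr s \<le> x powr s1" using assms by (intro powr_mono') auto
  then show ?thesis using powr_ge_zero[of x s2] by linarith
qed

text \<open>
  With \<open>h = t^(1/\<beta>)\<close> one has \<open>t h^(s-\<beta>) = t^(s/\<beta>)\<close>, so the power \<open>p / s\<close> produces the factor \<open>t^(p/\<beta>)\<close>
  whatever the value of \<open>s\<close>.
\<close>

lemma scaled_truncated_moment_powr:
  fixes t k L s p \<beta> :: real
  assumes "0 < t" "0 < k" "0 < L" "0 < s" "0 < \<beta>"
  shows "(t * (k * (t powr (1 / \<beta>)) powr (s - \<beta>) * L)) powr (p / s) = k powr (p / s) * (t powr (p / \<beta>)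
      * L powr (p / s))"
proof -
  have "t * (t powr (1 / \<beta>)) powr (s - \<beta>) = t powr (s / \<beta>)"
    using assms by (simp add: powr_powr powr_mult_base field_simps)
  then have eq: "t * (k * (t powr (1 / \<beta>)) powr (s - \<beta>) * L) = k * (t powr (s / \<beta>) * L)"
    by (simp add: mult_ac)
  show ?thesis unfolding eq using assms by (simp add: powr_mult powr_powr)
qed

locale regularly_dominated =
  fixes \<nu> :: "real measure" and \<phi> l l_low :: "real \<Rightarrow> real" and c \<beta> :: real
  assumes sets_\<nu>: "sets \<nu> = sets borel" and c: "0 < c" and \<beta>: "0 < \<beta>"
    and phi: "regularly_varying_at_zero c (- (\<beta> + 1)) \<phi>"
    and dominated: "\<forall>B\<in>sets borel.
      emeasure \<nu> (B \<inter> {x. 0 < \<bar>x\<bar> \<and> \<bar>x\<bar> \<le> c})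
        \<le> (\<integral>\<^sup>+x\<in>B \<inter> {x. 0 < \<bar>x\<bar> \<and> \<bar>x\<bar> \<le> c}. ennreal (\<phi> \<bar>x\<bar>) \<partial>lborel)"
    and l: "\<forall>x\<in>{0<..c}. l x = x powr (\<beta> + 1) * \<phi> x"
    and l_low: "\<forall>x>0. l_low x = l (x powr (1 / \<beta>))"
begin

lemma l_pos: "0 < x \<Longrightarrow> x \<le> c \<Longrightarrow> 0 < l x"
  using l phi by (auto simp: regularly_varying_at_zero_def)

lemma eventually_scale_le:
  assumes "0 < x0"
  shows "\<forall>\<^sub>F t in at_right 0. 0 < t \<and> t \<le> 1 \<and> t powr (1 / \<beta>) \<le> x0"
proof -
  have "\<forall>\<^sub>F t in at_right (0::real). t < min 1 (x0 powr \<beta>)"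
    unfolding eventually_at_right_field using assms by (intro exI[of _ "min 1 (x0 powr \<beta>)"]) auto
  moreover have "\<forall>\<^sub>F t in at_right (0::real). 0 < t" by (simp add: eventually_at_right_less)
  ultimately show ?thesis
  proof eventually_elim
    case (elim t)
    then have "t powr (1 / \<beta>) \<le> (x0 powr \<beta>) powr (1 / \<beta>)"
      using \<beta> by (intro powr_mono2) auto
    then show ?case using elim \<beta> assms by (simp add: powr_powr)
  qed
qed

lemma eventually_l_low_pos: "\<forall>\<^sub>F t in at_right 0. 0 < l_low t"
  using eventually_scale_le[OF c] by eventually_elim (use l_low l_pos in auto)

text \<open>
  A slowly varying function decays at zero more slowly than every power. This makes the contributions of the
  large jumps (\<open>z = 1\<close>) and of a drift (\<open>z = p\<close>, if \<open>\<beta> > 1\<close>) negligible.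
\<close>

lemma power_le_slowly_varying:
  assumes s: "0 < s" and z: "b < z"
  shows "\<exists>K\<ge>0. \<forall>\<^sub>F t in at_right 0. t powr z \<le> K * (t powr b * l_low t powr s)"
proof -
  \<comment> \<open>the exponent for which \<open>(h^e)^s\<close> with \<open>h = t^(1/\<beta>)\<close> is exactly \<open>t^(z-b)\<close>\<close>
  define e where "e = (z - b) * \<beta> / s"
  have e: "0 < e" using s z \<beta> by (simp add: e_def)
  obtain x0 where x0: "0 < x0" "x0 \<le> c" and potter: "\<And>x y. 0 < x \<Longrightarrow> x \<le> y \<Longrightarrow> y \<le> x0 \<Longrightarrow>
      l x \<le> exp e * (y / x) powr e * l y \<and> l y \<le> exp e * (y / x) powr e * l x"
    using regularly_varying_potter_bound[OF phi l e] by blast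
  define k where "k = exp e * x0 powr e / l x0"
  have k: "0 < k" using x0 l_pos[of x0] by (simp add: k_def)
  have "\<forall>\<^sub>F t in at_right 0. t powr z \<le> k powr s * (t powr b * l_low t powr s)"
    using eventually_scale_le[OF x0(1)]
  proof eventually_elim
    case (elim t)
    define h where "h = t powr (1 / \<beta>)"
    have h: "0 < h" "h \<le> x0" using elim by (auto simp: h_def)
    have lh: "0 < l h" "l h = l_low t" using l_pos[of h] h x0 l_low elim by (auto simp: h_def)
    have "l x0 \<le> exp e * (x0 / h) powr e * l h" using potter[of h x0] h by auto
    also have "(x0 / h) powr e = x0 powr e / h powr e" using h x0 by (simp add: powr_divide)
    finally have "h powr e \<le> k * l_low t"
      using h l_pos[of x0] x0 by (simp add: k_def field_simps lh)
    then have "(h powr e) powr s \<le> (k * l_low t) powr s" using s by (intro powr_mono2) auto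
    also have "(h powr e) powr s = t powr (z - b)"
      using \<beta> s by (simp add: h_def powr_powr e_def)
    also have "(k * l_low t) powr s = k powr s * l_low t powr s" using k lh by (simp add: powr_mult)
    finally have "t powr b * t powr (z - b) \<le> t powr b * (k powr s * l_low t powr s)"
      by (intro mult_left_mono) auto
    then show ?case by (simp add: mult_ac flip: powr_add)
  qed
  then show ?thesis by (intro exI[of _ "k powr s"]) simp
qed

lemma truncated_moment_small_jumps:
  assumes r: "\<beta> < r"
  shows "\<exists>K\<ge>0. \<forall>\<^sub>F t in at_right 0. \<exists>A>0.
    (\<integral>\<^sup>+x. ennreal (\<bar>x\<bar> powr r) * indicator {0<..t powr (1 / \<beta>)} \<bar>x\<bar> \<partial>\<nu>) \<le> ennreal A \<and>
    (t * A) powr (p / r) \<le> K * (t powr (p / \<beta>) * l_low t powr (p / r))"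
proof -
  define e where "e = (r - \<beta>) / 2"
  have e: "0 < e" "\<beta> + e < r" using r by (simp_all add: e_def field_simps)
  obtain x0 where x0: "0 < x0" "x0 \<le> c" and potter: "\<And>x y. 0 < x \<Longrightarrow> x \<le> y \<Longrightarrow> y \<le> x0 \<Longrightarrow>
      l x \<le> exp e * (y / x) powr e * l y \<and> l y \<le> exp e * (y / x) powr e * l x"
    using regularly_varying_potter_bound[OF phi l e(1)] by blast
  define k where "k = 2 * exp e / (r - \<beta> - e)"
  have k: "0 < k" using e by (simp add: k_def)
  have "\<forall>\<^sub>F t in at_right 0. \<exists>A>0.
    (\<integral>\<^sup>+x. ennreal (\<bar>x\<bar> powr r) * indicator {0<..t powr (1 / \<beta>)} \<bar>x\<bar> \<partial>\<nu>) \<le> ennreal A \<and>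
    (t * A) powr (p / r) \<le> k powr (p / r) * (t powr (p / \<beta>) * l_low t powr (p / r))"
    using eventually_scale_le[OF x0(1)]
  proof eventually_elim
    case (elim t)
    define h where "h = t powr (1 / \<beta>)"
    have h: "0 < h" "h \<le> x0" using elim by (auto simp: h_def)
    have lh: "0 < l h" "l h = l_low t" using l_pos[of h] h x0 l_low elim by (auto simp: h_def)
    show ?case
    proof (intro exI[of _ "k * h powr (r - \<beta>) * l h"] conjI)
      show "0 < k * h powr (r - \<beta>) * l h" using k h lh by simp
      show "(\<integral>\<^sup>+x. ennreal (\<bar>x\<bar> powr r) * indicator {0<..t powr (1 / \<beta>)} \<bar>x\<bar> \<partial>\<nu>) \<le> ennreal (k
          * h powr (r - \<beta>) * l h)"
        unfolding k_def h_def[symmetric]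
        by (rule karamata_truncated_moments(1)[OF sets_\<nu> dominated phi l x0 potter h e(2)])
      show "(t * (k * h powr (r - \<beta>) * l h)) powr (p / r) \<le> k powr (p / r) * (t powr (p / \<beta>)
          * l_low t powr (p / r))"
        using elim k lh r \<beta> unfolding h_def lh(2)[unfolded h_def]
        by (subst scaled_truncated_moment_powr) auto
    qed
  qed
  then show ?thesis by (intro exI[of _ "k powr (p / r)"]) simp
qed

lemma truncated_moment_intermediate_jumps:
  assumes q: "0 < q" "q < \<beta>"
  shows "\<exists>\<delta> K. 0 < \<delta> \<and> \<delta> \<le> c \<and> 0 \<le> K \<and> (\<forall>\<^sub>F t in at_right 0. \<exists>D>0.
    (\<integral>\<^sup>+x. ennreal (\<bar>x\<bar> powr q) * indicator {t powr (1 / \<beta>)<..\<delta>} \<bar>x\<bar> \<partial>\<nu>) \<le> ennreal D \<and>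
    (t * D) powr (p / q) \<le> K * (t powr (p / \<beta>) * l_low t powr (p / q)))"
proof -
  define e where "e = (\<beta> - q) / 2"
  have e: "0 < e" "q < \<beta> - e" using q by (simp_all add: e_def field_simps)
  obtain x0 where x0: "0 < x0" "x0 \<le> c" and potter: "\<And>x y. 0 < x \<Longrightarrow> x \<le> y \<Longrightarrow> y \<le> x0 \<Longrightarrow>
      l x \<le> exp e * (y / x) powr e * l y \<and> l y \<le> exp e * (y / x) powr e * l x"
    using regularly_varying_potter_bound[OF phi l e(1)] by blast
  define k where "k = 2 * exp e / (\<beta> - q - e)"
  have k: "0 < k" using e by (simp add: k_def)
  have "\<forall>\<^sub>F t in at_right 0. \<exists>D>0.
    (\<integral>\<^sup>+x. ennreal (\<bar>x\<bar> powr q) * indicator {t powr (1 / \<beta>)<..x0} \<bar>x\<bar> \<partial>\<nu>) \<le> ennreal D \<and>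
    (t * D) powr (p / q) \<le> k powr (p / q) * (t powr (p / \<beta>) * l_low t powr (p / q))"
    using eventually_scale_le[OF x0(1)]
  proof eventually_elim
    case (elim t)
    define h where "h = t powr (1 / \<beta>)"
    have h: "0 < h" "h \<le> x0" using elim by (auto simp: h_def)
    have lh: "0 < l h" "l h = l_low t" using l_pos[of h] h x0 l_low elim by (auto simp: h_def)
    show ?case
    proof (intro exI[of _ "k * h powr (q - \<beta>) * l h"] conjI)
      show "0 < k * h powr (q - \<beta>) * l h" using k h lh by simp
      show "(\<integral>\<^sup>+x. ennreal (\<bar>x\<bar> powr q) * indicator {t powr (1 / \<beta>)<..x0} \<bar>x\<bar> \<partial>\<nu>) \<le> ennreal (k
          * h powr (q - \<beta>) * l h)"
        unfolding k_def h_def[symmetric]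
        by (rule karamata_truncated_moments(2)[OF sets_\<nu> dominated phi l x0 potter h e(2)])
      show "(t * (k * h powr (q - \<beta>) * l h)) powr (p / q) \<le> k powr (p / q) * (t powr (p / \<beta>)
          * l_low t powr (p / q))"
        using elim k lh q \<beta> unfolding h_def lh(2)[unfolded h_def]
        by (subst scaled_truncated_moment_powr) auto
    qed
  qed
  then show ?thesis using x0 by (intro exI[of _ x0] exI[of _ "k powr (p / q)"]) simp
qed

end

text \<open>
  The function \<open>g\<close> stands for the order of the small-jump term: it is \<open>l_low t^(p/r)\<close> if \<open>r > \<beta>\<close>, and \<open>1\<close> in the
  boundary case \<open>r = \<beta> = 2\<close>, where the second moment of the small jumps is merely bounded. The threshold \<open>\<delta>\<close>
  comes from Potter's bounds, and the drift to be subtracted may depend on it.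
\<close>

lemma (in levy_process) centered_sup_moment_bigo:
  fixes a p q r :: real and d :: "real \<Rightarrow> real" and g l_low :: "real \<Rightarrow> real"
  assumes dom: "regularly_dominated \<nu> \<phi> l l_low c \<beta>"
    and chars: "has_levy_characteristics M X a 0 \<nu>" and p: "0 < p" "p < 2" "p < \<beta>"
    and moment: "integrable M (\<lambda>\<omega>. \<bar>X 1 \<omega>\<bar> powr p)" and c1: "c \<le> 1"
    and r: "p < r" "r \<le> 2" and q: "p < q" "q \<le> 2" "q < \<beta>"
    and small: "\<exists>K\<ge>0. \<forall>\<^sub>F t in at_right 0. \<exists>A>0.
      (\<integral>\<^sup>+x. ennreal (\<bar>x\<bar> powr r) * indicator {0<..t powr (1 / \<beta>)} \<bar>x\<bar> \<partial>\<nu>) \<le> ennreal A \<and>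
      (t * A) powr (p / r) \<le> K * (t powr (p / \<beta>) * g t)"
    and g: "\<And>t. 0 \<le> g t"
    and w: "w \<in> borel_measurable borel" "\<And>y. \<bar>w y\<bar> \<le> 2 * \<bar>y\<bar> powr r" "\<And>y. \<bar>w y\<bar> \<le> 2 * \<bar>y\<bar> powr q"
    and v: "v \<in> borel_measurable borel" "\<And>y. \<bar>v y\<bar> \<le> \<bar>sin y\<bar>"
    and centering: "\<And>\<delta> u. 0 < \<delta> \<Longrightarrow> \<delta> \<le> 1 \<Longrightarrow> Im (levy_exponent a 0 \<nu> u) + u * d \<delta>
      = - (LINT x|\<nu>. indicator {x. \<bar>x\<bar> \<le> \<delta>} x * w (u * x)) - (LINT x|\<nu>. indicator {x. \<delta> < \<bar>x\<bar>} x * v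
          (u * x))"
  shows "\<exists>\<delta>. ennreal_bigo_zero (sup_moment M (\<lambda>s \<omega>. X s \<omega> - d \<delta> * s) p)
    (\<lambda>t. t powr (p / \<beta>) * (g t + l_low t powr (p / q)))"
proof -
  interpret regularly_dominated \<nu> \<phi> l l_low c \<beta> by (rule dom)
  obtain K1 where K1: "0 \<le> K1" and small': "\<forall>\<^sub>F t in at_right 0. \<exists>A>0.
      (\<integral>\<^sup>+x. ennreal (\<bar>x\<bar> powr r) * indicator {0<..t powr (1 / \<beta>)} \<bar>x\<bar> \<partial>\<nu>) \<le> ennreal A \<and>
      (t * A) powr (p / r) \<le> K1 * (t powr (p / \<beta>) * g t)"
    using small by blast
  obtain \<delta> K2 where \<delta>: "0 < \<delta>" "\<delta> \<le> c" and K2: "0 \<le> K2" and mid: "\<forall>\<^sub>F t in at_right 0. \<exists>D>0.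
    (\<integral>\<^sup>+x. ennreal (\<bar>x\<bar> powr q) * indicator {t powr (1 / \<beta>)<..\<delta>} \<bar>x\<bar> \<partial>\<nu>) \<le> ennreal D \<and>
    (t * D) powr (p / q) \<le> K2 * (t powr (p / \<beta>) * l_low t powr (p / q))"
    using truncated_moment_intermediate_jumps[of q p] p q by auto
  obtain K3 where K3: "0 \<le> K3" and lin: "\<forall>\<^sub>F t in at_right 0. t powr 1 \<le> K3 * (t powr (p / \<beta>)
      * l_low t powr (p / q))"
    using power_le_slowly_varying[of "p / q" "p / \<beta>" 1] p q by auto
  have tail: "(\<integral>\<^sup>+x. ennreal (\<bar>x\<bar> powr p) * indicator {x. \<delta> < \<bar>x\<bar>} x \<partial>\<nu>) < \<infinity>"
    using \<delta> c1 by (intro levy_measure_tail_moment_finite[OF chars p(1,2) moment]) auto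
  obtain C where C: "0 \<le> C" and main: "\<And>t h A D. 0 < t \<Longrightarrow> t \<le> 1 \<Longrightarrow> 0 < A \<Longrightarrow> 0 < D \<Longrightarrow>
    (\<integral>\<^sup>+x. ennreal (\<bar>x\<bar> powr r) * indicator {0<..h} \<bar>x\<bar> \<partial>\<nu>) \<le> ennreal A \<Longrightarrow>
    (\<integral>\<^sup>+x. ennreal (\<bar>x\<bar> powr q) * indicator {h<..\<delta>} \<bar>x\<bar> \<partial>\<nu>) \<le> ennreal D \<Longrightarrow>
    sup_moment M (\<lambda>s \<omega>. X s \<omega> - d \<delta> * s) p t \<le> ennreal (C * ((t * A) powr (p / r) + (t * D) powr
        (p / q) + t))"
    using sup_moment_le_truncated_moments[OF chars p(1,2) r q(1,2) \<delta>(1) tail w v centering] \<delta> c1 by auto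
  define K where "K = K1 + K2 + K3"
  have "\<forall>\<^sub>F t in at_right 0. sup_moment M (\<lambda>s \<omega>. X s \<omega> - d \<delta> * s) p t
    \<le> ennreal ((C * K) * (t powr (p / \<beta>) * (g t + l_low t powr (p / q))))"
    using small' mid lin eventually_scale_le[OF zero_less_one]
  proof eventually_elim
    case (elim t)
    obtain A where A: "0 < A" "(\<integral>\<^sup>+x. ennreal (\<bar>x\<bar> powr r) * indicator {0<..t powr (1 / \<beta>)} \<bar>x\<bar> \<partial>\<nu>)
        \<le> ennreal A"
      "(t * A) powr (p / r) \<le> K1 * (t powr (p / \<beta>) * g t)" using elim by blast
    obtain D where D: "0 < D" "(\<integral>\<^sup>+x. ennreal (\<bar>x\<bar> powr q) * indicator {t powr (1 / \<beta>)<..\<delta>} \<bar>x\<bar> \<partial>\<nu>)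
        \<le> ennreal D"
      "(t * D) powr (p / q) \<le> K2 * (t powr (p / \<beta>) * l_low t powr (p / q))" using elim by blast
    let ?x = "t powr (p / \<beta>) * g t" and ?y = "t powr (p / \<beta>) * l_low t powr (p / q)"
    have x0: "0 \<le> ?x" "0 \<le> ?y" using g by auto
    have "(t * A) powr (p / r) + (t * D) powr (p / q) + t \<le> K1 * ?x + K2 * ?y + K3 * ?y"
      using A D elim by (intro add_mono) auto
    also have "\<dots> \<le> K * ?x + (K2 + K3) * ?y"
      unfolding K_def using x0 K1 K2 K3 by (auto simp: distrib_right intro!: add_mono)
    also have "\<dots> \<le> K * ?x + K * ?y"
      unfolding K_def using x0 K1 K2 K3 by (intro add_left_mono mult_right_mono) auto
    also have "\<dots> = K * (t powr (p / \<beta>) * (g t + l_low t powr (p / q)))" by (simp add: algebra_simps)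
    finally have "C * ((t * A) powr (p / r) + (t * D) powr (p / q) + t)
      \<le> C * (K * (t powr (p / \<beta>) * (g t + l_low t powr (p / q))))" using C by (intro mult_left_mono)
    then have "ennreal (C * ((t * A) powr (p / r) + (t * D) powr (p / q) + t))
      \<le> ennreal ((C * K) * (t powr (p / \<beta>) * (g t + l_low t powr (p / q))))"
      by (simp only: ennreal_leI mult.assoc)
    then show ?case using main[OF _ _ A(1) D(1) A(2) D(2)] elim by (auto intro: order_trans)
  qed
  then have "ennreal_bigo_zero (sup_moment M (\<lambda>s \<omega>. X s \<omega> - d \<delta> * s) p)
    (\<lambda>t. t powr (p / \<beta>) * (g t + l_low t powr (p / q)))"
    by (rule ennreal_bigo_zeroI) (use C K1 K2 K3 g in \<open>auto simp: K_def intro!: always_eventually\<close>)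
  then show ?thesis by blast
qed

lemma (in levy_process) sup_moment_bigo_add_drift:
  assumes p: "0 < p" and bigo: "ennreal_bigo_zero (sup_moment M (\<lambda>s \<omega>. X s \<omega> - d * s) p) g"
    and g: "\<And>t. 0 \<le> g t" and K: "0 \<le> K" "\<forall>\<^sub>F t in at_right 0. t powr p \<le> K * g t"
  shows "ennreal_bigo_zero (sup_moment M X p) g"
proof -
  obtain C where C: "0 < C" and le: "\<forall>\<^sub>F t in at_right 0. sup_moment M (\<lambda>s \<omega>. X s \<omega> - d * s) p t
      \<le> ennreal (C * \<bar>g t\<bar>)"
    using bigo by (rule ennreal_bigo_zeroE)
  have "\<forall>\<^sub>F t in at_right (0::real). 0 < t" by (simp add: eventually_at_right_less)
  then have "\<forall>\<^sub>F t in at_right 0. sup_moment M X p t \<le> ennreal ((2 powr p * (C + \<bar>d\<bar> powr p * K)) * g t)"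
    using le K(2)
  proof eventually_elim
    case (elim t)
    have "(\<bar>d\<bar> * t) powr p \<le> \<bar>d\<bar> powr p * K * g t"
      using elim by (simp add: powr_mult mult.assoc mult_left_mono)
    then have "ennreal ((\<bar>d\<bar> * t) powr p) \<le> ennreal (\<bar>d\<bar> powr p * K * g t)" by (rule ennreal_leI)
    moreover have "sup_moment M X p t
      \<le> ennreal (2 powr p) * (sup_moment M (\<lambda>s \<omega>. X s \<omega> - d * s) p t + ennreal ((\<bar>d\<bar> * t) powr p))"
      by (rule sup_moment_le_remove_drift[OF p elim(1)])
    moreover have "sup_moment M (\<lambda>s \<omega>. X s \<omega> - d * s) p t \<le> ennreal (C * g t)"
      using elim g[of t] by simp
    ultimately have "sup_moment M X p t \<le> ennreal (2 powr p) * (ennreal (C * g t) + ennreal (\<bar>d\<bar> powr p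
        * K * g t))"
      by (meson add_mono mult_left_mono order_trans zero_le)
    also have "\<dots> = ennreal ((2 powr p * (C + \<bar>d\<bar> powr p * K)) * g t)"
      using C K g[of t] by (simp add: distrib_right mult.assoc flip: ennreal_mult ennreal_plus)
    finally show ?case .
  qed
  then show ?thesis by (rule ennreal_bigo_zeroI) (use C K g in auto)
qed

text \<open>
  Powers of the slowly varying factor with exponents between \<open>s\<close> and \<open>q\<close> are dominated by the sum of the
  two extreme powers. Hence exponents closer to each other give the better rate.
\<close>

lemma interpolated_rate_bigo:
  fixes p s s' q q' b :: real
  assumes bigo: "ennreal_bigo_zero f (\<lambda>t. t powr b * (L t powr s' + L t powr q'))"
    and L: "\<forall>\<^sub>F t in at_right 0. 0 < L t" and s: "s \<le> s'" "s' \<le> q" and q: "s \<le> q'" "q' \<le> q"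
  shows "ennreal_bigo_zero f (\<lambda>t. t powr b * (L t powr s + L t powr q))"
proof (rule ennreal_bigo_zero_mono[OF bigo, where K = 2])
  show "\<forall>\<^sub>F t in at_right 0. \<bar>t powr b * (L t powr s' + L t powr q')\<bar> \<le> 2 * (t powr b * (L t powr s
      + L t powr q))"
    using L
  proof eventually_elim
    case (elim t)
    have "L t powr s' + L t powr q' \<le> 2 * (L t powr s + L t powr q)"
      using add_mono[OF powr_le_interpolate[OF elim s] powr_le_interpolate[OF elim q]]
      by (simp only: mult_2)
    then have "t powr b * (L t powr s' + L t powr q') \<le> t powr b * (2 * (L t powr s + L t powr q))"
      by (rule mult_left_mono) simp
    then show ?case by (simp add: mult.left_commute del: distrib_left_numeral)
  qed
qed auto

lemma symmetric_measure_integral_odd: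
  fixes f :: "real \<Rightarrow> real"
  assumes sets: "sets \<nu> = sets borel" and sym: "symmetric_measure \<nu>"
    and f: "f \<in> borel_measurable borel" and odd: "\<And>x. f (- x) = - f x"
  shows "(LINT x|\<nu>. f x) = 0"
proof -
  note sets[measurable_cong]
  have "(LINT x|\<nu>. f x) = (LINT x|distr \<nu> borel uminus. f x)"
    using sym by (simp add: symmetric_measure_def)
  also have "\<dots> = (LINT x|\<nu>. f (- x))" using f by (intro integral_distr) measurable
  also have "\<dots> = - (LINT x|\<nu>. f x)" by (simp add: odd)
  finally show ?thesis by simp
qed

lemma levy_integrable_identity_away:
  assumes \<nu>: "levy_measure \<nu>" and \<delta>: "0 < \<delta>"
  shows "integrable \<nu> (\<lambda>x. indicator {x. \<delta> < \<bar>x\<bar> \<and> \<bar>x\<bar> \<le> 1} x * x)"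
proof -
  have "integrable \<nu> (\<lambda>x. indicator {x. \<delta> < \<bar>x\<bar>} x * (indicator {x. \<bar>x\<bar> \<le> 1} x * x))"
    by (rule levy_integrable_tail[OF \<nu> \<delta>, of _ 1]) (auto split: split_indicator)
  then show ?thesis by (rule back_subst[where P = "integrable \<nu>"]) (auto split: split_indicator)
qed

text \<open>
  Full compensation of the jumps up to \<open>\<delta>\<close> and none of the larger ones; the difference to the compensation up
  to \<open>1\<close> is a drift.
\<close>

lemma levy_exponent_recentered_at_threshold:
  assumes \<nu>: "levy_measure \<nu>" and \<delta>: "0 < \<delta>" "\<delta> \<le> 1"
  shows "Im (levy_exponent a 0 \<nu> u) + u * (a - (LINT x|\<nu>. indicator {x. \<delta> < \<bar>x\<bar> \<and> \<bar>x\<bar> \<le> 1} x * x))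
    = - (LINT x|\<nu>. indicator {x. \<bar>x\<bar> \<le> \<delta>} x * (sin (u * x) - u * x)) -
        (LINT x|\<nu>. indicator {x. \<delta> < \<bar>x\<bar>} x * sin (u * x))"
proof -
  let ?f = "\<lambda>x. sin (u * x) - u * x * indicator {x. \<bar>x\<bar> \<le> 1} x"
  let ?g = "\<lambda>x. u * (indicator {x. \<delta> < \<bar>x\<bar> \<and> \<bar>x\<bar> \<le> 1} x * x)"
  let ?h = "\<lambda>x. indicator {x. \<delta> < \<bar>x\<bar>} x * sin (u * x)"
  let ?k = "\<lambda>x. indicator {x. \<bar>x\<bar> \<le> \<delta>} x * (sin (u * x) - u * x)"
  have f: "integrable \<nu> ?f" by (rule levy_integrable_compensated_sin[OF \<nu>])
  have g: "integrable \<nu> ?g" by (intro integrable_mult_right levy_integrable_identity_away \<nu> \<delta>)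
  have h: "integrable \<nu> ?h" by (rule levy_integrable_tail[OF \<nu> \<delta>(1), of _ 1]) auto
  have "?k = (\<lambda>x. ?f x + ?g x - ?h x)" using \<delta> by (auto split: split_indicator simp: fun_eq_iff)
  then have "(LINT x|\<nu>. ?k x) = (LINT x|\<nu>. ?f x + ?g x - ?h x)" by simp
  also have "\<dots> = (LINT x|\<nu>. ?f x) + (LINT x|\<nu>. ?g x) - (LINT x|\<nu>. ?h x)"
    using f g h
        by (simp only: Bochner_Integration.integral_diff Bochner_Integration.integral_add Bochner_Integration.integrable_add)
  finally show ?thesis
    by (simp add: levy_exponent_Re_Im[OF \<nu>] right_diff_distrib)
qed

lemma levy_exponent_uncompensated:
  assumes \<nu>: "levy_measure \<nu>" and \<delta>: "0 < \<delta>"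
    and int: "integrable \<nu> (\<lambda>x. indicator {x. \<bar>x\<bar> \<le> 1} x * x)"
  shows "Im (levy_exponent a 0 \<nu> u) + u * (a - (LINT x|\<nu>. indicator {x. \<bar>x\<bar> \<le> 1} x * x))
    = - (LINT x|\<nu>. indicator {x. \<bar>x\<bar> \<le> \<delta>} x * sin (u * x)) - (LINT x|\<nu>. indicator {x. \<delta> < \<bar>x\<bar>} x * sin
        (u * x))"
proof -
  let ?f = "\<lambda>x. sin (u * x) - u * x * indicator {x. \<bar>x\<bar> \<le> 1} x"
  let ?g = "\<lambda>x. u * (indicator {x. \<bar>x\<bar> \<le> 1} x * x)"
  let ?h = "\<lambda>x. indicator {x. \<delta> < \<bar>x\<bar>} x * sin (u * x)"
  let ?k = "\<lambda>x. indicator {x. \<bar>x\<bar> \<le> \<delta>} x * sin (u * x)"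
  have f: "integrable \<nu> ?f" by (rule levy_integrable_compensated_sin[OF \<nu>])
  have g: "integrable \<nu> ?g" by (intro integrable_mult_right int)
  have h: "integrable \<nu> ?h" by (rule levy_integrable_tail[OF \<nu> \<delta>(1), of _ 1]) auto
  have "?k = (\<lambda>x. ?f x + ?g x - ?h x)" by (auto split: split_indicator simp: fun_eq_iff)
  then have "(LINT x|\<nu>. ?k x) = (LINT x|\<nu>. ?f x + ?g x - ?h x)" by simp
  also have "\<dots> = (LINT x|\<nu>. ?f x) + (LINT x|\<nu>. ?g x) - (LINT x|\<nu>. ?h x)"
    using f g h
        by (simp only: Bochner_Integration.integral_diff Bochner_Integration.integral_add Bochner_Integration.integrable_add)
  finally show ?thesis
    by (simp add: levy_exponent_Re_Im[OF \<nu>] right_diff_distrib)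
qed

lemma (in regularly_dominated) integrable_identity_near_zero:
  assumes \<nu>: "levy_measure \<nu>" and "\<beta> < 1"
  shows "integrable \<nu> (\<lambda>x. indicator {x. \<bar>x\<bar> \<le> 1} x * x)"
proof -
  note sets_\<nu>[measurable_cong]
  obtain K where K: "\<forall>\<^sub>F t in at_right 0. \<exists>A>0.
    (\<integral>\<^sup>+x. ennreal (\<bar>x\<bar> powr 1) * indicator {0<..t powr (1 / \<beta>)} \<bar>x\<bar> \<partial>\<nu>) \<le> ennreal A \<and>
    (t * A) powr (1 / 1) \<le> K * (t powr (1 / \<beta>) * l_low t powr (1 / 1))"
    using truncated_moment_small_jumps[OF \<open>\<beta> < 1\<close>, of 1] by blast
  have half: "\<forall>\<^sub>F t in at_right 0. 0 < t \<and> t \<le> 1 \<and> t powr (1 / \<beta>) \<le> 1 / 2"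
    by (rule eventually_scale_le) simp
  obtain t where t: "0 < t" "t powr (1 / \<beta>) \<le> 1 / 2" and ex: "\<exists>A>0.
    (\<integral>\<^sup>+x. ennreal (\<bar>x\<bar> powr 1) * indicator {0<..t powr (1 / \<beta>)} \<bar>x\<bar> \<partial>\<nu>) \<le> ennreal A \<and>
    (t * A) powr (1 / 1) \<le> K * (t powr (1 / \<beta>) * l_low t powr (1 / 1))"
    using eventually_happens'[OF trivial_limit_at_right_real eventually_conj[OF half K]] by blast
  obtain A where A: "(\<integral>\<^sup>+x. ennreal (\<bar>x\<bar> powr 1) * indicator {0<..t powr (1 / \<beta>)} \<bar>x\<bar> \<partial>\<nu>) \<le> ennreal A"
    using ex by blast
  define h where "h = t powr (1 / \<beta>)"
  have h: "0 < h" "h < 1" using t by (simp_all add: h_def)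
  have near: "integrable \<nu> (\<lambda>x. indicator {x. \<bar>x\<bar> \<le> h} x * x)"
  proof (rule integrableI_bounded)
    have "(\<integral>\<^sup>+x. ennreal (norm (indicator {x. \<bar>x\<bar> \<le> h} x * x)) \<partial>\<nu>)
      \<le> (\<integral>\<^sup>+x. ennreal (\<bar>x\<bar> powr 1) * indicator {0<..h} \<bar>x\<bar> \<partial>\<nu>)"
      by (intro nn_integral_mono) (auto split: split_indicator)
    also have "\<dots> < \<infinity>"
      using A unfolding h_def[symmetric] by (rule le_less_trans) simp
    finally show "(\<integral>\<^sup>+x. ennreal (norm (indicator {x. \<bar>x\<bar> \<le> h} x * x)) \<partial>\<nu>) < \<infinity>" .
  qed measurable
  have "integrable \<nu> (\<lambda>x. indicator {x. \<bar>x\<bar> \<le> h} x * x + indicator {x. h < \<bar>x\<bar> \<and> \<bar>x\<bar> \<le> 1} x * x)"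
    by (intro Bochner_Integration.integrable_add near levy_integrable_identity_away \<nu> h)
  then show ?thesis
    by (rule back_subst[where P = "integrable \<nu>"])
        (use h in \<open>auto split: split_indicator simp: fun_eq_iff\<close>)
qed

section \<open>Moments of the supremum for small times\<close>

theorem theorem2:
  fixes M :: "'a measure" and X Y :: "real \<Rightarrow> 'a \<Rightarrow> real"
    and \<nu> :: "real measure" and a \<beta> p c :: real and \<phi> l l_low :: "real \<Rightarrow> real"
  assumes levy: "levy_process M X"
    and chars: "has_levy_characteristics M X a 0 \<nu>"
    and index: "\<beta> = levy_index \<nu>" "0 < \<beta>"
    and p: "0 < p" "p < \<beta>"
    and moment: "integrable M (\<lambda>\<omega>. \<bar>X 1 \<omega>\<bar> powr p)"
    and c: "0 < c" "c \<le> 1"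
    and phi: "regularly_varying_at_zero c (- (\<beta> + 1)) \<phi>"
    and dominated: "\<forall>B\<in>sets borel.
      emeasure \<nu> (B \<inter> {x. 0 < \<bar>x\<bar> \<and> \<bar>x\<bar> \<le> c})
        \<le> (\<integral>\<^sup>+x\<in>B \<inter> {x. 0 < \<bar>x\<bar> \<and> \<bar>x\<bar> \<le> c}. ennreal (\<phi> \<bar>x\<bar>) \<partial>lborel)"
    and l: "\<forall>x\<in>{0<..c}. l x = x powr (\<beta> + 1) * \<phi> x"
    and l_locally_bounded: "locally_bounded_on {1 / c..} (\<lambda>x. l (1 / x))"
    and l_low: "\<forall>x>0. l_low x = l (x powr (1 / \<beta>))"
    and Y: "\<forall>t \<omega>. Y t \<omega> = X t \<omega> - t * (a - (LINT x:{x. \<bar>x\<bar> \<le> 1}|\<nu>. x))"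
  shows
    "(1 < \<beta> \<longrightarrow>
        (\<beta> < 2 \<longrightarrow> (\<forall>r\<in>{\<beta><..2}. \<forall>q\<in>{max p 1..<\<beta>}. ennreal_bigo_zero (sup_moment M X p)
           (\<lambda>t. t powr (p / \<beta>) * (l_low t powr (p / r) + l_low t powr (p / q))))) \<and>
        (\<beta> = 2 \<longrightarrow> (\<forall>q\<in>{max p 1..<\<beta>}. ennreal_bigo_zero (sup_moment M X p)
           (\<lambda>t. t powr (p / \<beta>) * (1 + l_low t powr (p / q))))) \<and>
        (symmetric_measure \<nu> \<longrightarrow>
          (\<beta> < 2 \<longrightarrow> (\<forall>r\<in>{\<beta><..2}. \<forall>q\<in>{p..<\<beta>}. ennreal_bigo_zero (sup_moment M X p)
             (\<lambda>t. t powr (p / \<beta>) * (l_low t powr (p / r) + l_low t powr (p / q))))) \<and>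
          (\<beta> = 2 \<longrightarrow> (\<forall>q\<in>{p..<\<beta>}. ennreal_bigo_zero (sup_moment M X p)
             (\<lambda>t. t powr (p / \<beta>) * (1 + l_low t powr (p / q))))))) \<and>
     (\<beta> < 1 \<longrightarrow>
        (\<forall>r\<in>{\<beta><..1}. \<forall>q\<in>{p..<\<beta>}. ennreal_bigo_zero (sup_moment M Y p)
           (\<lambda>t. t powr (p / \<beta>) * (l_low t powr (p / r) + l_low t powr (p / q)))) \<and>
        (symmetric_measure \<nu> \<longrightarrow>
          (\<forall>r\<in>{\<beta><..2}. \<forall>q\<in>{p..<\<beta>}. ennreal_bigo_zero (sup_moment M Y p)
             (\<lambda>t. t powr (p / \<beta>) * (l_low t powr (p / r) + l_low t powr (p / q)))))) \<and>
     (\<beta> = 1 \<and> symmetric_measure \<nu> \<longrightarrow>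
        (\<forall>r\<in>{\<beta><..2}. \<forall>q\<in>{p..<\<beta>}. ennreal_bigo_zero (sup_moment M (\<lambda>s \<omega>. X s \<omega> - a * s) p)
           (\<lambda>t. t powr (p / \<beta>) * (l_low t powr (p / r) + l_low t powr (p / q)))))"
proof -
  interpret levy_process M X by (rule levy)
  have \<nu>: "levy_measure \<nu>" using chars by (simp add: has_levy_characteristics_def)
  have dom: "regularly_dominated \<nu> \<phi> l l_low c \<beta>"
    by (intro regularly_dominated.intro levy_measure_sets[OF \<nu>] c(1) index(2) phi dominated l l_low)
  interpret dom: regularly_dominated \<nu> \<phi> l l_low c \<beta> by (rule dom)
  note L = dom.eventually_l_low_pos
  define rate where "rate r q = (\<lambda>t. t powr (p / \<beta>) * (l_low t powr (p / r)
      + l_low t powr (p / q)))" for r q :: real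
  have rate_weaken: "ennreal_bigo_zero f (rate r q)"
    if "ennreal_bigo_zero f (rate r' q')" "0 < q" "q \<le> q'" "q \<le> r'" "r' \<le> r" "q' \<le> r" for f r q r' q'
  proof -
    have mono: "p / y \<le> p / x" if "0 < x" "x \<le> y" for x y
      using that p by (intro divide_left_mono mult_pos_pos) auto
    show ?thesis
      using that(1) unfolding rate_def
      by (rule interpolated_rate_bigo[where L = l_low and s' = "p / r'" and q' = "p / q'", OF _ L])
        (use that in \<open>simp_all add: mono\<close>)
  qed

  \<comment> \<open>The case \<open>\<beta> > 1\<close>: subtract the drift that recenters at \<open>\<delta>\<close>, and add it again at the cost \<open>t^p\<close>.\<close>
  have above_one: "ennreal_bigo_zero (sup_moment M X p) (\<lambda>t. t powr (p / \<beta>) * (g t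
      + l_low t powr (p / q)))"
    if \<beta>: "1 < \<beta>" "\<beta> \<le> 2" and r: "\<beta> \<le> r" "r \<le> 2" and q: "max p 1 < q" "q < \<beta>"
      and g: "\<And>t. 0 \<le> g t" and small: "\<exists>K\<ge>0. \<forall>\<^sub>F t in at_right 0. \<exists>A>0.
        (\<integral>\<^sup>+x. ennreal (\<bar>x\<bar> powr r) * indicator {0<..t powr (1 / \<beta>)} \<bar>x\<bar> \<partial>\<nu>) \<le> ennreal A \<and>
        (t * A) powr (p / r) \<le> K * (t powr (p / \<beta>) * g t)" for r q g
  proof -
    let ?d = "\<lambda>\<delta>. a - (LINT x|\<nu>. indicator {x. \<delta> < \<bar>x\<bar> \<and> \<bar>x\<bar> \<le> 1} x * x)"
    have "\<exists>\<delta>. ennreal_bigo_zero (sup_moment M (\<lambda>s \<omega>. X s \<omega> - ?d \<delta> * s) p)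
      (\<lambda>t. t powr (p / \<beta>) * (g t + l_low t powr (p / q)))"
    proof (rule centered_sup_moment_bigo[OF dom chars p(1) _ p(2) moment c(2) _ r(2) _ _ q(2) small g,
          where w = "\<lambda>y. sin y - y" and v = sin])
      show "\<bar>sin y - y\<bar> \<le> 2 * \<bar>y\<bar> powr r" for y using r \<beta> by (intro abs_sin_minus_id_le_powr) auto
      show "\<bar>sin y - y\<bar> \<le> 2 * \<bar>y\<bar> powr q" for y using q \<beta> by (intro abs_sin_minus_id_le_powr) auto
      show "Im (levy_exponent a 0 \<nu> u) + u * ?d \<delta> = - (LINT x|\<nu>. indicator {x. \<bar>x\<bar> \<le> \<delta>} x * (sin (u
          * x) - u * x))
        - (LINT x|\<nu>. indicator {x. \<delta> < \<bar>x\<bar>} x * sin (u * x))" if "0 < \<delta>" "\<delta> \<le> 1" for \<delta> u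
        by (rule levy_exponent_recentered_at_threshold[OF \<nu> that])
    qed (use p(2) \<beta> r q in auto)
    then obtain d where d: "ennreal_bigo_zero (sup_moment M (\<lambda>s \<omega>. X s \<omega> - d * s) p)
      (\<lambda>t. t powr (p / \<beta>) * (g t + l_low t powr (p / q)))" by blast
    obtain K where K: "0 \<le> K" and le: "\<forall>\<^sub>F t in at_right 0. t powr p \<le> K * (t powr (p / \<beta>)
        * l_low t powr (p / q))"
    proof -
      have "0 < p / q" "p / \<beta> < p" using p q \<beta> by (auto simp: field_simps)
      then show thesis using that dom.power_le_slowly_varying by blast
    qed
    show ?thesis
    proof (rule sup_moment_bigo_add_drift[OF p(1) d _ K])
      show "\<forall>\<^sub>F t in at_right 0. t powr p \<le> K * (t powr (p / \<beta>) * (g t + l_low t powr (p / q)))"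
        using le
      proof eventually_elim
        case (elim t)
        have "K * (t powr (p / \<beta>) * l_low t powr (p / q)) \<le> K * (t powr (p / \<beta>) * (g t
            + l_low t powr (p / q)))"
          using K g by (intro mult_left_mono) auto
        then show ?case using elim by linarith
      qed
    qed (use g in auto)
  qed

  \<comment> \<open>Strictly larger \<open>q'\<close> is needed in the integrals and gives the better rate.\<close>
  have case_a: "ennreal_bigo_zero (sup_moment M X p) (rate r q)"
    if \<beta>: "1 < \<beta>" "\<beta> < 2" and r: "r \<in> {\<beta><..2}" and q: "q \<in> {p..<\<beta>}" for r q
  proof -
    obtain q' where q': "max (max p 1) q < q'" "q' < \<beta>"
      using dense[of "max (max p 1) q" \<beta>] p \<beta> q by auto
    have "ennreal_bigo_zero (sup_moment M X p) (rate r q')"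
      unfolding rate_def
      by (rule above_one) (use \<beta> r q' dom.truncated_moment_small_jumps[of r p] in auto)
    then show ?thesis by (rule rate_weaken) (use p q q' r in auto)
  qed

  \<comment> \<open>At \<open>\<beta> = 2\<close> the second moment of the small jumps is only bounded, which gives \<open>(t m)^(p/2)\<close>.\<close>
  have case_a2: "ennreal_bigo_zero (sup_moment M X p) (\<lambda>t. t powr (p / \<beta>) * (1 + l_low t powr (p / q)))"
    if \<beta>: "\<beta> = 2" and q: "q \<in> {p..<\<beta>}" for q
  proof -
    obtain q' where q': "max (max p 1) q < q'" "q' < \<beta>"
      using dense[of "max (max p 1) q" \<beta>] p \<beta> q by auto
    define m where "m = 1 + enn2real (\<integral>\<^sup>+x. ennreal (min (x\<^sup>2) 1) \<partial>\<nu>)"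
    have m: "0 < m" by (simp add: m_def add_pos_nonneg)
    have "\<forall>\<^sub>F t in at_right 0. \<exists>A>0.
        (\<integral>\<^sup>+x. ennreal (\<bar>x\<bar> powr 2) * indicator {0<..t powr (1 / \<beta>)} \<bar>x\<bar> \<partial>\<nu>) \<le> ennreal A \<and>
        (t * A) powr (p / 2) \<le> m powr (p / 2) * (t powr (p / \<beta>) * 1)"
      using dom.eventually_scale_le[OF zero_less_one]
    proof eventually_elim
      case (elim t)
      have "(\<integral>\<^sup>+x. ennreal (\<bar>x\<bar> powr 2) * indicator {0<..t powr (1 / \<beta>)} \<bar>x\<bar> \<partial>\<nu>)
        \<le> (\<integral>\<^sup>+x. ennreal (min (x\<^sup>2) 1) \<partial>\<nu>)"
      proof (rule nn_integral_mono)
        fix x :: real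
        show "ennreal (\<bar>x\<bar> powr 2) * indicator {0<..t powr (1 / \<beta>)} \<bar>x\<bar> \<le> ennreal (min (x\<^sup>2) 1)"
        proof (cases "0 < \<bar>x\<bar> \<and> \<bar>x\<bar> \<le> t powr (1 / \<beta>)")
          case True
          then have "x\<^sup>2 \<le> 1" using elim abs_square_le_1[of x] by linarith
          then show ?thesis using True by (simp add: min_def)
        qed (auto split: split_indicator)
      qed
      also have "\<dots> = ennreal (enn2real (\<integral>\<^sup>+x. ennreal (min (x\<^sup>2) 1) \<partial>\<nu>))"
        using \<nu> by (simp add: levy_measure_def)
      also have "\<dots> \<le> ennreal m" by (intro ennreal_leI) (simp add: m_def)
      finally show ?case
        using m elim \<beta> by (intro exI[of _ m]) (simp add: powr_mult)
    qed
    then have small: "\<exists>K\<ge>0. \<forall>\<^sub>F t in at_right 0. \<exists>A>0.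
        (\<integral>\<^sup>+x. ennreal (\<bar>x\<bar> powr 2) * indicator {0<..t powr (1 / \<beta>)} \<bar>x\<bar> \<partial>\<nu>) \<le> ennreal A \<and>
        (t * A) powr (p / 2) \<le> K * (t powr (p / \<beta>) * 1)"
      by (intro exI[of _ "m powr (p / 2)"] conjI powr_ge_zero)
    have "ennreal_bigo_zero (sup_moment M X p) (\<lambda>t. t powr (p / \<beta>) * (1 + l_low t powr (p / q')))"
      by (rule above_one[OF _ _ _ _ _ _ _ small]) (use \<beta> q' in auto)
    then show ?thesis
    proof (rule ennreal_bigo_zero_mono[where K = 2])
      show "\<forall>\<^sub>F t in at_right 0. \<bar>t powr (p / \<beta>) * (1 + l_low t powr (p / q'))\<bar> \<le> 2 * (t powr (p / \<beta>)
          * (1 + l_low t powr (p / q)))"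
        using L
      proof eventually_elim
        case (elim t)
        have double: "1 + x \<le> 2 * (1 + y)" if "x \<le> 1 + y" "0 \<le> y" for x y :: real
          using that by (simp add: distrib_left)
        have "l_low t powr (p / q') \<le> l_low t powr 0 + l_low t powr (p / q)"
          using elim p q q' by (intro powr_le_interpolate) (auto intro: divide_left_mono)
        then have "1 + l_low t powr (p / q') \<le> 2 * (1 + l_low t powr (p / q))"
          using elim by (intro double) simp_all
        then have "t powr (p / \<beta>) * (1 + l_low t powr (p / q')) \<le> t powr (p / \<beta>) * (2 * (1
            + l_low t powr (p / q)))"
          by (rule mult_left_mono) simp
        then show ?case by (simp add: mult.left_commute del: distrib_left_numeral)
      qed
    qed auto
  qed

  have Y_eq: "Y = (\<lambda>s \<omega>. X s \<omega> - (a - (LINT x|\<nu>. indicator {x. \<bar>x\<bar> \<le> 1} x * x)) * s)"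
    using Y by (intro ext) (simp add: set_lebesgue_integral_def mult.commute)
  \<comment> \<open>The bound for \<open>sin\<close> needs exponents at most \<open>1\<close>; \<open>r' = min r 1\<close> suffices as the smaller exponent is better.\<close>
  have case_b: "ennreal_bigo_zero (sup_moment M Y p) (rate r q)"
    if \<beta>: "\<beta> < 1" and r: "r \<in> {\<beta><..2}" and q: "q \<in> {p..<\<beta>}" for r q
  proof -
    obtain q' where q': "q < q'" "q' < \<beta>" using dense[of q \<beta>] q by auto
    define r' where "r' = min r 1"
    have r': "\<beta> < r'" "r' \<le> 1" "r' \<le> r" using r \<beta> by (auto simp: r'_def)
    have "\<exists>\<delta>::real. ennreal_bigo_zero (sup_moment M (\<lambda>s \<omega>. X s \<omega> - (a - (LINT x|\<nu>. indicator {x. \<bar>x\<bar>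
        \<le> 1} x * x)) * s) p)
      (\<lambda>t. t powr (p / \<beta>) * (l_low t powr (p / r') + l_low t powr (p / q')))"
    proof (rule centered_sup_moment_bigo[OF dom chars p(1) _ p(2) moment c(2) _ _ _ _ q'(2)
          dom.truncated_moment_small_jumps[OF r'(1)], where w = sin and v = sin])
      show "\<bar>sin y\<bar> \<le> 2 * \<bar>y\<bar> powr r'" for y using r' index(2) by (intro abs_sin_le_powr) auto
      show "\<bar>sin y\<bar> \<le> 2 * \<bar>y\<bar> powr q'" for y using q q' p \<beta> by (intro abs_sin_le_powr) auto
      show "Im (levy_exponent a 0 \<nu> u) + u * (a - (LINT x|\<nu>. indicator {x. \<bar>x\<bar> \<le> 1} x * x))
        = - (LINT x|\<nu>. indicator {x. \<bar>x\<bar> \<le> \<delta>} x * sin (u * x)) -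
            (LINT x|\<nu>. indicator {x. \<delta> < \<bar>x\<bar>} x * sin (u * x))"
        if "0 < \<delta>" for \<delta> u
        by (rule levy_exponent_uncompensated[OF \<nu> that dom.integrable_identity_near_zero[OF \<nu> \<beta>]])
    qed (use p(2) \<beta> r' q q' in auto)
    then have "ennreal_bigo_zero (sup_moment M Y p) (rate r' q')" unfolding Y_eq rate_def by blast
    then show ?thesis by (rule rate_weaken) (use p q q' r' in auto)
  qed

  \<comment> \<open>By symmetry the imaginary part is a pure drift, so that only \<open>1 - cos\<close> has to be bounded.\<close>
  have case_c: "ennreal_bigo_zero (sup_moment M (\<lambda>s \<omega>. X s \<omega> - a * s) p) (rate r q)"
    if \<beta>: "\<beta> = 1" and sym: "symmetric_measure \<nu>" and r: "r \<in> {\<beta><..2}" and q: "q \<in> {p..<\<beta>}" for r q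
  proof -
    obtain q' where q': "q < q'" "q' < \<beta>" using dense[of q \<beta>] q by auto
    have zero: "(LINT x|\<nu>. sin (u * x) - u * x * indicator {x. \<bar>x\<bar> \<le> 1} x) = 0" for u
      by (rule symmetric_measure_integral_odd[OF levy_measure_sets[OF \<nu>] sym])
          (auto split: split_indicator)
    have "\<exists>\<delta>::real. ennreal_bigo_zero (sup_moment M (\<lambda>s \<omega>. X s \<omega> - a * s) p)
      (\<lambda>t. t powr (p / \<beta>) * (l_low t powr (p / r) + l_low t powr (p / q')))"
    proof (rule centered_sup_moment_bigo[OF dom chars p(1) _ p(2) moment c(2) _ _ _ _ q'(2)
          dom.truncated_moment_small_jumps, where w = "\<lambda>_. 0" and v = "\<lambda>_. 0"])
      show "Im (levy_exponent a 0 \<nu> u) + u * a = - (LINT x|\<nu>. indicator {x. \<bar>x\<bar> \<le> \<delta>} x * 0)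
        - (LINT x|\<nu>. indicator {x. \<delta> < \<bar>x\<bar>} x * 0)" for u \<delta>
        by (simp add: levy_exponent_Re_Im[OF \<nu>] zero)
    qed (use p \<beta> r q q' in auto)
    then have "ennreal_bigo_zero (sup_moment M (\<lambda>s \<omega>. X s \<omega> - a * s) p) (rate r q')"
      unfolding rate_def by blast
    then show ?thesis by (rule rate_weaken) (use p q q' r in auto)
  qed

  show ?thesis
  proof (intro conjI impI ballI)
    show "ennreal_bigo_zero (sup_moment M X p) (\<lambda>t. t powr (p / \<beta>) * (l_low t powr (p / r)
        + l_low t powr (p / q)))"
      if "1 < \<beta>" "\<beta> < 2" "r \<in> {\<beta><..2}" "q \<in> {max p 1..<\<beta>}" for r q
      using case_a[of r q, unfolded rate_def] that by simp
    show "ennreal_bigo_zero (sup_moment M X p) (\<lambda>t. t powr (p / \<beta>) * (1 + l_low t powr (p / q)))"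
      if "\<beta> = 2" "q \<in> {max p 1..<\<beta>}" for q
      using case_a2[of q] that by simp
  qed (use case_a[unfolded rate_def] case_a2 case_b[unfolded rate_def] case_c[unfolded rate_def] in \<open>blast | fastforce\<close>)+
qed

end
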